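(* Let $\{B(t)\}_{t\in[0,1]}$ be a standard one-dimensional Brownian motion, let $a\in\mathbb{R}$, and let $\sigma:\mathbb{R}\to\mathbb{R}$ be a measurable function such that $\sigma$ and $\sigma\sigma'$ are continuously differentiable with bounded derivatives. Let $\{X(t)\}_{t\in[0,1]}$ be the unique strong solution of the It\^o stochastic differential equation $$dX(t)=\sigma(X(t))\,dB(t),\quad t\in\,]0,1],\qquad X(0)=a.$$ For every integer $N\geq 1$ define recursively $x_N(0)=a$ and, for $k\in\{0,\dots,N-1\}$, $$x_N(k+1)=x_N(k)+\frac{\sigma(x_N(k))}{\sigma'(x_N(k))}\left(\exp\left\{\sigma'(x_N(k))\left(B\left(\tfrac{k+1}{N}\right)-B\left(\tfrac{k}{N}\right)\right)-\frac{\sigma'(x_N(k))^2}{2N}\right\}-1\right),$$ where, if $\sigma'(x_N(k))=0$, the second summand on the right-hand side is understood as $\sigma(x_N(k))\left(B\left(\tfrac{k+1}{N}\right)-B\left(\tfrac{k}{N}\right)\right)$. Then: (1) There exists a positive constant $\mathtt{c}$, independent of $N$, such that for all integers $N\geq 1$ $$\mathbb{E}[|X(1)-x_N(N)|]\leq\frac{\mathtt{c}}{N}.$$ (2) If moreover $\sigma$ is linear, i.e. $\sigma(x)=\alpha x$ for all $x\in\mathbb{R}$ and some $\alpha\in\mathbb{R}$, then for all integers $N\geq 1$ the sequence $\{x_N(k)\}_{k\in\{0,\dots,N\}}$ coincides (almost surely) with $\{X\left(\tfrac{k}{N}\right)\}_{k\in\{0,\dots,N\}}$.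
   Context: The paper writes the scheme with the Wick exponential $\exp^{\diamond}\left\{\sigma'(x_N(k))\left(B\left(\frac{k+1}{N}\right)-B\left(\frac{k}{N}\right)\right)\right\}$, which is by definition shorthand for $\exp\left\{\sigma'(x_N(k))\left(B\left(\frac{k+1}{N}\right)-B\left(\frac{k}{N}\right)\right)-\frac{\sigma'(x_N(k))^2}{2N}\right\}$. The convention for $\sigma'(x_N(k))=0$ comes from the series expansion of the increment: with $\Delta=B\left(\frac{k+1}{N}\right)-B\left(\frac{k}{N}\right)$, the increment equals $\sigma(x_N(k))\sum_{j\geq1}\frac{\sigma'(x_N(k))^{j-1}}{j!}\Delta^{\diamond j}$. Here $\Delta^{\diamond j}$ is the $j$-th Wick power, i.e. $\Delta^{\diamond j}=N^{-j/2}\,\mathrm{He}_j(\sqrt{N}\Delta)$ with $\mathrm{He}_j$ the monic (probabilists') Hermite polynomial of degree $j$; in particular $\Delta^{\diamond 1}=\Delta$. When $\sigma'(x_N(k))=0$ only the $j=1$ term remains. *)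

theory Defs
  imports "HOL-Probability.Probability"
begin

text \<open>Standard one-dimensional Brownian motion on [0, 1]; values of B outside [0, 1] play no role.
  The starting point and path continuity are only required almost surely.\<close>

definition brownian_motion :: "'w measure \<Rightarrow> (real \<Rightarrow> 'w \<Rightarrow> real) \<Rightarrow> bool" where
  "brownian_motion M B \<longleftrightarrow>
     prob_space M \<and>
     (\<forall>t\<in>{0..1}. B t \<in> borel_measurable M) \<and>
     (AE \<omega> in M. B 0 \<omega> = 0) \<and>
     (\<forall>n \<tau>. (\<forall>i\<le>n. \<tau> i \<in> {0..1}) \<and> (\<forall>i<n. \<tau> i \<le> \<tau> (Suc i)) \<longrightarrow>
        prob_space.indep_vars M (\<lambda>_. borel) (\<lambda>i \<omega>. B (\<tau> (Suc i)) \<omega> - B (\<tau> i) \<omega>) {..<n}) \<and>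
     (\<forall>s t. 0 \<le> s \<and> s < t \<and> t \<le> 1 \<longrightarrow>
        distributed M lborel (\<lambda>\<omega>. B t \<omega> - B s \<omega>) (normal_density 0 (sqrt (t - s)))) \<and>
     (AE \<omega> in M. continuous_on {0..1} (\<lambda>t. B t \<omega>))"

text \<open>The filtration generated by B, augmented by the null sets of M. If M is complete this is the
  usual augmentation; in general it keeps every member a sub-sigma-algebra of M. Only the sets and
  the space of these measures matter.\<close>

definition brownian_filtration ::
    "'w measure \<Rightarrow> (real \<Rightarrow> 'w \<Rightarrow> real) \<Rightarrow> real \<Rightarrow> 'w measure" where
  "brownian_filtration M B t =
     sigma (space M)
       ({B s -` A \<inter> space M | s A. s \<in> {0..t} \<and> A \<in> sets borel} \<union> null_sets M)"

definition progressively_measurable ::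
    "(real \<Rightarrow> 'w measure) \<Rightarrow> real \<Rightarrow> (real \<Rightarrow> 'w \<Rightarrow> real) \<Rightarrow> bool" where
  "progressively_measurable F T H \<longleftrightarrow>
     (\<forall>t\<in>{0..T}. (\<lambda>(s, \<omega>). H s \<omega>) \<in> borel_measurable (restrict_space borel {0..t} \<Otimes>\<^sub>M F t))"

text \<open>Simple integrands on [0, T]: the sum over i < n of xi i times the indicator of the interval
  from tau i (excluded) to tau (i + 1) (included), with xi i bounded and known at time tau i.\<close>

definition simple_data ::
    "'w measure \<Rightarrow> (real \<Rightarrow> 'w measure) \<Rightarrow> real \<Rightarrow> nat \<Rightarrow> (nat \<Rightarrow> real) \<Rightarrow> (nat \<Rightarrow> 'w \<Rightarrow> real) \<Rightarrow> bool"
  where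
  "simple_data M F T n \<tau> \<xi> \<longleftrightarrow>
     (\<forall>i\<le>n. \<tau> i \<in> {0..T}) \<and> (\<forall>i<n. \<tau> i \<le> \<tau> (Suc i)) \<and>
     (\<forall>i<n. \<xi> i \<in> borel_measurable (F (\<tau> i)) \<and> (\<exists>C. \<forall>\<omega>\<in>space M. \<bar>\<xi> i \<omega>\<bar> \<le> C))"

definition simple_process ::
    "nat \<Rightarrow> (nat \<Rightarrow> real) \<Rightarrow> (nat \<Rightarrow> 'w \<Rightarrow> real) \<Rightarrow> real \<Rightarrow> 'w \<Rightarrow> real" where
  "simple_process n \<tau> \<xi> s \<omega> = (\<Sum>i<n. \<xi> i \<omega> * indicator {\<tau> i<..\<tau> (Suc i)} s)"

definition simple_integral ::
    "(real \<Rightarrow> 'w \<Rightarrow> real) \<Rightarrow> nat \<Rightarrow> (nat \<Rightarrow> real) \<Rightarrow> (nat \<Rightarrow> 'w \<Rightarrow> real) \<Rightarrow> 'w \<Rightarrow> real" where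
  "simple_integral B n \<tau> \<xi> \<omega> = (\<Sum>i<n. \<xi> i \<omega> * (B (\<tau> (Suc i)) \<omega> - B (\<tau> i) \<omega>))"

text \<open>The random variable I is (a version of) the Ito integral of H with respect to B over [0, T].
  This is the integral for progressively measurable H whose square is almost surely integrable in
  time; no moments of H are required. It is the limit in probability of integrals of simple
  integrands approximating H in the sense that the time integral of the squared error tends to 0
  in probability. Non-negative Lebesgue integrals are used so that a divergent time integral is
  infinite instead of 0.\<close>

definition has_ito_integral ::
    "'w measure \<Rightarrow> (real \<Rightarrow> 'w measure) \<Rightarrow> (real \<Rightarrow> 'w \<Rightarrow> real) \<Rightarrow> (real \<Rightarrow> 'w \<Rightarrow> real) \<Rightarrow> real
      \<Rightarrow> ('w \<Rightarrow> real) \<Rightarrow> bool" where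
  "has_ito_integral M F B H T I \<longleftrightarrow>
     progressively_measurable F T H \<and>
     (AE \<omega> in M. (\<integral>\<^sup>+s\<in>{0..T}. ennreal ((H s \<omega>)\<^sup>2) \<partial>lborel) < \<infinity>) \<and>
     I \<in> borel_measurable M \<and>
     (\<exists>n \<tau> \<xi>.
        (\<forall>m. simple_data M F T (n m) (\<tau> m) (\<xi> m)) \<and>
        (\<forall>\<epsilon>>0. (\<lambda>m. measure M {\<omega>\<in>space M.
            (\<integral>\<^sup>+s\<in>{0..T}. ennreal ((H s \<omega> - simple_process (n m) (\<tau> m) (\<xi> m) s \<omega>)\<^sup>2) \<partial>lborel)
              > ennreal \<epsilon>}) \<longlonglongrightarrow> 0) \<and>
        (\<forall>\<epsilon>>0. (\<lambda>m. measure M {\<omega>\<in>space M.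
            \<bar>simple_integral B (n m) (\<tau> m) (\<xi> m) \<omega> - I \<omega>\<bar> > \<epsilon>}) \<longlonglongrightarrow> 0))"

text \<open>Strong solution on [0, 1] of dX = sigma(X) dB, X(0) = a: adapted to the augmented filtration
  of the given B, with almost surely continuous paths, satisfying the integral equation.\<close>

definition strong_solution ::
    "'w measure \<Rightarrow> (real \<Rightarrow> 'w \<Rightarrow> real) \<Rightarrow> (real \<Rightarrow> real) \<Rightarrow> real \<Rightarrow> (real \<Rightarrow> 'w \<Rightarrow> real) \<Rightarrow> bool" where
  "strong_solution M B \<sigma> a X \<longleftrightarrow>
     (\<forall>t\<in>{0..1}. X t \<in> borel_measurable (brownian_filtration M B t)) \<and>
     (AE \<omega> in M. continuous_on {0..1} (\<lambda>t. X t \<omega>)) \<and>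
     (AE \<omega> in M. X 0 \<omega> = a) \<and>
     (\<forall>t\<in>{0..1}. has_ito_integral M (brownian_filtration M B) B
        (\<lambda>s \<omega>. \<sigma> (X s \<omega>)) t (\<lambda>\<omega>. X t \<omega> - a))"

definition C1_bounded_deriv :: "(real \<Rightarrow> real) \<Rightarrow> bool" where
  "C1_bounded_deriv f \<longleftrightarrow>
     (\<forall>x. f differentiable (at x)) \<and> continuous_on UNIV (deriv f) \<and> bounded (range (deriv f))"

primrec scheme ::
    "(real \<Rightarrow> 'w \<Rightarrow> real) \<Rightarrow> (real \<Rightarrow> real) \<Rightarrow> real \<Rightarrow> nat \<Rightarrow> nat \<Rightarrow> 'w \<Rightarrow> real" where
  "scheme B \<sigma> a N 0 = (\<lambda>\<omega>. a)"
| "scheme B \<sigma> a N (Suc k) = (\<lambda>\<omega>.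
     let x = scheme B \<sigma> a N k \<omega>;
         \<Delta> = B (real (k + 1) / real N) \<omega> - B (real k / real N) \<omega>
     in x + (if deriv \<sigma> x = 0 then \<sigma> x * \<Delta>
             else \<sigma> x / deriv \<sigma> x * (exp (deriv \<sigma> x * \<Delta> - (deriv \<sigma> x)\<^sup>2 / (2 * real N)) - 1)))"

end

theory Submission
  imports Defs
begin

text \<open>
  On a step of length h = 1/N started at the value x, the scheme is the value at the end of the step
  of dZ = D dB with D_s = \<sigma>(x) exp(\<sigma>'(x) b_s - \<sigma>'(x)^2 s / 2), where b is the
  increment of B since the beginning of the step. Solution and scheme are therefore both stochastic
  integrals, and by the Ito isometry the mean square of their difference grows at the rate E
  |\<sigma>(X_s) - D_s|^2. To first order, \<sigma>(X_s) is \<sigma>(X_0) + \<sigma>(X_0)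
  \<sigma>'(X_0) b_s and D_s is \<sigma>(x) + \<sigma>(x) \<sigma>'(x) b_s. Because \<sigma> and
  \<sigma> \<sigma>' are Lipschitz, the two main parts differ by at most a multiple of X_0 - x; if
  the two remainders are O(h) in mean square norm, a Gronwall argument makes the accumulated error
  O(1/N).

  The remainder of \<sigma> is the delicate one, since \<sigma>'' need not be bounded or even exist.
  The lemma taylor_remainder_bound estimates it by (X_s - X_0)^2 / |\<sigma>(X_0)|, and this is
  enough: the fourth moment of X_s - X_0 is of order h^2 \<sigma>(X_0)^4, so that the singular
  weight cancels.

  To make these moments accessible, the solution is replaced by its Euler scheme on a grid of mesh
  1/(NP) with P \<ge> N, and every moment is computed by integrating out one Gaussian increment at a
  time (nn_integral_increment, an instance of Fubini). All integrands are squares, so the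
  computation takes place in the non-negative Lebesgue integral, where an infinite moment is a
  legitimate value. The locale euler_block compares one step of the scheme with P Euler steps. The
  resulting bound does not depend on P; by Fatou's lemma it passes to the solution once the Euler
  schemes are known to converge to it in probability.

  That convergence has to be extracted from the bare definition of the Ito integral as a limit in
  probability. The Lenglart inequality, proved by stopping a sum before its quadratic variation
  exceeds a threshold, shows that the choice of the approximating simple integrands is irrelevant,
  and so that the integral of a continuous adapted process is the limit of its Riemann sums
  (riemann_sums_tendsto_ito_integral). Nothing is known about the moments of X at this stage.
  Indicators of the events on which the path has stayed in a bounded set so far replace stopping
  times: they decrease in time, so they may be moved inside a stochastic sum (localized_isometry),
  and what remains is the usual Gronwall argument for the Euler scheme.

  If \<sigma> is linear, a step of the scheme multiplies by a geometric Brownian motion factor, and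
  the values at a fixed time agree for all refinements of the grid. The error for N is then bounded
  by the error for every multiple of N, hence it vanishes.
\<close>

section \<open>Gaussian integrals\<close>

text \<open>
  The parameter is the variance, so that the increment of B from s to t has the law gauss (t - s).
\<close>

definition gauss :: "real \<Rightarrow> real measure" where
  "gauss v = density lborel (\<lambda>x. ennreal (normal_density 0 (sqrt v) x))"

lemma sets_gauss [measurable_cong, simp]: "sets (gauss v) = sets borel"
  and space_gauss [simp]: "space (gauss v) = UNIV"
  by (simp_all add: gauss_def)

lemma prob_space_gauss: "0 < v \<Longrightarrow> prob_space (gauss v)"
  unfolding gauss_def by (rule prob_space_normal_density) simp

lemma has_bochner_integral_gauss:
  fixes f :: "real \<Rightarrow> real"
  assumes [measurable]: "f \<in> borel_measurable borel"
    and "has_bochner_integral lborel (\<lambda>x. normal_density 0 (sqrt v) x * f x) I"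
  shows "has_bochner_integral (gauss v) f I"
  unfolding gauss_def
  by (rule has_bochner_integral_density) (use assms in auto)

lemma gauss_moments:
  assumes v: "0 < v"
  shows "has_bochner_integral (gauss v) (\<lambda>x. 1 :: real) 1"
    and "has_bochner_integral (gauss v) (\<lambda>x. x) 0"
    and "has_bochner_integral (gauss v) (\<lambda>x. x^2) v"
    and "has_bochner_integral (gauss v) (\<lambda>x. x^3) 0"
    and "has_bochner_integral (gauss v) (\<lambda>x. x^4) (3 * v^2)"
proof -
  have s: "0 < sqrt v" using v by simp
  note ev = normal_moment_even[OF s, of 0] and od = normal_moment_odd[OF s, of 0]
  show "has_bochner_integral (gauss v) (\<lambda>x. 1 :: real) 1"
    by (rule has_bochner_integral_gauss) (use ev[of 0] in auto)
  show "has_bochner_integral (gauss v) (\<lambda>x. x) 0"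
    by (rule has_bochner_integral_gauss) (use od[of 0] in auto)
  show "has_bochner_integral (gauss v) (\<lambda>x. x^2) v"
    by (rule has_bochner_integral_gauss) (use ev[of 1] v in auto)
  show "has_bochner_integral (gauss v) (\<lambda>x. x^3) 0"
    by (rule has_bochner_integral_gauss) (use od[of 1] in \<open>auto simp: eval_nat_numeral\<close>)
  have "fact (2 * 2) / ((2 / (sqrt v)\<^sup>2) ^ 2 * fact 2) = 3 * v^2"
    using v by (simp add: field_simps power2_eq_square fact_numeral)
  then show "has_bochner_integral (gauss v) (\<lambda>x. x^4) (3 * v^2)"
    by (intro has_bochner_integral_gauss) (use ev[of 2] in \<open>simp_all\<close>)
qed

text \<open>
  Multiplying the centred density by the Wick exponential only shifts it to mean c v (the
  Cameron-Martin formula), so both integrals are read off from a normal density.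
\<close>

lemma gauss_exp_moments:
  fixes c v :: real
  assumes v: "0 < v"
  shows "has_bochner_integral (gauss v) (\<lambda>x. exp (c * x - c^2 * v / 2)) 1"
    and "has_bochner_integral (gauss v) (\<lambda>x. x * exp (c * x - c^2 * v / 2)) (c * v)"
proof -
  have s: "0 < sqrt v" using v by simp
  have eq: "normal_density 0 (sqrt v) x * exp (c * x - c^2 * v / 2) = normal_density (c * v) (sqrt v) x" for x
  proof -
    have "- x\<^sup>2 / (2 * v) + (c * x - c^2 * v / 2) = - (x - c * v)\<^sup>2 / (2 * v)"
      using v by (simp add: field_simps power2_eq_square)
    then show ?thesis
      using v by (simp add: normal_density_def exp_add[symmetric])
  qed
  show "has_bochner_integral (gauss v) (\<lambda>x. exp (c * x - c^2 * v / 2)) 1"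
    by (rule has_bochner_integral_gauss)
       (use normal_moment_even[OF s, of "c * v" 0] in \<open>simp_all add: eq\<close>)
  have "normal_density 0 (sqrt v) x * (x * exp (c * x - c^2 * v / 2)) = normal_density (c * v) (sqrt v) x * x" for x
    by (simp add: eq[symmetric] ac_simps)
  then show "has_bochner_integral (gauss v) (\<lambda>x. x * exp (c * x - c^2 * v / 2)) (c * v)"
    by (intro has_bochner_integral_gauss)
       (use normal_moment_nz_1[OF s, of "c * v"] in \<open>simp_all only:, auto\<close>)
qed

lemma gauss_exp_square:
  fixes c v :: real
  assumes v: "0 < v"
  shows "has_bochner_integral (gauss v) (\<lambda>x. (exp (c * x - c^2 * v / 2))^2) (exp (c^2 * v))"
proof -
  have "(exp (c * x - c^2 * v / 2))^2 = exp (c^2 * v) * exp ((2*c) * x - (2*c)^2 * v / 2)" for x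
    by (simp add: power2_eq_square exp_add[symmetric] algebra_simps)
  then show ?thesis
    using has_bochner_integral_mult_right[OF gauss_exp_moments(1)[OF v, of "2*c"], of "exp (c^2 * v)"]
    by simp
qed

lemma nn_integral_has_bochner:
  assumes "has_bochner_integral M f I" "\<And>x. 0 \<le> f x"
  shows "(\<integral>\<^sup>+x. ennreal (f x) \<partial>M) = ennreal I"
  using assms by (simp add: has_bochner_integral_iff nn_integral_eq_integral)

lemma gauss_affine_square:
  assumes v: "0 < v"
  shows "(\<integral>\<^sup>+x. ennreal ((u + s * x)^2) \<partial>gauss v) = ennreal (u^2 + v * s^2)"
proof (rule nn_integral_has_bochner)
  note m = gauss_moments[OF v]
  have "has_bochner_integral (gauss v) (\<lambda>x. u^2 * 1 + (2*u * s) * x + s^2 * x^2) (u^2 * 1 + (2*u * s) * 0 + s^2 * v)"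
    by (intro has_bochner_integral_add has_bochner_integral_mult_right m)
  moreover have "u^2 * 1 + (2*u * s) * x + s^2 * x^2 = (u + s * x)^2" for x
    by algebra
  ultimately show "has_bochner_integral (gauss v) (\<lambda>x. (u + s * x)^2) (u^2 + v * s^2)"
    by (simp add: ac_simps)
qed auto

lemma gauss_affine_fourth:
  assumes v: "0 < v"
  shows "(\<integral>\<^sup>+x. ennreal ((u + s * x)^4) \<partial>gauss v) = ennreal (u^4 + 6 * v * u^2 * s^2 + 3 * v^2 * s^4)"
proof (rule nn_integral_has_bochner)
  note m = gauss_moments[OF v]
  have "has_bochner_integral (gauss v) (\<lambda>x. u^4 * 1 + (4*u^3 * s) * x + (6*u^2 * s^2) * x^2 + (4*u * s^3) * x^3 + s^4 * x^4)
     (u^4 * 1 + (4*u^3 * s) * 0 + (6*u^2 * s^2) * v + (4*u * s^3) * 0 + s^4 * (3 * v^2))"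
    by (intro has_bochner_integral_add has_bochner_integral_mult_right m)
  moreover have "u^4 * 1 + (4*u^3 * s) * x + (6*u^2 * s^2) * x^2 + (4*u * s^3) * x^3 + s^4 * x^4 = (u + s * x)^4" for x
    by algebra
  ultimately show "has_bochner_integral (gauss v) (\<lambda>x. (u + s * x)^4) (u^4 + 6 * v * u^2 * s^2 + 3 * v^2 * s^4)"
    by (simp add: ac_simps)
qed auto

text \<open>
  All mean squares that involve the scheme are instances of this one quadratic expansion.
\<close>

lemma gauss_affine_exp_square:
  fixes c v p q d :: real
  assumes v: "0 < v"
  shows "(\<integral>\<^sup>+x. ennreal ((p + q * x + d * exp (c * x - c^2 * v / 2))^2) \<partial>gauss v)
     = ennreal (p^2 + v * q^2 + d^2 * exp (c^2 * v) + 2*p*d + 2*q*d*c * v)"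
proof (rule nn_integral_has_bochner)
  note m = gauss_moments[OF v] gauss_exp_moments[OF v, of c] gauss_exp_square[OF v, of c]
  define E where "E = (\<lambda>x. exp (c * x - c^2 * v / 2))"
  have "has_bochner_integral (gauss v) (\<lambda>x. p^2 * 1 + (2*p*q) * x + q^2 * x^2 + d^2 * (E x)^2 + (2*p*d) * E x + (2*q*d) * (x * E x))
     (p^2 * 1 + (2*p*q) * 0 + q^2 * v + d^2 * exp (c^2 * v) + (2*p*d) * 1 + (2*q*d) * (c * v))"
    unfolding E_def by (intro has_bochner_integral_add has_bochner_integral_mult_right m)
  moreover have "p^2 * 1 + (2*p*q) * x + q^2 * x^2 + d^2 * (E x)^2 + (2*p*d) * E x + (2*q*d) * (x * E x)
      = (p + q * x + d * E x)^2" for x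
    by algebra
  ultimately show "has_bochner_integral (gauss v) (\<lambda>x. (p + q * x + d * exp (c * x - c^2 * v / 2))^2)
      (p^2 + v * q^2 + d^2 * exp (c^2 * v) + 2*p*d + 2*q*d*c * v)"
    by (simp add: ac_simps E_def)
qed auto

section \<open>The increment of the scheme\<close>

text \<open>
  The increment of the scheme for \<sigma>(x) = s, \<sigma>'(x) = c and a Brownian increment x over
  a time of length v. In the series of Wick powers the limit c \<rightarrow> 0 is the linear term.
\<close>

definition wick_step :: "real \<Rightarrow> real \<Rightarrow> real \<Rightarrow> real \<Rightarrow> real" where
  "wick_step s c x v = (if c = 0 then s * x else s / c * (exp (c * x - c^2 * v / 2) - 1))"

lemma wick_step_zero [simp]: "wick_step s c 0 0 = 0"
  by (simp add: wick_step_def)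

lemma wick_step_minus: "wick_step (- s) c x v = - wick_step s c x v"
  by (simp add: wick_step_def)

lemma wick_step_measurable [measurable (raw)]:
  assumes [measurable]: "s \<in> borel_measurable M" "c \<in> borel_measurable M" "x \<in> borel_measurable M"
  shows "(\<lambda>\<omega>. wick_step (s \<omega>) (c \<omega>) (x \<omega>) v) \<in> borel_measurable M"
  unfolding wick_step_def by measurable

text \<open>
  The flow property: a step over two consecutive intervals is a step over the first one, followed by
  a step over the second one whose coefficient has been multiplied by the Wick exponential of the
  first. This is what makes the scheme computable on a finer grid than its own.
\<close>

lemma wick_step_add:
  "wick_step s c (x + y) (t + v) = wick_step s c x t + wick_step (s * exp (c * x - c^2 * t / 2)) c y v"
proof (cases "c = 0")
  case False
  have "exp (c * (x + y) - c^2 * (t + v) / 2) = exp (c * x - c^2 * t / 2) * exp (c * y - c^2 * v / 2)"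
    by (simp add: exp_add[symmetric] algebra_simps add_divide_distrib)
  with False show ?thesis by (simp add: wick_step_def right_diff_distrib left_diff_distrib)
qed (simp add: wick_step_def algebra_simps)

text \<open>
  The bound exp x - 1 \<le> x exp x, a form of 1 - x \<le> exp (-x), is used twice: exp x - 1 - x
  \<le> x (exp x - 1) \<le> x^2 exp x.
\<close>

lemma exp_minus_quadratic_le:
  fixes x :: real
  assumes "0 \<le> x"
  shows "exp x - 1 - x \<le> x^2 * exp x"
proof -
  have "1 + (-x) \<le> exp (-x)" by (rule exp_ge_add_one_self)
  then have a: "1 - exp (-x) \<le> x" by simp
  have "exp x - 1 = exp x * (1 - exp (-x))"
    by (simp add: algebra_simps exp_minus)
  also have "\<dots> \<le> exp x * x" using a by simp
  finally have b: "exp x - 1 \<le> exp x * x" .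
  have "x * (exp x - 1) \<le> x * (exp x * x)"
    using b assms by (rule mult_left_mono)
  with b show ?thesis
    by (simp add: algebra_simps power2_eq_square)
qed

text \<open>
  The mean square after one increment of the difference between an Euler step with coefficient s and
  a scheme step with coefficient D. The increment of the scheme and its linear part differ by a
  variable of mean zero that is uncorrelated with x, so the mean square is exactly e^2 + v (s - D)^2
  plus the variance of that variable, which is of second order in v.
\<close>

lemma gauss_wick_step_square:
  fixes c v s D e :: real
  assumes v: "0 < v"
  shows "(\<integral>\<^sup>+x. ennreal ((e + s * x - wick_step D c x v)^2) \<partial>gauss v)
     \<le> ennreal (e^2 + v * (s - D)^2 + c^2 * v^2 * exp (c^2 * v) * D^2)"
proof (cases "c = 0")
  case True
  then have *: "e + s * x - wick_step D c x v = e + (s - D) * x" for x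
    by (simp add: wick_step_def algebra_simps)
  show ?thesis unfolding *
    by (simp only: gauss_affine_square[OF v]) (simp add: True)
next
  case False
  have "e + s * x - wick_step D c x v = (e + D/c) + s * x + (- D/c) * exp (c * x - c^2 * v / 2)" for x
    using False by (simp add: wick_step_def field_simps)
  then have "(\<integral>\<^sup>+x. ennreal ((e + s * x - wick_step D c x v)^2) \<partial>gauss v)
     = ennreal ((e + D/c)^2 + v * s^2 + (- D/c)^2 * exp (c^2 * v) + 2*(e + D/c)*(- D/c) + 2 * s*(- D/c)*c * v)"
    by (simp only: gauss_affine_exp_square[OF v])
  also have "(e + D/c)^2 + v * s^2 + (- D/c)^2 * exp (c^2 * v) + 2*(e + D/c)*(- D/c) + 2 * s*(- D/c)*c * v
     = e^2 + v * (s - D)^2 + (D/c)^2 * (exp (c^2 * v) - 1 - c^2 * v)"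
    using False by (simp add: field_simps power2_eq_square)
  also have "ennreal \<dots> \<le> ennreal (e^2 + v * (s - D)^2 + (D/c)^2 * ((c^2 * v)^2 * exp (c^2 * v)))"
    using exp_minus_quadratic_le[of "c^2 * v"] v
    by (intro ennreal_leI add_mono order_refl mult_left_mono) auto
  also have "(D/c)^2 * ((c^2 * v)^2 * exp (c^2 * v)) = c^2 * v^2 * exp (c^2 * v) * D^2"
    using False by (simp add: field_simps power2_eq_square)
  finally show ?thesis .
qed

text \<open>
  The chaos components of order at least two of a Wick exponential have total variance exp (c^2 v) -
  1 - c^2 v.
\<close>

lemma gauss_exp_remainder_square:
  fixes c v :: real
  assumes v: "0 < v"
  shows "(\<integral>\<^sup>+x. ennreal ((1 + c * x - exp (c * x - c^2 * v / 2))^2) \<partial>gauss v)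
     \<le> ennreal (c^4 * v^2 * exp (c^2 * v))"
proof -
  have "(\<integral>\<^sup>+x. ennreal ((1 + c * x - exp (c * x - c^2 * v / 2))^2) \<partial>gauss v)
     = ennreal (exp (c^2 * v) - 1 - c^2 * v)"
    using gauss_affine_exp_square[OF v, of 1 c "-1" c] by (simp add: power2_eq_square algebra_simps)
  also have "\<dots> \<le> ennreal ((c^2 * v)^2 * exp (c^2 * v))"
    using exp_minus_quadratic_le[of "c^2 * v"] v by (intro ennreal_leI) auto
  also have "(c^2 * v)^2 * exp (c^2 * v) = c^4 * v^2 * exp (c^2 * v)" by (simp add: power_mult_distrib)
  finally show ?thesis .
qed

section \<open>First-order expansion without a second derivative\<close>

text \<open>
  Formally the remainder is \<sigma>'' (y - x)^2 / 2, and only \<sigma> \<sigma>'' is bounded, as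
  the difference of (\<sigma> \<sigma>')' and \<sigma>'^2. If y is so close to x that \<sigma>
  changes by at most half of |\<sigma>(x)| between them, then \<sigma>(x) is comparable with
  \<sigma>(\<xi>) at the intermediate point, and the Lipschitz bounds of \<sigma> \<sigma>' and
  \<sigma> control \<sigma>(\<xi>) (\<sigma>'(\<xi>) - \<sigma>'(x)). Otherwise |\<sigma>(x)| is
  itself bounded by a multiple of |y - x|, and the crude bound 2 L |y - x| of the remainder
  suffices.
\<close>

lemma taylor_remainder_bound:
  fixes \<sigma> \<sigma>' :: "real \<Rightarrow> real"
  assumes d: "\<And>x. (\<sigma> has_real_derivative \<sigma>' x) (at x)"
    and L: "\<And>x. \<bar>\<sigma>' x\<bar> \<le> L"
    and g: "\<And>x y. \<bar>\<sigma> x * \<sigma>' x - \<sigma> y * \<sigma>' y\<bar> \<le> K * \<bar>x - y\<bar>"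
    and lip: "\<And>x y. \<bar>\<sigma> x - \<sigma> y\<bar> \<le> L * \<bar>x - y\<bar>"
    and K: "0 \<le> K" and Lp: "0 \<le> L"
  shows "\<bar>\<sigma> x\<bar> * \<bar>\<sigma> y - \<sigma> x - \<sigma>' x * (y - x)\<bar> \<le> (6 * L^2 + 2 * K) * (y - x)^2"
proof (cases "\<bar>\<sigma> x\<bar> \<le> 2 * L * \<bar>y - x\<bar>")
  case True
  have "\<bar>\<sigma> y - \<sigma> x - \<sigma>' x * (y - x)\<bar> \<le> \<bar>\<sigma> y - \<sigma> x\<bar> + \<bar>\<sigma>' x\<bar> * \<bar>y - x\<bar>"
    by (metis abs_mult abs_triangle_ineq4)
  also have "\<dots> \<le> L * \<bar>y - x\<bar> + L * \<bar>y - x\<bar>"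
    by (intro add_mono lip mult_right_mono L) auto
  finally have "\<bar>\<sigma> y - \<sigma> x - \<sigma>' x * (y - x)\<bar> \<le> 2 * L * \<bar>y - x\<bar>" by simp
  then have "\<bar>\<sigma> x\<bar> * \<bar>\<sigma> y - \<sigma> x - \<sigma>' x * (y - x)\<bar> \<le> (2 * L * \<bar>y - x\<bar>) * (2 * L * \<bar>y - x\<bar>)"
    using True Lp by (intro mult_mono) auto
  also have "\<dots> = 4 * L^2 * (y - x)^2" by (simp add: power2_eq_square abs_mult_self_eq algebra_simps)
  also have "\<dots> \<le> (6 * L^2 + 2 * K) * (y - x)^2" using K by (intro mult_right_mono) auto
  finally show ?thesis .
next
  case False
  have "\<exists>\<xi>. \<bar>\<xi> - x\<bar> \<le> \<bar>y - x\<bar> \<and> \<sigma> y - \<sigma> x = \<sigma>' \<xi> * (y - x)"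
  proof (cases x y rule: linorder_cases)
    case less
    from MVT2[OF less, of \<sigma> \<sigma>'] d obtain z where "x < z" "z < y" "\<sigma> y - \<sigma> x = (y - x) * \<sigma>' z"
      by auto
    then show ?thesis by (intro exI[of _ z]) (auto simp: ac_simps)
  next
    case equal then show ?thesis by (intro exI[of _ x]) auto
  next
    case greater
    from MVT2[OF greater, of \<sigma> \<sigma>'] d obtain z where "y < z" "z < x" "\<sigma> x - \<sigma> y = (x - y) * \<sigma>' z"
      by auto
    then show ?thesis by (intro exI[of _ z]) (auto simp: algebra_simps)
  qed
  then obtain \<xi> where xi: "\<bar>\<xi> - x\<bar> \<le> \<bar>y - x\<bar>" and mv: "\<sigma> y - \<sigma> x = \<sigma>' \<xi> * (y - x)" by auto
  have R: "\<sigma> y - \<sigma> x - \<sigma>' x * (y - x) = (\<sigma>' \<xi> - \<sigma>' x) * (y - x)"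
    unfolding mv by (simp add: algebra_simps)
  have "\<bar>\<sigma> \<xi> - \<sigma> x\<bar> \<le> L * \<bar>y - x\<bar>"
    using lip[of \<xi> x] mult_left_mono[OF xi Lp] by linarith
  then have half: "\<bar>\<sigma> x\<bar> \<le> 2 * \<bar>\<sigma> \<xi>\<bar>" using False by linarith
  have "\<sigma> \<xi> * (\<sigma>' \<xi> - \<sigma>' x) = (\<sigma> \<xi> * \<sigma>' \<xi> - \<sigma> x * \<sigma>' x) - \<sigma>' x * (\<sigma> \<xi> - \<sigma> x)"
    by (simp add: algebra_simps)
  then have "\<bar>\<sigma> \<xi>\<bar> * \<bar>\<sigma>' \<xi> - \<sigma>' x\<bar> \<le> \<bar>\<sigma> \<xi> * \<sigma>' \<xi> - \<sigma> x * \<sigma>' x\<bar> + \<bar>\<sigma>' x\<bar> * \<bar>\<sigma> \<xi> - \<sigma> x\<bar>"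
    by (metis abs_mult abs_triangle_ineq4)
  also have "\<dots> \<le> K * \<bar>\<xi> - x\<bar> + L * (L * \<bar>\<xi> - x\<bar>)"
    using Lp by (intro add_mono g mult_mono L lip) auto
  also have "\<dots> = (K + L^2) * \<bar>\<xi> - x\<bar>" by (simp add: algebra_simps power2_eq_square)
  also have "\<dots> \<le> (K + L^2) * \<bar>y - x\<bar>" using xi K by (intro mult_left_mono) auto
  finally have a: "\<bar>\<sigma> \<xi>\<bar> * \<bar>\<sigma>' \<xi> - \<sigma>' x\<bar> \<le> (K + L^2) * \<bar>y - x\<bar>" .
  have "\<bar>\<sigma> x\<bar> * \<bar>\<sigma>' \<xi> - \<sigma>' x\<bar> \<le> (2 * \<bar>\<sigma> \<xi>\<bar>) * \<bar>\<sigma>' \<xi> - \<sigma>' x\<bar>"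
    by (intro mult_right_mono half) auto
  also have "\<dots> \<le> 2 * ((K + L^2) * \<bar>y - x\<bar>)" using a by simp
  finally have "\<bar>\<sigma> x\<bar> * \<bar>\<sigma>' \<xi> - \<sigma>' x\<bar> * \<bar>y - x\<bar> \<le> 2 * ((K + L^2) * \<bar>y - x\<bar>) * \<bar>y - x\<bar>"
    by (rule mult_right_mono) auto
  also have "\<dots> = 2 * (K + L^2) * (y - x)^2" by (simp add: power2_eq_square algebra_simps)
  also have "\<dots> \<le> (6 * L^2 + 2 * K) * (y - x)^2" using K by (intro mult_right_mono) auto
  finally show ?thesis unfolding R by (simp add: abs_mult mult.assoc)
qed

section \<open>Gronwall inequalities\<close>

text \<open>
  The values of A are moments, which are a priori possibly infinite; their finiteness is part of the
  conclusion.
\<close>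

lemma gronwall_sum_ennreal:
  fixes A :: "nat \<Rightarrow> ennreal"
  assumes nn: "0 \<le> \<alpha>" "0 \<le> \<beta>"
    and A: "\<And>i. i \<le> n \<Longrightarrow> A i \<le> (\<Sum>j<i. ennreal \<alpha> + ennreal \<beta> * A j)"
  shows "i \<le> n \<Longrightarrow> A i \<le> ennreal (real i * \<alpha> * (1 + \<beta>) ^ i)"
proof (induction i rule: less_induct)
  case (less i)
  have "A i \<le> (\<Sum>j<i. ennreal \<alpha> + ennreal \<beta> * A j)" using A less.prems by simp
  also have "\<dots> \<le> (\<Sum>j<i. ennreal (\<alpha> + \<beta> * (real i * \<alpha> * (1 + \<beta>) ^ j)))"
  proof (rule sum_mono)
    fix j assume "j \<in> {..<i}"
    then have j: "j < i" by simp
    have "A j \<le> ennreal (real j * \<alpha> * (1 + \<beta>) ^ j)" using less j by simp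
    also have "\<dots> \<le> ennreal (real i * \<alpha> * (1 + \<beta>) ^ j)"
      using j nn by (intro ennreal_leI mult_right_mono) auto
    finally have "ennreal \<alpha> + ennreal \<beta> * A j \<le> ennreal \<alpha> + ennreal \<beta> * ennreal (real i * \<alpha> * (1 + \<beta>) ^ j)"
      by (intro add_left_mono mult_left_mono) auto
    also have "\<dots> = ennreal (\<alpha> + \<beta> * (real i * \<alpha> * (1 + \<beta>) ^ j))"
      using nn by (simp add: ennreal_plus ennreal_mult)
    finally show "ennreal \<alpha> + ennreal \<beta> * A j \<le> ennreal (\<alpha> + \<beta> * (real i * \<alpha> * (1 + \<beta>) ^ j))" .
  qed
  also have "\<dots> = ennreal (\<Sum>j<i. \<alpha> + \<beta> * (real i * \<alpha> * (1 + \<beta>) ^ j))"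
    using nn by (intro sum_ennreal) auto
  also have "(\<Sum>j<i. \<alpha> + \<beta> * (real i * \<alpha> * (1 + \<beta>) ^ j)) = real i * \<alpha> + real i * \<alpha> * (\<beta> * (\<Sum>j<i. (1 + \<beta>) ^ j))"
    by (simp add: sum.distrib sum_distrib_left mult.assoc mult.left_commute)
  also have "\<beta> * (\<Sum>j<i. (1 + \<beta>) ^ j) = (1 + \<beta>) ^ i - 1"
    using power_diff_1_eq[of "1 + \<beta>" i] by simp
  finally show ?case by (simp add: algebra_simps)
qed

text \<open>
  The form used on a block of P steps of length 1/n: the result carries the length P/n of the block
  as a factor.
\<close>

lemma gronwall_step_ennreal:
  fixes f :: "nat \<Rightarrow> ennreal"
  assumes nn: "0 \<le> \<alpha>" "0 \<le> \<beta>" and n: "0 < n" and P: "P \<le> n"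
    and f0: "f 0 = 0"
    and step: "\<And>j. j < P \<Longrightarrow> f (Suc j) \<le> f j + (ennreal (\<alpha> / real n) + ennreal (\<beta> / real n) * f j)"
    and j: "j \<le> P"
  shows "f j \<le> ennreal (real P / real n * \<alpha> * exp \<beta>)"
proof -
  have sum: "f i \<le> (\<Sum>j<i. ennreal (\<alpha> / real n) + ennreal (\<beta> / real n) * f j)" if "i \<le> P" for i
    using that
  proof (induction i)
    case (Suc i)
    have "f (Suc i) \<le> f i + (ennreal (\<alpha> / real n) + ennreal (\<beta> / real n) * f i)" using step[of i] Suc.prems by simp
    also have "\<dots> \<le> (\<Sum>j<i. ennreal (\<alpha> / real n) + ennreal (\<beta> / real n) * f j) + (ennreal (\<alpha> / real n) + ennreal (\<beta> / real n) * f i)"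
      using Suc by (intro add_right_mono) simp
    finally show ?case by simp
  qed (simp add: f0)
  have "f j \<le> ennreal (real j * (\<alpha> / real n) * (1 + \<beta> / real n) ^ j)"
    by (rule gronwall_sum_ennreal[OF _ _ sum j]) (use nn in auto)
  also have "\<dots> \<le> ennreal (real P / real n * \<alpha> * exp \<beta>)"
  proof (rule ennreal_leI)
    have "(1 + \<beta> / real n) ^ j \<le> (1 + \<beta> / real n) ^ n" using j P nn by (intro power_increasing) auto
    also have "\<dots> \<le> exp (\<beta> / real n) ^ n" using nn by (intro power_mono exp_ge_add_one_self) auto
    also have "\<dots> = exp \<beta>" using n by (simp add: exp_of_nat_mult[symmetric])
    finally have e: "(1 + \<beta> / real n) ^ j \<le> exp \<beta>" .
    have "real j * (\<alpha> / real n) \<le> real P * (\<alpha> / real n)" using j nn by (intro mult_right_mono) auto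
    then have "real j * (\<alpha> / real n) * (1 + \<beta> / real n) ^ j \<le> real P * (\<alpha> / real n) * exp \<beta>"
      using e nn j by (intro mult_mono) auto
    then show "real j * (\<alpha> / real n) * (1 + \<beta> / real n) ^ j \<le> real P / real n * \<alpha> * exp \<beta>" by simp
  qed
  finally show ?thesis .
qed

lemma ennreal_add_mult:
  assumes "0 \<le> p" "0 \<le> a" "0 \<le> b"
  shows "ennreal p + ennreal a * ennreal b = ennreal (p + a * b)"
  using assms by (simp add: ennreal_plus ennreal_mult)

lemma ennreal_add_mult_mult:
  assumes "0 \<le> p" "0 \<le> a" "0 \<le> b" "0 \<le> c" "0 \<le> d"
  shows "ennreal p + ennreal a * ennreal b + ennreal c * ennreal d = ennreal (p + a * b + c * d)"
  using assms by (simp add: ennreal_plus ennreal_mult)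

section \<open>Mean squares and convergence in probability\<close>

lemma square_diff_le: "(x - y)^2 \<le> 2 * (z - x)^2 + 2 * (z - y)^2" for x y z :: real
proof -
  have "2 * (z - x)^2 + 2 * (z - y)^2 - (x - y)^2 = (2*z - x - y)^2" by (simp add: power2_eq_square algebra_simps)
  then show ?thesis by (smt (verit) zero_le_power2)
qed

context prob_space
begin

text \<open>
  The mean square, as a non-negative integral: it is infinite, and not a default value, if the
  second moment does not exist.
\<close>

definition sqmean :: "('a \<Rightarrow> real) \<Rightarrow> ennreal" where
  "sqmean f = (\<integral>\<^sup>+\<omega>. ennreal ((f \<omega>)^2) \<partial>M)"

lemma sqmean_mono: "(\<And>\<omega>. \<omega> \<in> space M \<Longrightarrow> \<bar>f \<omega>\<bar> \<le> \<bar>g \<omega>\<bar>) \<Longrightarrow> sqmean f \<le> sqmean g"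
  unfolding sqmean_def by (intro nn_integral_mono ennreal_leI) (simp add: abs_le_square_iff)

lemma sqmean_bounded: "(\<And>\<omega>. \<omega> \<in> space M \<Longrightarrow> \<bar>f \<omega>\<bar> \<le> c) \<Longrightarrow> sqmean f \<le> ennreal (c^2)"
proof -
  assume a: "\<And>\<omega>. \<omega> \<in> space M \<Longrightarrow> \<bar>f \<omega>\<bar> \<le> c"
  have "sqmean f \<le> (\<integral>\<^sup>+\<omega>. ennreal (c^2) \<partial>M)"
    unfolding sqmean_def
  proof (intro nn_integral_mono ennreal_leI)
    fix \<omega> assume "\<omega> \<in> space M"
    from a[OF this] have "\<bar>f \<omega>\<bar> \<le> \<bar>c\<bar>" by linarith
    then show "(f \<omega>)^2 \<le> c^2" by (simp add: abs_le_square_iff)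
  qed
  then show ?thesis by (simp add: emeasure_space_1)
qed

lemma sqmean_cmult: "f \<in> borel_measurable M \<Longrightarrow> sqmean (\<lambda>\<omega>. c * f \<omega>) = ennreal (c^2) * sqmean f"
  unfolding sqmean_def by (simp add: power_mult_distrib ennreal_mult' nn_integral_cmult)

lemma sqmean_le_cmult:
  assumes [measurable]: "g \<in> borel_measurable M"
    and le: "\<And>\<omega>. \<omega> \<in> space M \<Longrightarrow> \<bar>f \<omega>\<bar> \<le> c * \<bar>g \<omega>\<bar>" and g: "sqmean g \<le> ennreal q" and q: "0 \<le> q"
  shows "sqmean f \<le> ennreal (c^2 * q)"
proof -
  have "sqmean f \<le> sqmean (\<lambda>\<omega>. c * g \<omega>)"
  proof (rule sqmean_mono)
    fix \<omega> assume "\<omega> \<in> space M"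
    have "c * \<bar>g \<omega>\<bar> \<le> \<bar>c\<bar> * \<bar>g \<omega>\<bar>" by (intro mult_right_mono) auto
    then show "\<bar>f \<omega>\<bar> \<le> \<bar>c * g \<omega>\<bar>" using le[OF \<open>\<omega> \<in> space M\<close>] by (simp add: abs_mult)
  qed
  also have "\<dots> = ennreal (c^2) * sqmean g" by (rule sqmean_cmult) measurable
  also have "\<dots> \<le> ennreal (c^2) * ennreal q" using g by (rule mult_left_mono) simp
  also have "\<dots> = ennreal (c^2 * q)" by (rule ennreal_mult'[symmetric]) simp
  finally show ?thesis .
qed

lemma sqmean_add:
  assumes [measurable]: "f \<in> borel_measurable M" "g \<in> borel_measurable M"
  shows "sqmean (\<lambda>\<omega>. f \<omega> + g \<omega>) \<le> 2 * sqmean f + 2 * sqmean g"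
proof -
  have "sqmean (\<lambda>\<omega>. f \<omega> + g \<omega>) \<le> (\<integral>\<^sup>+\<omega>. 2 * ennreal ((f \<omega>)^2) + 2 * ennreal ((g \<omega>)^2) \<partial>M)"
    unfolding sqmean_def
  proof (rule nn_integral_mono)
    fix \<omega>
    have "ennreal ((f \<omega> + g \<omega>)\<^sup>2) \<le> ennreal (2 * (f \<omega>)\<^sup>2 + 2 * (g \<omega>)\<^sup>2)"
      using square_diff_le[of "f \<omega>" "- g \<omega>" 0] by (intro ennreal_leI) auto
    then show "ennreal ((f \<omega> + g \<omega>)\<^sup>2) \<le> 2 * ennreal ((f \<omega>)\<^sup>2) + 2 * ennreal ((g \<omega>)\<^sup>2)"
      by (simp add: ennreal_plus ennreal_mult)
  qed
  also have "\<dots> = 2 * sqmean f + 2 * sqmean g"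
    by (simp add: nn_integral_add nn_integral_cmult sqmean_def)
  finally show ?thesis .
qed

lemma sqmean_add_le:
  assumes "f \<in> borel_measurable M" "g \<in> borel_measurable M"
    and "sqmean f \<le> ennreal p" "sqmean g \<le> ennreal q" "0 \<le> p" "0 \<le> q"
  shows "sqmean (\<lambda>\<omega>. f \<omega> + g \<omega>) \<le> ennreal (2 * p + 2 * q)"
proof -
  have "sqmean (\<lambda>\<omega>. f \<omega> + g \<omega>) \<le> 2 * sqmean f + 2 * sqmean g" by (rule sqmean_add[OF assms(1,2)])
  also have "\<dots> \<le> 2 * ennreal p + 2 * ennreal q" using assms by (intro add_mono mult_left_mono) auto
  also have "\<dots> = ennreal (2 * p + 2 * q)" using assms by (simp add: ennreal_plus ennreal_mult)
  finally show ?thesis .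
qed

lemma chebyshev_sqmean:
  assumes [measurable]: "f \<in> borel_measurable M" and f: "sqmean f \<le> ennreal c" and c: "0 \<le> c" and e: "0 < \<epsilon>"
  shows "prob {\<omega>\<in>space M. \<epsilon> < \<bar>f \<omega>\<bar>} \<le> c / \<epsilon>^2"
proof -
  have "ennreal (\<epsilon>^2) * emeasure M {\<omega>\<in>space M. \<epsilon> < \<bar>f \<omega>\<bar>} = (\<integral>\<^sup>+\<omega>. ennreal (\<epsilon>^2) * indicator {\<omega>\<in>space M. \<epsilon> < \<bar>f \<omega>\<bar>} \<omega> \<partial>M)"
    by (subst nn_integral_cmult_indicator) auto
  also have "\<dots> \<le> sqmean f"
    unfolding sqmean_def
    using e by (intro nn_integral_mono) (auto simp: indicator_def abs_le_square_iff[symmetric] intro!: ennreal_leI)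
  also note f
  finally have "ennreal (\<epsilon>^2 * prob {\<omega>\<in>space M. \<epsilon> < \<bar>f \<omega>\<bar>}) \<le> ennreal c"
    by (simp add: emeasure_eq_measure ennreal_mult')
  then show ?thesis using e c by (simp add: field_simps)
qed

definition tendsto_prob :: "(nat \<Rightarrow> 'a \<Rightarrow> real) \<Rightarrow> ('a \<Rightarrow> real) \<Rightarrow> bool" where
  "tendsto_prob Y Z \<longleftrightarrow> (\<forall>\<epsilon>>0. (\<lambda>p. prob {\<omega>\<in>space M. \<epsilon> < \<bar>Y p \<omega> - Z \<omega>\<bar>}) \<longlonglongrightarrow> 0)"

lemma tendsto_probD:
  "tendsto_prob Y Z \<Longrightarrow> 0 < \<epsilon> \<Longrightarrow> (\<lambda>p. prob {\<omega>\<in>space M. \<epsilon> < \<bar>Y p \<omega> - Z \<omega>\<bar>}) \<longlonglongrightarrow> 0"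
  by (simp add: tendsto_prob_def)

lemma tendsto_prob_diff:
  assumes m [measurable]: "\<And>p. Y p \<in> borel_measurable M" "\<And>p. Y' p \<in> borel_measurable M"
    "Z \<in> borel_measurable M" "Z' \<in> borel_measurable M"
    and Y: "tendsto_prob Y Z" and Y': "tendsto_prob Y' Z'"
  shows "tendsto_prob (\<lambda>p \<omega>. Y p \<omega> - Y' p \<omega>) (\<lambda>\<omega>. Z \<omega> - Z' \<omega>)"
  unfolding tendsto_prob_def
proof (intro allI impI)
  fix \<epsilon> :: real assume e: "0 < \<epsilon>"
  let ?b = "\<lambda>p. prob {\<omega>\<in>space M. \<epsilon>/2 < \<bar>Y p \<omega> - Z \<omega>\<bar>} + prob {\<omega>\<in>space M. \<epsilon>/2 < \<bar>Y' p \<omega> - Z' \<omega>\<bar>}"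
  have lim: "?b \<longlonglongrightarrow> 0"
    using tendsto_add[OF tendsto_probD[OF Y half_gt_zero[OF e]] tendsto_probD[OF Y' half_gt_zero[OF e]]]
    by (simp only: add_0_right)
  have "prob {\<omega>\<in>space M. \<epsilon> < \<bar>Y p \<omega> - Y' p \<omega> - (Z \<omega> - Z' \<omega>)\<bar>} \<le> ?b p" for p
  proof -
    have "\<epsilon>/2 < \<bar>Y p \<omega> - Z \<omega>\<bar> \<or> \<epsilon>/2 < \<bar>Y' p \<omega> - Z' \<omega>\<bar>" if "\<epsilon> < \<bar>Y p \<omega> - Y' p \<omega> - (Z \<omega> - Z' \<omega>)\<bar>" for \<omega>
      using that by linarith
    then have "{\<omega>\<in>space M. \<epsilon> < \<bar>Y p \<omega> - Y' p \<omega> - (Z \<omega> - Z' \<omega>)\<bar>}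
       \<subseteq> {\<omega>\<in>space M. \<epsilon>/2 < \<bar>Y p \<omega> - Z \<omega>\<bar>} \<union> {\<omega>\<in>space M. \<epsilon>/2 < \<bar>Y' p \<omega> - Z' \<omega>\<bar>}" by blast
    then have "prob {\<omega>\<in>space M. \<epsilon> < \<bar>Y p \<omega> - Y' p \<omega> - (Z \<omega> - Z' \<omega>)\<bar>}
       \<le> prob ({\<omega>\<in>space M. \<epsilon>/2 < \<bar>Y p \<omega> - Z \<omega>\<bar>} \<union> {\<omega>\<in>space M. \<epsilon>/2 < \<bar>Y' p \<omega> - Z' \<omega>\<bar>})"
      by (rule finite_measure_mono) measurable
    also have "\<dots> \<le> ?b p" by (rule measure_Un_le) auto
    finally show ?thesis .
  qed
  then show "(\<lambda>p. prob {\<omega>\<in>space M. \<epsilon> < \<bar>Y p \<omega> - Y' p \<omega> - (Z \<omega> - Z' \<omega>)\<bar>}) \<longlonglongrightarrow> 0"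
    by (intro tendsto_sandwich[OF _ _ tendsto_const lim] always_eventually allI measure_nonneg)
qed

lemma AE_tendsto_0_imp_prob:
  fixes f :: "nat \<Rightarrow> 'a \<Rightarrow> ennreal"
  assumes [measurable]: "\<And>p. f p \<in> borel_measurable M"
    and ae: "AE \<omega> in M. (\<lambda>p. f p \<omega>) \<longlonglongrightarrow> 0" and c: "0 < c"
  shows "(\<lambda>p. prob {\<omega>\<in>space M. c < f p \<omega>}) \<longlonglongrightarrow> 0"
proof -
  have "(\<lambda>p. \<integral>\<omega>. indicator {\<omega>\<in>space M. c < f p \<omega>} \<omega> \<partial>M) \<longlonglongrightarrow> (\<integral>\<omega>. (0::real) \<partial>M)"
  proof (rule integral_dominated_convergence[where w="\<lambda>_. 1"])
    show "AE \<omega> in M. (\<lambda>p. indicator {\<omega>\<in>space M. c < f p \<omega>} \<omega> :: real) \<longlonglongrightarrow> 0"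
      using ae
    proof eventually_elim
      case (elim \<omega>)
      then have "eventually (\<lambda>p. f p \<omega> < c) sequentially" using c by (rule order_tendstoD(2))
      then have "eventually (\<lambda>p. indicator {\<omega>\<in>space M. c < f p \<omega>} \<omega> = (0::real)) sequentially"
        by eventually_elim (auto simp: indicator_def)
      then show ?case by (rule tendsto_eventually)
    qed
  qed (auto simp: indicator_def)
  then show ?thesis by simp
qed

text \<open>
  The truncated distances min(1, |Y_p - Z|) tend to zero in L^1, and truncation at one does not
  affect convergence to zero.
\<close>

lemma tendsto_prob_AE_subseq:
  assumes [measurable]: "\<And>p. Y p \<in> borel_measurable M" "Z \<in> borel_measurable M"
    and Y: "tendsto_prob Y Z"
  shows "\<exists>r. strict_mono r \<and> (AE \<omega> in M. (\<lambda>k. Y (r k) \<omega>) \<longlonglongrightarrow> Z \<omega>)"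
proof -
  define u where "u p \<omega> = min 1 \<bar>Y p \<omega> - Z \<omega>\<bar>" for p \<omega>
  have um [measurable]: "u p \<in> borel_measurable M" for p unfolding u_def by measurable
  have u01: "0 \<le> u p \<omega> \<and> u p \<omega> \<le> 1" for p \<omega> by (auto simp: u_def)
  have ui: "integrable M (u p)" for p
    by (rule integrable_const_bound[where B=1]) (use u01 in auto)
  have "(\<lambda>p. \<integral>\<omega>. norm (u p \<omega>) \<partial>M) \<longlonglongrightarrow> 0"
  proof (rule order_tendstoI)
    fix c :: real assume c: "0 < c"
    have "eventually (\<lambda>p. prob {\<omega>\<in>space M. c/2 < \<bar>Y p \<omega> - Z \<omega>\<bar>} < c/2) sequentially"
      using tendsto_probD[OF Y half_gt_zero[OF c]] half_gt_zero[OF c] by (rule order_tendstoD(2))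
    then show "eventually (\<lambda>p. (\<integral>\<omega>. norm (u p \<omega>) \<partial>M) < c) sequentially"
    proof eventually_elim
      case (elim p)
      have ind: "integrable M (\<lambda>\<omega>. indicator {\<omega>\<in>space M. c/2 < \<bar>Y p \<omega> - Z \<omega>\<bar>} \<omega> :: real)"
        by (rule integrable_real_indicator) (auto simp: emeasure_eq_measure)
      have "(\<integral>\<omega>. norm (u p \<omega>) \<partial>M) \<le> (\<integral>\<omega>. c/2 + indicator {\<omega>\<in>space M. c/2 < \<bar>Y p \<omega> - Z \<omega>\<bar>} \<omega> \<partial>M)"
      proof (rule integral_mono)
        show "integrable M (\<lambda>\<omega>. norm (u p \<omega>))" using ui[of p] by simp
        show "integrable M (\<lambda>\<omega>. c/2 + indicator {\<omega>\<in>space M. c/2 < \<bar>Y p \<omega> - Z \<omega>\<bar>} \<omega>)"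
          by (intro Bochner_Integration.integrable_add integrable_const ind)
        fix \<omega> assume "\<omega> \<in> space M"
        then show "norm (u p \<omega>) \<le> c/2 + indicator {\<omega>\<in>space M. c/2 < \<bar>Y p \<omega> - Z \<omega>\<bar>} \<omega>"
          using c u01[of p \<omega>] min.cobounded2[of 1 "\<bar>Y p \<omega> - Z \<omega>\<bar>"]
          by (cases "c/2 < \<bar>Y p \<omega> - Z \<omega>\<bar>") (auto simp: u_def[symmetric])
      qed
      also have "\<dots> = c/2 + prob {\<omega>\<in>space M. c/2 < \<bar>Y p \<omega> - Z \<omega>\<bar>}"
        by (subst Bochner_Integration.integral_add[OF integrable_const ind]) (simp add: prob_space)
      finally show ?case using elim by linarith
    qed
  next
    fix c :: real assume "c < 0"
    then show "eventually (\<lambda>p. c < (\<integral>\<omega>. norm (u p \<omega>) \<partial>M)) sequentially"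
      by (intro always_eventually allI less_le_trans[OF _ Bochner_Integration.integral_nonneg]) auto
  qed
  from tendsto_L1_AE_subseq[OF ui this] obtain r where r: "strict_mono r" "AE \<omega> in M. (\<lambda>k. u (r k) \<omega>) \<longlonglongrightarrow> 0"
    by blast
  from r(2) have "AE \<omega> in M. (\<lambda>k. Y (r k) \<omega>) \<longlonglongrightarrow> Z \<omega>"
  proof eventually_elim
    case (elim \<omega>)
    have "eventually (\<lambda>k. u (r k) \<omega> < 1) sequentially" using elim by (rule order_tendstoD(2)) simp
    then have "eventually (\<lambda>k. u (r k) \<omega> = \<bar>Y (r k) \<omega> - Z \<omega>\<bar>) sequentially"
      by eventually_elim (auto simp: u_def min_def split: if_splits)
    with elim have "(\<lambda>k. \<bar>Y (r k) \<omega> - Z \<omega>\<bar>) \<longlonglongrightarrow> 0" by (rule Lim_transform_eventually)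
    then show ?case by (simp add: tendsto_rabs_zero_iff LIM_zero_iff)
  qed
  with r(1) show ?thesis by blast
qed

text \<open>
  Fatou's lemma along an almost surely convergent subsequence. The factor g will be the indicator of
  a localising event.
\<close>

lemma fatou_prob:
  assumes [measurable]: "\<And>p. Y p \<in> borel_measurable M" "Z \<in> borel_measurable M" "g \<in> borel_measurable M"
    and Y: "tendsto_prob Y Z"
    and c: "\<And>p. sqmean (\<lambda>\<omega>. g \<omega> * Y p \<omega>) \<le> c"
  shows "sqmean (\<lambda>\<omega>. g \<omega> * Z \<omega>) \<le> c"
proof -
  from tendsto_prob_AE_subseq[OF assms(1,2) Y] obtain r where
    r: "AE \<omega> in M. (\<lambda>k. Y (r k) \<omega>) \<longlonglongrightarrow> Z \<omega>" by blast
  have "sqmean (\<lambda>\<omega>. g \<omega> * Z \<omega>) = (\<integral>\<^sup>+\<omega>. liminf (\<lambda>k. ennreal ((g \<omega> * Y (r k) \<omega>)^2)) \<partial>M)"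
    unfolding sqmean_def
  proof (rule nn_integral_cong_AE)
    show "AE \<omega> in M. ennreal ((g \<omega> * Z \<omega>)\<^sup>2) = liminf (\<lambda>k. ennreal ((g \<omega> * Y (r k) \<omega>)\<^sup>2))"
      using r
    proof eventually_elim
      case (elim \<omega>)
      have "(\<lambda>k. ennreal ((g \<omega> * Y (r k) \<omega>)\<^sup>2)) \<longlonglongrightarrow> ennreal ((g \<omega> * Z \<omega>)\<^sup>2)"
        by (intro tendsto_ennrealI tendsto_intros elim)
      from lim_imp_Liminf[OF _ this] show ?case by simp
    qed
  qed
  also have "\<dots> \<le> liminf (\<lambda>k. sqmean (\<lambda>\<omega>. g \<omega> * Y (r k) \<omega>))"
    unfolding sqmean_def by (rule nn_integral_liminf) measurable
  also have "\<dots> \<le> c"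
    using c by (intro Liminf_le) auto
  finally show ?thesis .
qed

end

section \<open>Independence of the past from the increments\<close>

locale brownian =
  fixes M :: "'w measure" and B :: "real \<Rightarrow> 'w \<Rightarrow> real"
  assumes bm: "brownian_motion M B"
begin

sublocale prob_space M
  using bm by (simp add: brownian_motion_def)

abbreviation F :: "real \<Rightarrow> 'w measure" where
  "F \<equiv> brownian_filtration M B"

lemma B_measurable: "t \<in> {0..1} \<Longrightarrow> B t \<in> borel_measurable M"
  and B_zero: "AE \<omega> in M. B 0 \<omega> = 0"
  and B_indep: "(\<And>i. i \<le> n \<Longrightarrow> \<tau> i \<in> {0..1}) \<Longrightarrow> (\<And>i. i < n \<Longrightarrow> \<tau> i \<le> \<tau> (Suc i)) \<Longrightarrow>
        indep_vars (\<lambda>_. borel) (\<lambda>i \<omega>. B (\<tau> (Suc i)) \<omega> - B (\<tau> i) \<omega>) {..<n}"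
  and B_distributed: "0 \<le> s \<Longrightarrow> s < t \<Longrightarrow> t \<le> 1 \<Longrightarrow>
        distributed M lborel (\<lambda>\<omega>. B t \<omega> - B s \<omega>) (normal_density 0 (sqrt (t - s)))"
  using bm by (simp_all add: brownian_motion_def)

abbreviation filtration_generator :: "real \<Rightarrow> 'w set set" where
  "filtration_generator t \<equiv>
     {B s -` A \<inter> space M | s A. s \<in> {0..t} \<and> A \<in> sets borel} \<union> null_sets M"

lemma filtration_generator_subset: "t \<le> 1 \<Longrightarrow> filtration_generator t \<subseteq> sets M"
  by (auto intro!: measurable_sets B_measurable)

lemma space_F [simp]: "space (F t) = space M"
  by (auto simp: brownian_filtration_def space_measure_of_conv)

lemma sets_F: "sets (F t) = sigma_sets (space M) (filtration_generator t)"
  unfolding brownian_filtration_def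
  by (rule sets_measure_of) (auto dest: null_setsD2 sets.sets_into_space)

lemma sets_F_subset: "t \<le> 1 \<Longrightarrow> sets (F t) \<subseteq> sets M"
  unfolding sets_F by (rule sets.sigma_sets_subset[OF filtration_generator_subset])

lemma sets_F_mono: "s \<le> t \<Longrightarrow> sets (F s) \<subseteq> sets (F t)"
  unfolding sets_F by (intro sigma_sets_mono') fastforce

lemma measurable_F_M: "f \<in> measurable (F t) N \<Longrightarrow> t \<le> 1 \<Longrightarrow> f \<in> measurable M N"
  using sets_F_subset[of t] by (auto simp: measurable_def)

lemma measurable_F_mono: "f \<in> measurable (F s) N \<Longrightarrow> s \<le> t \<Longrightarrow> f \<in> measurable (F t) N"
  using sets_F_mono[of s t] by (auto simp: measurable_def)

lemma B_adapted: "0 \<le> s \<Longrightarrow> s \<le> t \<Longrightarrow> B s \<in> borel_measurable (F t)"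
  by (rule measurableI) (auto simp: sets_F intro!: sigma_sets.Basic)

text \<open>
  A pi-system that generates the history of B up to time t, without the null sets.
\<close>

definition cylinders :: "real \<Rightarrow> 'w set set" where
  "cylinders t = {space M \<inter> (\<Inter>u\<in>U. B u -` A u) | U A. finite U \<and> U \<subseteq> {0..t} \<and> (\<forall>u. A u \<in> sets (borel :: real measure))}"

lemma Int_stable_cylinders: "Int_stable (cylinders t)"
proof (rule Int_stableI)
  fix a b assume "a \<in> cylinders t" "b \<in> cylinders t"
  then obtain U A V C where a: "a = space M \<inter> (\<Inter>u\<in>U. B u -` A u)" "finite U" "U \<subseteq> {0..t}" "\<forall>u. A u \<in> sets (borel :: real measure)"
    and b: "b = space M \<inter> (\<Inter>u\<in>V. B u -` C u)" "finite V" "V \<subseteq> {0..t}" "\<forall>u. C u \<in> sets (borel :: real measure)"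
    unfolding cylinders_def by (smt (verit) mem_Collect_eq)
  define D where "D u = (if u \<in> U then A u else UNIV) \<inter> (if u \<in> V then C u else UNIV)" for u
  have "a \<inter> b = space M \<inter> (\<Inter>u\<in>U \<union> V. B u -` D u)"
    unfolding a b D_def by (auto split: if_splits)
  then show "a \<inter> b \<in> cylinders t"
    unfolding cylinders_def using a b
    by (intro CollectI exI[of _ "U \<union> V"] exI[of _ D]) (auto simp: D_def)
qed

lemma cylinders_subset: "t \<le> 1 \<Longrightarrow> cylinders t \<subseteq> sets M"
proof
  fix a assume t: "t \<le> 1" and "a \<in> cylinders t"
  then obtain U A where a: "a = space M \<inter> (\<Inter>u\<in>U. B u -` A u)" "finite U" "U \<subseteq> {0..t}" "\<forall>u. A u \<in> sets (borel :: real measure)"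
    unfolding cylinders_def by auto
  have "a = {\<omega> \<in> space M. \<forall>u\<in>U. B u \<omega> \<in> A u}" unfolding a by auto
  also have "\<dots> \<in> sets M"
    using a t by (intro sets.sets_Collect_finite_All) (auto intro!: measurable_sets_Collect[OF B_measurable])
  finally show "a \<in> sets M" .
qed

text \<open>
  Sort the times of the cylinder. Since B starts at zero almost surely, its values at these times
  are partial sums of the increments of the sorted sequence, and all of these are jointly
  independent of the increment from s to t.
\<close>

lemma prob_cylinder_increment:
  assumes s: "0 \<le> s" "s < t" "t \<le> 1" and a: "a \<in> cylinders s" and C: "C \<in> sets borel"
  defines "d \<equiv> {\<omega> \<in> space M. B t \<omega> - B s \<omega> \<in> C}"
  shows "prob (a \<inter> d) = prob a * prob d"
proof -
  obtain U A where a_eq: "a = space M \<inter> (\<Inter>u\<in>U. B u -` A u)" and U: "finite U" "U \<subseteq> {0..s}"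
    and A [measurable]: "\<And>u. A u \<in> sets (borel :: real measure)"
    using a unfolding cylinders_def by auto
  define W where "W = insert 0 (insert s U)"
  have W: "finite W" "W \<subseteq> {0..s}" "0 \<in> W" "s \<in> W" using U s by (auto simp: W_def)
  define xs where "xs = sorted_list_of_set W"
  define n where "n = length xs"
  have xs: "set xs = W" "sorted xs" "distinct xs" using W by (auto simp: xs_def)
  then have n: "0 < n" using W by (auto simp: n_def)
  \<comment> \<open>The times start at zero, and s and t come last, so that the last increment is the one in question.\<close>
  define \<tau> where "\<tau> i = (if i < n then xs ! i else t)" for i
  have tau_mem: "\<tau> i \<in> W" if "i < n" for i using that xs by (auto simp: \<tau>_def n_def)
  have idx: "\<exists>i<n. u = \<tau> i" if "u \<in> W" for u
    using that xs by (metis \<tau>_def in_set_conv_nth n_def)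
  have tau_le: "\<tau> i \<le> \<tau> j" if "i \<le> j" "j < n" for i j
    using that xs sorted_nth_mono[of xs i j] by (auto simp: \<tau>_def n_def)
  have tau_last: "\<tau> (n - 1) = s"
  proof (rule antisym)
    show "\<tau> (n - 1) \<le> s" using tau_mem[of "n-1"] n W by auto
    show "s \<le> \<tau> (n - 1)" using idx[OF W(4)] tau_le[of _ "n-1"] by auto
  qed
  have tau_0: "\<tau> 0 = 0"
  proof (rule antisym)
    show "0 \<le> \<tau> 0" using tau_mem[of 0] n W by auto
    from idx[OF W(3)] obtain i where "i < n" "0 = \<tau> i" by blast
    then show "\<tau> 0 \<le> 0" using tau_le[of 0 i] by simp
  qed
  have tau_n: "\<tau> n = t" by (simp add: \<tau>_def)
  define Y where "Y i \<omega> = B (\<tau> (Suc i)) \<omega> - B (\<tau> i) \<omega>" for i \<omega>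
  have ind: "indep_vars (\<lambda>_. borel) Y {..<n}"
    unfolding Y_def
  proof (rule B_indep)
    fix i assume "i \<le> n" then show "\<tau> i \<in> {0..1}"
      using tau_mem[of i] W s by (cases "i = n") (auto simp: tau_n)
  next
    fix i assume i: "i < n" show "\<tau> i \<le> \<tau> (Suc i)"
    proof (cases "Suc i = n")
      case True
      then show ?thesis using tau_mem[OF i] W s by (auto simp: tau_n)
    qed (use i tau_le in auto)
  qed
  have Ym [measurable]: "Y i \<in> borel_measurable M" if "i < n" for i
    using ind that by (auto simp: indep_vars_def)
  let ?A = "{..<n - 1}" and ?B = "{n - 1}"
  have iv: "indep_var (PiM ?A (\<lambda>_. borel)) (\<lambda>\<omega>. restrict (\<lambda>i. Y i \<omega>) ?A)
        (PiM ?B (\<lambda>_. borel)) (\<lambda>\<omega>. restrict (\<lambda>i. Y i \<omega>) ?B)"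
    by (rule indep_var_restrict[OF ind]) (use n in auto)
  define ix where "ix u = (SOME i. i < n \<and> u = \<tau> i)" for u
  have ix: "ix u < n \<and> u = \<tau> (ix u)" if "u \<in> U" for u
    unfolding ix_def by (rule someI_ex) (use idx that in \<open>auto simp: W_def\<close>)
  define SA where "SA = {f \<in> space (PiM ?A (\<lambda>_. borel)). \<forall>u\<in>U. (\<Sum>j<ix u. f j) \<in> A u}"
  define SB where "SB = {f \<in> space (PiM ?B (\<lambda>_. borel)). f (n - 1) \<in> C}"
  have SA: "SA \<in> sets (PiM ?A (\<lambda>_. borel))"
    unfolding SA_def
  proof (intro sets.sets_Collect_finite_All U)
    fix u assume "u \<in> U"
    then have sub: "j \<in> ?A" if "j < ix u" for j using ix[of u] that by auto
    have [measurable]: "(\<lambda>f. \<Sum>j<ix u. f j) \<in> borel_measurable (PiM ?A (\<lambda>_. borel :: real measure))"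
      by (intro borel_measurable_sum measurable_component_singleton sub) auto
    show "{f \<in> space (PiM ?A (\<lambda>_. borel)). (\<Sum>j<ix u. f j) \<in> A u} \<in> sets (PiM ?A (\<lambda>_. borel))"
      by measurable
  qed
  have SB: "SB \<in> sets (PiM ?B (\<lambda>_. borel))"
  proof -
    have [measurable]: "(\<lambda>f. f (n - 1)) \<in> borel_measurable (PiM ?B (\<lambda>_. borel :: real measure))"
      by (rule measurable_component_singleton) auto
    show ?thesis unfolding SB_def using C by measurable
  qed
  define a' where "a' = {\<omega> \<in> space M. \<forall>u\<in>U. (\<Sum>j<ix u. Y j \<omega>) \<in> A u}"
  have eq_a: "(\<lambda>\<omega>. restrict (\<lambda>i. Y i \<omega>) ?A) -` SA \<inter> space M = a'"
  proof -
    have "(\<Sum>j<ix u. restrict (\<lambda>i. Y i \<omega>) ?A j) = (\<Sum>j<ix u. Y j \<omega>)" if "u \<in> U" for u \<omega>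
      by (intro sum.cong refl) (use ix[OF that] in auto)
    then show ?thesis by (auto simp: SA_def a'_def space_PiM)
  qed
  have eq_d: "(\<lambda>\<omega>. restrict (\<lambda>i. Y i \<omega>) ?B) -` SB \<inter> space M = d"
    using n by (auto simp: SB_def d_def space_PiM Y_def tau_n tau_last[simplified])
  have *: "prob ((\<lambda>\<omega>. (restrict (\<lambda>i. Y i \<omega>) ?A, restrict (\<lambda>i. Y i \<omega>) ?B)) -` (SA \<times> SB) \<inter> space M) = prob a' * prob d"
    using indep_varD[OF iv SA SB] unfolding eq_a eq_d .
  have "(\<lambda>\<omega>. (restrict (\<lambda>i. Y i \<omega>) ?A, restrict (\<lambda>i. Y i \<omega>) ?B)) -` (SA \<times> SB) \<inter> space M = a' \<inter> d"
    using eq_a eq_d by auto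
  with * have indep: "prob (a' \<inter> d) = prob a' * prob d" by simp
  have a_M: "a \<in> sets M" using cylinders_subset[of s] a s by auto
  have a'_M: "a' \<in> sets M" unfolding eq_a[symmetric]
    using iv[THEN indep_var_rv1] SA by (rule measurable_sets)
  have d_M: "d \<in> sets M" unfolding eq_d[symmetric]
    using iv[THEN indep_var_rv2] SB by (rule measurable_sets)
  have sumY: "(\<Sum>j<i. Y j \<omega>) = B (\<tau> i) \<omega> - B 0 \<omega>" for i \<omega>
    unfolding Y_def by (induction i) (auto simp: tau_0)
  have ae: "AE \<omega> in M. \<omega> \<in> a \<longleftrightarrow> \<omega> \<in> a'"
    using B_zero
  proof eventually_elim
    case (elim \<omega>)
    then have "(\<Sum>j<ix u. Y j \<omega>) = B u \<omega>" if "u \<in> U" for u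
      using ix[OF that] by (simp add: sumY)
    then show ?case by (auto simp: a_eq a'_def)
  qed
  have "prob a = prob a'"
    by (rule measure_eq_AE[OF ae a_M a'_M])
  moreover have "prob (a \<inter> d) = prob (a' \<inter> d)"
    by (rule measure_eq_AE) (use ae a_M a'_M d_M in auto)
  ultimately show ?thesis using indep by simp
qed

text \<open>
  The augmentation by null sets does not enlarge the filtration essentially, so independence extends
  from the cylinders to the augmented filtration.
\<close>

lemma F_modulo_null:
  assumes "s \<le> 1" "a \<in> sets (F s)"
  shows "\<exists>a'\<in>sigma_sets (space M) (cylinders s). AE \<omega> in M. \<omega> \<in> a \<longleftrightarrow> \<omega> \<in> a'"
  using assms(2) unfolding sets_F
proof (induction rule: sigma_sets.induct)
  case (Basic a)
  then show ?case
  proof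
    assume "a \<in> {B u -` A \<inter> space M | u A. u \<in> {0..s} \<and> A \<in> sets borel}"
    then obtain u A where "a = B u -` A \<inter> space M" "u \<in> {0..s}" "A \<in> sets borel" by auto
    then have "a \<in> cylinders s" unfolding cylinders_def
      by (intro CollectI exI[of _ "{u}"] exI[of _ "\<lambda>_. A"]) auto
    then show ?thesis by (intro bexI[of _ a] sigma_sets.Basic) auto
  next
    assume "a \<in> null_sets M"
    then show ?thesis
      by (intro bexI[of _ "{}"] sigma_sets.Empty) (auto dest: AE_not_in)
  qed
next
  case Empty
  then show ?case by (intro bexI[of _ "{}"] sigma_sets.Empty) auto
next
  case (Compl a)
  then obtain a' where "a'\<in>sigma_sets (space M) (cylinders s)" "AE \<omega> in M. \<omega> \<in> a \<longleftrightarrow> \<omega> \<in> a'" by auto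
  then show ?case
    by (intro bexI[of _ "space M - a'"] sigma_sets.Compl) (auto elim: eventually_mono)
next
  case (Union a)
  then have "\<forall>i. \<exists>a'. a'\<in>sigma_sets (space M) (cylinders s) \<and> (AE \<omega> in M. \<omega> \<in> a i \<longleftrightarrow> \<omega> \<in> a')" by auto
  then obtain a' where a': "\<And>i. a' i\<in>sigma_sets (space M) (cylinders s)" "\<And>i. AE \<omega> in M. \<omega> \<in> a i \<longleftrightarrow> \<omega> \<in> a' i"
    by metis
  have "AE \<omega> in M. \<forall>i. \<omega> \<in> a i \<longleftrightarrow> \<omega> \<in> a' i" using a'(2) by (simp add: AE_all_countable)
  then show ?case using a'(1)
    by (intro bexI[of _ "\<Union>i. a' i"] sigma_sets.Union) (auto elim: eventually_mono)
qed

lemma prob_F_increment: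
  assumes s: "0 \<le> s" "s < t" "t \<le> 1" and a: "a \<in> sets (F s)" and C: "C \<in> sets borel"
  defines "d \<equiv> {\<omega> \<in> space M. B t \<omega> - B s \<omega> \<in> C}"
  shows "prob (a \<inter> d) = prob a * prob d"
proof -
  have [measurable]: "B s \<in> borel_measurable M" "B t \<in> borel_measurable M"
    using B_measurable[of s] B_measurable[of t] s by auto
  have "Int_stable {d}" by (auto simp: Int_stable_def)
  moreover have "d \<in> sets M" unfolding d_def using C by measurable
  then have "indep_set (cylinders s) {d}"
    using cylinders_subset[of s] prob_cylinder_increment[OF s _ C] s
    by (intro indep_setI) (auto simp: d_def)
  ultimately have ind: "indep_set (sigma_sets (space M) (cylinders s)) (sigma_sets (space M) {d})"
    by (intro indep_set_sigma_sets Int_stable_cylinders)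
  obtain a' where a': "a' \<in> sigma_sets (space M) (cylinders s)" and ae: "AE \<omega> in M. \<omega> \<in> a \<longleftrightarrow> \<omega> \<in> a'"
    using F_modulo_null[OF _ a] s by auto
  have M: "a \<in> sets M" "a' \<in> sets M"
    using a a' sets_F_subset[of s] s sets.sigma_sets_subset[OF cylinders_subset[of s]] by auto
  have "prob a = prob a'" by (rule measure_eq_AE) (use ae M in auto)
  moreover have "prob (a \<inter> d) = prob (a' \<inter> d)"
    by (rule measure_eq_AE) (use ae M \<open>d \<in> sets M\<close> in auto)
  ultimately show ?thesis
    using indep_setD[OF ind a', of d] by (simp add: sigma_sets.Basic)
qed

lemma distr_increment:
  assumes s: "0 \<le> s" "s < t" "t \<le> 1"
  shows "distr M borel (\<lambda>\<omega>. B t \<omega> - B s \<omega>) = gauss (t - s)"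
proof -
  have "distr M borel (\<lambda>\<omega>. B t \<omega> - B s \<omega>) = distr M lborel (\<lambda>\<omega>. B t \<omega> - B s \<omega>)"
    by (rule distr_cong) auto
  also have "\<dots> = gauss (t - s)"
    using distributed_distr_eq_density[OF B_distributed[OF s]] by (simp add: gauss_def)
  finally show ?thesis .
qed

text \<open>
  Conditioning on the past and integrating out the increment. The past enters through the identity
  map, measurable into (\<Omega>, F_s), so that a single statement covers integrands depending on
  any number of random variables known at time s.
\<close>

lemma nn_integral_increment:
  assumes s: "0 \<le> s" "s < t" "t \<le> 1"
    and g [measurable]: "g \<in> borel_measurable (F s \<Otimes>\<^sub>M borel)"
  shows "(\<integral>\<^sup>+\<omega>. g (\<omega>, B t \<omega> - B s \<omega>) \<partial>M) = (\<integral>\<^sup>+\<omega>. (\<integral>\<^sup>+x. g (\<omega>, x) \<partial>gauss (t - s)) \<partial>M)"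
proof -
  let ?D = "\<lambda>\<omega>. B t \<omega> - B s \<omega>"
  have Dm [measurable]: "?D \<in> borel_measurable M"
    using B_measurable[of s] B_measurable[of t] s by auto
  have IM [measurable]: "(\<lambda>\<omega>. \<omega>) \<in> measurable M (F s)"
    using measurable_F_M[of "\<lambda>\<omega>. \<omega>" s "F s"] s by simp
  interpret G: prob_space "gauss (t - s)" by (rule prob_space_gauss) (use s in simp)
  have sets_eq: "sets (distr M (F s) (\<lambda>\<omega>. \<omega>) \<Otimes>\<^sub>M gauss (t - s)) = sets (F s \<Otimes>\<^sub>M borel)"
    by (intro sets_pair_measure_cong) auto
  have "(\<integral>\<^sup>+\<omega>. g (\<omega>, ?D \<omega>) \<partial>M) = (\<integral>\<^sup>+z. g z \<partial>distr M (F s \<Otimes>\<^sub>M borel) (\<lambda>\<omega>. (\<omega>, ?D \<omega>)))"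
    by (subst nn_integral_distr) auto
  also have "distr M (F s \<Otimes>\<^sub>M borel) (\<lambda>\<omega>. (\<omega>, ?D \<omega>)) = distr M (F s) (\<lambda>\<omega>. \<omega>) \<Otimes>\<^sub>M gauss (t - s)"
  proof (rule pair_measure_eqI[symmetric])
    show "sigma_finite_measure (distr M (F s) (\<lambda>\<omega>. \<omega>))"
      by (intro finite_measure.axioms(1) prob_space.axioms(1) prob_space_distr IM)
    show "sigma_finite_measure (gauss (t - s))" ..
    show "sets (distr M (F s) (\<lambda>\<omega>. \<omega>) \<Otimes>\<^sub>M gauss (t - s)) = sets (distr M (F s \<Otimes>\<^sub>M borel) (\<lambda>\<omega>. (\<omega>, ?D \<omega>)))"
      using sets_eq by simp
    fix a C assume "a \<in> sets (distr M (F s) (\<lambda>\<omega>. \<omega>))" "C \<in> sets (gauss (t - s))"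
    then have a: "a \<in> sets (F s)" and C [measurable]: "C \<in> sets borel" by auto
    have aM: "a \<in> sets M" using a sets_F_subset[of s] s by auto
    have "emeasure (distr M (F s \<Otimes>\<^sub>M borel) (\<lambda>\<omega>. (\<omega>, ?D \<omega>))) (a \<times> C)
        = emeasure M (a \<inter> {\<omega> \<in> space M. ?D \<omega> \<in> C})"
      using a C sets.sets_into_space[OF aM]
      by (subst emeasure_distr) (auto intro!: arg_cong[where f="emeasure M"])
    also have "\<dots> = emeasure M a * emeasure M {\<omega> \<in> space M. ?D \<omega> \<in> C}"
      using prob_F_increment[OF s a C] by (simp add: emeasure_eq_measure ennreal_mult'')
    also have "emeasure M a = emeasure (distr M (F s) (\<lambda>\<omega>. \<omega>)) a"
      using a sets.sets_into_space[OF aM] by (subst emeasure_distr) (auto intro!: arg_cong[where f="emeasure M"])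
    also have "emeasure M {\<omega> \<in> space M. ?D \<omega> \<in> C} = emeasure (gauss (t - s)) C"
      unfolding distr_increment[OF s, symmetric]
      by (subst emeasure_distr) (auto intro!: arg_cong[where f="emeasure M"])
    finally show "emeasure (distr M (F s) (\<lambda>\<omega>. \<omega>)) a * emeasure (gauss (t - s)) C
        = emeasure (distr M (F s \<Otimes>\<^sub>M borel) (\<lambda>\<omega>. (\<omega>, ?D \<omega>))) (a \<times> C)" by simp
  qed
  also have "(\<integral>\<^sup>+z. g z \<partial>\<dots>) = (\<integral>\<^sup>+\<omega>. (\<integral>\<^sup>+x. g (\<omega>, x) \<partial>gauss (t - s)) \<partial>distr M (F s) (\<lambda>\<omega>. \<omega>))"
    by (rule G.nn_integral_fst[symmetric]) (simp add: g measurable_cong_sets[OF sets_eq refl])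
  also have "\<dots> = (\<integral>\<^sup>+\<omega>. (\<integral>\<^sup>+x. g (\<omega>, x) \<partial>gauss (t - s)) \<partial>M)"
    by (subst nn_integral_distr)
       (auto intro!: G.borel_measurable_nn_integral simp: g measurable_cong_sets[OF sets_eq refl]
         measurable_cong_sets[OF sets_pair_measure_cong[OF refl sets_gauss] refl])
  finally show ?thesis .
qed

section \<open>Ito isometry and the Lenglart inequality\<close>

abbreviation ito_sum :: "(nat \<Rightarrow> real) \<Rightarrow> (nat \<Rightarrow> 'w \<Rightarrow> real) \<Rightarrow> nat \<Rightarrow> 'w \<Rightarrow> real" where
  "ito_sum v \<zeta> r \<omega> \<equiv> \<Sum>j<r. \<zeta> j \<omega> * (B (v (Suc j)) \<omega> - B (v j) \<omega>)"

lemma sqmean_increment: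
  assumes s: "0 \<le> s" "s \<le> t" "t \<le> 1"
    and U [measurable]: "U \<in> borel_measurable (F s)" and V [measurable]: "V \<in> borel_measurable (F s)"
  shows "sqmean (\<lambda>\<omega>. U \<omega> + V \<omega> * (B t \<omega> - B s \<omega>)) = sqmean U + ennreal (t - s) * sqmean V"
proof (cases "s = t")
  case False
  then have st: "s < t" using s by simp
  have [measurable]: "U \<in> borel_measurable M" "V \<in> borel_measurable M"
    using measurable_F_M[OF U] measurable_F_M[OF V] s by auto
  have "sqmean (\<lambda>\<omega>. U \<omega> + V \<omega> * (B t \<omega> - B s \<omega>))
     = (\<integral>\<^sup>+\<omega>. (\<integral>\<^sup>+x. ennreal ((U \<omega> + V \<omega> * x)^2) \<partial>gauss (t - s)) \<partial>M)"
    unfolding sqmean_def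
    using nn_integral_increment[OF s(1) st s(3), of "\<lambda>z. ennreal ((U (fst z) + V (fst z) * snd z)^2)"] by simp
  also have "\<dots> = (\<integral>\<^sup>+\<omega>. ennreal ((U \<omega>)^2) + ennreal (t - s) * ennreal ((V \<omega>)^2) \<partial>M)"
    using st by (intro nn_integral_cong) (simp add: gauss_affine_square ennreal_plus ennreal_mult')
  finally show ?thesis by (simp add: nn_integral_add nn_integral_cmult sqmean_def)
qed (auto simp: sqmean_def)

lemma partial_sum_adapted:
  assumes v: "\<And>j. j \<le> r \<Longrightarrow> v j \<in> {0..1}" "\<And>j. j < r \<Longrightarrow> v j \<le> v (Suc j)"
    and z: "\<And>j. j < r \<Longrightarrow> \<zeta> j \<in> borel_measurable (F (v j))"
  shows "(\<lambda>\<omega>. ito_sum v \<zeta> r \<omega>) \<in> borel_measurable (F (v r))"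
  using assms
proof (induction r)
  case (Suc r)
  have vr: "v r \<le> v (Suc r)" "0 \<le> v r" "v (Suc r) \<le> 1"
    using Suc.prems(1)[of r] Suc.prems(1)[of "Suc r"] Suc.prems(2)[of r] by auto
  have "(\<lambda>\<omega>. ito_sum v \<zeta> r \<omega>) \<in> borel_measurable (F (v r))"
    by (rule Suc.IH) (simp_all add: Suc.prems less_SucI le_SucI del: atLeastAtMost_iff)
  then have [measurable]: "(\<lambda>\<omega>. ito_sum v \<zeta> r \<omega>) \<in> borel_measurable (F (v (Suc r)))"
    using vr(1) by (rule measurable_F_mono)
  have [measurable]: "\<zeta> r \<in> borel_measurable (F (v (Suc r)))"
    using Suc.prems(3)[of r] vr(1) by (auto intro: measurable_F_mono)
  have [measurable]: "B (v r) \<in> borel_measurable (F (v (Suc r)))" "B (v (Suc r)) \<in> borel_measurable (F (v (Suc r)))"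
    using vr by (auto intro!: B_adapted)
  show ?case unfolding sum.lessThan_Suc by measurable
qed simp

lemma ito_isometry:
  assumes v: "\<And>j. j \<le> r \<Longrightarrow> v j \<in> {0..1}" "\<And>j. j < r \<Longrightarrow> v j \<le> v (Suc j)"
    and z: "\<And>j. j < r \<Longrightarrow> \<zeta> j \<in> borel_measurable (F (v j))"
  shows "sqmean (\<lambda>\<omega>. ito_sum v \<zeta> r \<omega>)
    = (\<Sum>j<r. ennreal (v (Suc j) - v j) * sqmean (\<zeta> j))"
  using assms
proof (induction r)
  case (Suc r)
  have "sqmean (\<lambda>\<omega>. (ito_sum v \<zeta> r \<omega>) + \<zeta> r \<omega> * (B (v (Suc r)) \<omega> - B (v r) \<omega>))
    = sqmean (\<lambda>\<omega>. ito_sum v \<zeta> r \<omega>)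
      + ennreal (v (Suc r) - v r) * sqmean (\<zeta> r)"
  proof (rule sqmean_increment)
    show "0 \<le> v r" "v r \<le> v (Suc r)" "v (Suc r) \<le> 1"
      using Suc.prems(1)[of r] Suc.prems(1)[of "Suc r"] Suc.prems(2)[of r] by auto
    show "(\<lambda>\<omega>. ito_sum v \<zeta> r \<omega>) \<in> borel_measurable (F (v r))"
      by (rule partial_sum_adapted) (simp_all add: Suc.prems less_SucI le_SucI del: atLeastAtMost_iff)
    show "\<zeta> r \<in> borel_measurable (F (v r))" by (rule Suc.prems) simp
  qed
  moreover have "sqmean (\<lambda>\<omega>. ito_sum v \<zeta> r \<omega>)
    = (\<Sum>j<r. ennreal (v (Suc j) - v j) * sqmean (\<zeta> j))"
    by (rule Suc.IH) (simp_all add: Suc.prems less_SucI le_SucI del: atLeastAtMost_iff)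
  ultimately show ?case by simp
qed (simp add: sqmean_def)

text \<open>
  Stop the sum before its quadratic variation exceeds \<delta>. The stopped sum has mean square at
  most \<delta> by the isometry, and it differs from the original one only where the total quadratic
  variation exceeds \<delta>. Thus the sum is controlled in probability by its quadratic variation
  in probability, whatever the moments of the coefficients are.
\<close>

lemma lenglart_inequality:
  assumes v: "\<And>j. j \<le> r \<Longrightarrow> v j \<in> {0..1}" "\<And>j. j < r \<Longrightarrow> v j \<le> v (Suc j)"
    and z: "\<And>j. j < r \<Longrightarrow> \<zeta> j \<in> borel_measurable (F (v j))"
    and e: "0 < \<epsilon>" and d: "0 \<le> \<delta>"
  shows "prob {\<omega>\<in>space M. \<epsilon> < \<bar>ito_sum v \<zeta> r \<omega>\<bar>}
    \<le> \<delta> / \<epsilon>^2 + prob {\<omega>\<in>space M. \<delta> < (\<Sum>j<r. (\<zeta> j \<omega>)^2 * (v (Suc j) - v j))}"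
proof -
  define Q where "Q k \<omega> = (\<Sum>j<k. (\<zeta> j \<omega>)^2 * (v (Suc j) - v j))" for k \<omega>
  \<comment> \<open>The variation up to the end of the cell is known at its beginning, so the stopped coefficient is adapted.\<close>
  define \<xi> where "\<xi> j \<omega> = (if Q (Suc j) \<omega> \<le> \<delta> then \<zeta> j \<omega> else 0)" for j \<omega>
  let ?I = "\<lambda>\<zeta> \<omega>. ito_sum v \<zeta> r \<omega>"
  have vmono: "v i \<le> v j" if "i \<le> j" "j \<le> r" for i j
    using that
  proof (induction j)
    case (Suc j)
    then show ?case using v(2)[of j] by (cases "i = Suc j") auto
  qed simp
  have Qm: "Q k \<in> borel_measurable (F (v j))" if "k \<le> Suc j" "j < r" for k j
    unfolding Q_def
  proof (intro borel_measurable_sum borel_measurable_times borel_measurable_power borel_measurable_const)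
    fix i assume "i \<in> {..<k}"
    then have i: "i \<le> j" "j \<le> r" "i < r" using that by auto
    show "\<zeta> i \<in> borel_measurable (F (v j))"
      by (rule measurable_F_mono[OF z[OF i(3)] vmono[OF i(1,2)]])
  qed
  have xm: "\<xi> j \<in> borel_measurable (F (v j))" if "j < r" for j
  proof -
    have [measurable]: "Q (Suc j) \<in> borel_measurable (F (v j))" "\<zeta> j \<in> borel_measurable (F (v j))"
      using Qm[of "Suc j" j] z[OF that] that by auto
    show ?thesis unfolding \<xi>_def by measurable
  qed
  have toM: "f \<in> borel_measurable M" if "f \<in> borel_measurable (F (v j))" "j \<le> r" for f :: "'w \<Rightarrow> real" and j
    using measurable_F_M[OF that(1)] v(1)[OF that(2)] by simp
  have zM [measurable]: "?I \<zeta> \<in> borel_measurable M" and xM [measurable]: "?I \<xi> \<in> borel_measurable M"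
    using toM[OF partial_sum_adapted[of r v \<zeta>, OF v z] order_refl]
      toM[OF partial_sum_adapted[of r v \<xi>, OF v xm] order_refl] by blast+
  have QM [measurable]: "Q r \<in> borel_measurable M"
  proof -
    have "\<zeta> j \<in> borel_measurable M" if "j < r" for j using toM[OF z[OF that]] that by simp
    then show ?thesis unfolding Q_def by (intro borel_measurable_sum borel_measurable_times borel_measurable_power) auto
  qed
  have Qmono: "Q i \<omega> \<le> Q j \<omega>" if "i \<le> j" "j \<le> r" for i j \<omega>
    unfolding Q_def
  proof (rule sum_mono2)
    fix k assume "k \<in> {..<j} - {..<i}"
    then show "0 \<le> (\<zeta> k \<omega>)\<^sup>2 * (v (Suc k) - v k)" using v(2)[of k] that by simp
  qed (use that in auto)
  have stopped: "(\<Sum>j<k. (\<xi> j \<omega>)^2 * (v (Suc j) - v j)) \<le> \<delta>" if "k \<le> r" for k \<omega>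
    using that
  proof (induction k)
    case (Suc k)
    show ?case
    proof (cases "Q (Suc k) \<omega> \<le> \<delta>")
      case True
      then have "Q (Suc j) \<omega> \<le> \<delta>" if "j < Suc k" for j
        using Qmono[of "Suc j" "Suc k" \<omega>] that Suc by auto
      then have "(\<Sum>j<Suc k. (\<xi> j \<omega>)^2 * (v (Suc j) - v j)) = Q (Suc k) \<omega>"
        unfolding Q_def \<xi>_def by (intro sum.cong) auto
      then show ?thesis using True by simp
    next
      case False
      then have "\<xi> k \<omega> = 0" by (simp add: \<xi>_def)
      then show ?thesis using Suc by simp
    qed
  qed (use d in simp)
  have "sqmean (?I \<xi>) = (\<Sum>j<r. ennreal (v (Suc j) - v j) * sqmean (\<xi> j))"
    using v xm by (rule ito_isometry)
  also have "\<dots> = (\<integral>\<^sup>+\<omega>. (\<Sum>j<r. ennreal ((\<xi> j \<omega>)^2 * (v (Suc j) - v j))) \<partial>M)"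
  proof -
    have [measurable]: "\<xi> j \<in> borel_measurable M" if "j < r" for j using toM[OF xm[OF that]] that by simp
    show ?thesis
    proof (subst nn_integral_sum)
      show "(\<Sum>j<r. ennreal (v (Suc j) - v j) * sqmean (\<xi> j))
         = (\<Sum>j<r. \<integral>\<^sup>+\<omega>. ennreal ((\<xi> j \<omega>)^2 * (v (Suc j) - v j)) \<partial>M)"
      proof (intro sum.cong refl)
        fix j assume "j \<in> {..<r}"
        then have j: "j < r" "0 \<le> v (Suc j) - v j" using v(2)[of j] by auto
        have "(\<integral>\<^sup>+\<omega>. ennreal ((\<xi> j \<omega>)^2 * (v (Suc j) - v j)) \<partial>M)
            = (\<integral>\<^sup>+\<omega>. ennreal (v (Suc j) - v j) * ennreal ((\<xi> j \<omega>)^2) \<partial>M)"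
          using j by (simp add: ennreal_mult[symmetric] mult.commute)
        then show "ennreal (v (Suc j) - v j) * sqmean (\<xi> j)
           = (\<integral>\<^sup>+\<omega>. ennreal ((\<xi> j \<omega>)^2 * (v (Suc j) - v j)) \<partial>M)"
          using j by (simp add: nn_integral_cmult sqmean_def)
      qed
    qed auto
  qed
  also have "\<dots> \<le> (\<integral>\<^sup>+\<omega>. ennreal \<delta> \<partial>M)"
  proof (rule nn_integral_mono)
    fix \<omega>
    have "(\<Sum>j<r. ennreal ((\<xi> j \<omega>)^2 * (v (Suc j) - v j))) = ennreal (\<Sum>j<r. (\<xi> j \<omega>)^2 * (v (Suc j) - v j))"
    proof (rule sum_ennreal)
      fix j assume "j \<in> {..<r}"
      then show "0 \<le> (\<xi> j \<omega>)^2 * (v (Suc j) - v j)" using v(2)[of j] by simp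
    qed
    then show "(\<Sum>j<r. ennreal ((\<xi> j \<omega>)^2 * (v (Suc j) - v j))) \<le> ennreal \<delta>"
      using stopped[of r \<omega>] by (simp add: ennreal_leI)
  qed
  also have "\<dots> = ennreal \<delta>" by (simp add: emeasure_space_1)
  finally have L2: "sqmean (?I \<xi>) \<le> ennreal \<delta>" .
  have cheb: "prob {\<omega>\<in>space M. \<epsilon> < \<bar>?I \<xi> \<omega>\<bar>} \<le> \<delta> / \<epsilon>^2"
    by (rule chebyshev_sqmean[OF xM L2 d e])
  have "prob {\<omega>\<in>space M. \<epsilon> < \<bar>?I \<zeta> \<omega>\<bar>} \<le> prob ({\<omega>\<in>space M. \<epsilon> < \<bar>?I \<xi> \<omega>\<bar>} \<union> {\<omega>\<in>space M. \<delta> < Q r \<omega>})"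
  proof (rule finite_measure_mono)
    show "{\<omega>\<in>space M. \<epsilon> < \<bar>?I \<zeta> \<omega>\<bar>} \<subseteq> {\<omega>\<in>space M. \<epsilon> < \<bar>?I \<xi> \<omega>\<bar>} \<union> {\<omega>\<in>space M. \<delta> < Q r \<omega>}"
    proof safe
      fix \<omega> assume "\<epsilon> < \<bar>?I \<zeta> \<omega>\<bar>" "\<not> \<delta> < Q r \<omega>" "\<omega> \<in> space M"
      moreover have "?I \<xi> \<omega> = ?I \<zeta> \<omega>" if "Q r \<omega> \<le> \<delta>"
      proof (intro sum.cong refl)
        fix j assume "j \<in> {..<r}"
        then have "Q (Suc j) \<omega> \<le> \<delta>" using Qmono[of "Suc j" r \<omega>] that by auto
        then show "\<xi> j \<omega> * (B (v (Suc j)) \<omega> - B (v j) \<omega>) = \<zeta> j \<omega> * (B (v (Suc j)) \<omega> - B (v j) \<omega>)"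
          by (simp add: \<xi>_def)
      qed
      ultimately show "\<epsilon> < \<bar>?I \<xi> \<omega>\<bar>" by simp
    qed
  qed auto
  also have "\<dots> \<le> prob {\<omega>\<in>space M. \<epsilon> < \<bar>?I \<xi> \<omega>\<bar>} + prob {\<omega>\<in>space M. \<delta> < Q r \<omega>}"
    by (rule measure_Un_le) auto
  finally show ?thesis using cheb unfolding Q_def by linarith
qed

end

section \<open>Ito integrals of continuous processes as limits of Riemann sums\<close>

lemma grid_less:
  fixes v :: "nat \<Rightarrow> real"
  assumes "\<And>j. j < r \<Longrightarrow> v j < v (Suc j)" "p < q" "q \<le> r"
  shows "v p < v q"
  using assms(2,3)
proof (induction q)
  case (Suc q)
  then show ?case using assms(1)[of q] by (cases "p = q") auto
qed simp

lemma simple_process_grid_cell: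
  assumes mono: "\<And>j. j < r \<Longrightarrow> v j < v (Suc j)"
    and sub: "\<And>i. i \<le> n \<Longrightarrow> \<tau> i \<in> v ` {..r}"
    and j: "j < r" and s: "s \<in> {v j<..v (Suc j)}"
  shows "simple_process n \<tau> \<xi> s \<omega> = simple_process n \<tau> \<xi> (v (Suc j)) \<omega>"
proof -
  have vs: "v p < v q" if "p < q" "q \<le> r" for p q
    by (rule grid_less[of r v, OF mono that])
  have vle: "v p \<le> v q" if "p \<le> q" "q \<le> r" for p q
    using vs[of p q] that by (cases "p = q") auto
  have *: "(\<tau> i < s \<longleftrightarrow> \<tau> i < v (Suc j)) \<and> (s \<le> \<tau> i \<longleftrightarrow> v (Suc j) \<le> \<tau> i)" if "i \<le> n" for i
  proof -
    obtain p where p: "p \<le> r" "\<tau> i = v p" using sub[of i] \<open>i \<le> n\<close> by auto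
    show ?thesis
    proof (cases "p \<le> j")
      case True
      then have "v p \<le> v j" using vle[of p j] j by simp
      then show ?thesis using s p vs[of j "Suc j"] j by auto
    next
      case False
      then have "v (Suc j) \<le> v p" using vle[of "Suc j" p] p by simp
      then show ?thesis using s p by auto
    qed
  qed
  have "indicator {\<tau> i<..\<tau> (Suc i)} s = (indicator {\<tau> i<..\<tau> (Suc i)} (v (Suc j)) :: real)" if "i < n" for i
    using *[of i] *[of "Suc i"] that by (simp add: indicator_def)
  then show ?thesis by (simp add: simple_process_def)
qed

text \<open>
  A simple process is left continuous and constant on the cells of any finer grid, so its value on a
  cell is the value at the right end point.
\<close>

lemma simple_integral_refine:
  assumes mono: "\<And>j. j < r \<Longrightarrow> v j < v (Suc j)"
    and sub: "\<And>i. i \<le> n \<Longrightarrow> \<tau> i \<in> v ` {..r}"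
    and tau: "\<And>i. i < n \<Longrightarrow> \<tau> i \<le> \<tau> (Suc i)"
  shows "simple_integral B n \<tau> \<xi> \<omega>
    = (\<Sum>j<r. simple_process n \<tau> \<xi> (v (Suc j)) \<omega> * (B (v (Suc j)) \<omega> - B (v j) \<omega>))"
proof -
  have vs: "v p < v q" if "p < q" "q \<le> r" for p q
    by (rule grid_less[of r v, OF mono that])
  have vle_iff: "v p \<le> v q \<longleftrightarrow> p \<le> q" if "p \<le> r" "q \<le> r" for p q
    using vs[of p q] vs[of q p] that by (cases p q rule: linorder_cases) auto
  have vlt_iff: "v p < v q \<longleftrightarrow> p < q" if "p \<le> r" "q \<le> r" for p q
    using vs[of p q] vs[of q p] that by (cases p q rule: linorder_cases) auto
  have *: "(\<Sum>j<r. indicator {\<tau> i<..\<tau> (Suc i)} (v (Suc j)) * (B (v (Suc j)) \<omega> - B (v j) \<omega>))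
      = B (\<tau> (Suc i)) \<omega> - B (\<tau> i) \<omega>" if i: "i < n" for i
  proof -
    obtain p where p: "p \<le> r" "\<tau> i = v p" using sub[of i] i by auto
    obtain q where q: "q \<le> r" "\<tau> (Suc i) = v q" using sub[of "Suc i"] i by auto
    have pq: "p \<le> q" using tau[OF i] p q vle_iff by simp
    have "(\<Sum>j<r. indicator {\<tau> i<..\<tau> (Suc i)} (v (Suc j)) * (B (v (Suc j)) \<omega> - B (v j) \<omega>))
       = (\<Sum>j\<in>{..<r}. if j \<in> {p..<q} then B (v (Suc j)) \<omega> - B (v j) \<omega> else 0)"
    proof (intro sum.cong refl)
      fix j assume "j \<in> {..<r}"
      then have j: "v p < v (Suc j) \<longleftrightarrow> p \<le> j" "v (Suc j) \<le> v q \<longleftrightarrow> j < q"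
        using vlt_iff[of p "Suc j"] vle_iff[of "Suc j" q] p q by auto
      show "indicator {\<tau> i<..\<tau> (Suc i)} (v (Suc j)) * (B (v (Suc j)) \<omega> - B (v j) \<omega>)
         = (if j \<in> {p..<q} then B (v (Suc j)) \<omega> - B (v j) \<omega> else 0)"
        by (simp add: indicator_def p(2) q(2) j)
    qed
    also have "\<dots> = (\<Sum>j\<in>{..<r} \<inter> {p..<q}. B (v (Suc j)) \<omega> - B (v j) \<omega>)"
      by (rule sum.inter_restrict[symmetric]) simp
    also have "{..<r} \<inter> {p..<q} = {p..<q}" using q by auto
    also have "(\<Sum>j\<in>{p..<q}. B (v (Suc j)) \<omega> - B (v j) \<omega>) = B (v q) \<omega> - B (v p) \<omega>"
      using pq by (rule sum_Suc_diff')
    finally show ?thesis using p q by simp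
  qed
  have "(\<Sum>j<r. simple_process n \<tau> \<xi> (v (Suc j)) \<omega> * (B (v (Suc j)) \<omega> - B (v j) \<omega>))
     = (\<Sum>j<r. \<Sum>i<n. \<xi> i \<omega> * (indicator {\<tau> i<..\<tau> (Suc i)} (v (Suc j)) * (B (v (Suc j)) \<omega> - B (v j) \<omega>)))"
    by (simp only: simple_process_def sum_distrib_right mult.assoc)
  also have "\<dots> = (\<Sum>i<n. \<xi> i \<omega> * (\<Sum>j<r. indicator {\<tau> i<..\<tau> (Suc i)} (v (Suc j)) * (B (v (Suc j)) \<omega> - B (v j) \<omega>)))"
    by (subst sum.swap) (simp only: sum_distrib_left)
  also have "\<dots> = simple_integral B n \<tau> \<xi> \<omega>"
    unfolding simple_integral_def by (intro sum.cong refl) (simp only: * lessThan_iff)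
  finally show ?thesis by simp
qed

lemma step_function_integral_le:
  fixes D :: "real \<Rightarrow> real"
  assumes mono: "\<And>j. j < r \<Longrightarrow> v j < v (Suc j)"
    and v: "\<And>j. j \<le> r \<Longrightarrow> v j \<in> {0..T}"
    and D: "\<And>j s. j < r \<Longrightarrow> s \<in> {v j<..v (Suc j)} \<Longrightarrow> D s = D (v (Suc j))"
  shows "ennreal (\<Sum>j<r. (D (v (Suc j)))^2 * (v (Suc j) - v j)) \<le> (\<integral>\<^sup>+s\<in>{0..T}. ennreal ((D s)\<^sup>2) \<partial>lborel)"
proof -
  have vs: "v p < v q" if "p < q" "q \<le> r" for p q
    by (rule grid_less[of r v, OF mono that])
  have vle: "v p \<le> v q" if "p \<le> q" "q \<le> r" for p q
    using vs[of p q] that by (cases "p = q") auto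
  have "ennreal (\<Sum>j<r. (D (v (Suc j)))^2 * (v (Suc j) - v j))
     = (\<Sum>j<r. ennreal ((D (v (Suc j)))^2 * (v (Suc j) - v j)))"
  proof (rule sum_ennreal[symmetric])
    fix j assume "j \<in> {..<r}"
    then show "0 \<le> (D (v (Suc j)))\<^sup>2 * (v (Suc j) - v j)" using mono[of j] by simp
  qed
  also have "\<dots> = (\<Sum>j<r. \<integral>\<^sup>+s. ennreal ((D (v (Suc j)))^2) * indicator {v j<..v (Suc j)} s \<partial>lborel)"
  proof (intro sum.cong refl)
    fix j assume "j \<in> {..<r}"
    then have "v j < v (Suc j)" using mono[of j] by simp
    then show "ennreal ((D (v (Suc j)))^2 * (v (Suc j) - v j))
      = (\<integral>\<^sup>+s. ennreal ((D (v (Suc j)))^2) * indicator {v j<..v (Suc j)} s \<partial>lborel)"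
      by (simp add: nn_integral_cmult_indicator ennreal_mult)
  qed
  also have "\<dots> = (\<integral>\<^sup>+s. (\<Sum>j<r. ennreal ((D (v (Suc j)))^2) * indicator {v j<..v (Suc j)} s) \<partial>lborel)"
    by (rule nn_integral_sum[symmetric]) simp
  also have "\<dots> \<le> (\<integral>\<^sup>+s\<in>{0..T}. ennreal ((D s)\<^sup>2) \<partial>lborel)"
  proof (rule nn_integral_mono)
    fix s
    show "(\<Sum>j<r. ennreal ((D (v (Suc j)))^2) * indicator {v j<..v (Suc j)} s) \<le> ennreal ((D s)\<^sup>2) * indicator {0..T} s"
    proof (cases "\<exists>i<r. s \<in> {v i<..v (Suc i)}")
      case True
      then obtain i where i: "i < r" "s \<in> {v i<..v (Suc i)}" by auto
      have "(\<Sum>j<r. ennreal ((D (v (Suc j)))^2) * indicator {v j<..v (Suc j)} s)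
         = (\<Sum>j<r. if j = i then ennreal ((D (v (Suc i)))^2) else 0)"
      proof (intro sum.cong refl)
        fix j assume j: "j \<in> {..<r}"
        have "s \<notin> {v j<..v (Suc j)}" if "j \<noteq> i"
        proof (cases "j < i")
          case True
          then show ?thesis using vle[of "Suc j" i] i by auto
        next
          case False
          then have "Suc i \<le> j" using that by simp
          then show ?thesis using vle[of "Suc i" j] i j by auto
        qed
        then show "ennreal ((D (v (Suc j)))^2) * indicator {v j<..v (Suc j)} s
            = (if j = i then ennreal ((D (v (Suc i)))^2) else 0)"
          using i by (cases "j = i") auto
      qed
      also have "\<dots> = ennreal ((D (v (Suc i)))^2)" using i by simp
      also have "D (v (Suc i)) = D s" using D[OF i] by simp
      finally show ?thesis using i v[of i] v[of "Suc i"] by (auto simp: indicator_def)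
    next
      case False
      then have "(\<Sum>j<r. ennreal ((D (v (Suc j)))^2) * indicator {v j<..v (Suc j)} s) = 0"
        by (intro sum.neutral) (auto simp: indicator_def)
      then show ?thesis by simp
    qed
  qed
  finally show ?thesis .
qed

lemma sorted_enumeration:
  fixes P :: "real set"
  assumes P: "finite P" "P \<noteq> {}"
  obtains v r where "\<And>j. j < r \<Longrightarrow> v j < v (Suc j)" "v ` {..r} = P"
proof -
  define xs where "xs = sorted_list_of_set P"
  have xs: "set xs = P" "sorted_wrt (<) xs" using P by (auto simp: xs_def)
  then have len: "0 < length xs" using P by auto
  define r where "r = length xs - 1"
  show thesis
  proof (rule that[of r "\<lambda>j. xs ! j"])
    fix j assume "j < r"
    then show "xs ! j < xs ! Suc j" using xs(2) by (auto simp: r_def sorted_wrt_iff_nth_less)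
  next
    have "length xs = Suc r" using len by (simp add: r_def)
    then have "{..r} = {..<length xs}" by (simp only: lessThan_Suc_atMost)
    moreover have "(\<lambda>j. xs ! j) ` {..<length xs} = set xs" by (auto simp: set_conv_nth)
    ultimately show "(\<lambda>j. xs ! j) ` {..r} = P" using xs(1) by (simp only:)
  qed
qed

lemma uniform_grid_cell:
  assumes p: "0 < p" and T: "0 < T" and s: "0 < s" "s \<le> T"
  obtains l :: nat where "l < p" "s \<in> {T * real l / real p<..T * real (Suc l) / real p}"
proof -
  define z where "z = s * real p / T"
  have z: "0 < z" "z \<le> real p" using assms by (auto simp: z_def field_simps)
  \<comment> \<open>The cells are open on the left, hence the ceiling minus one and not the floor.\<close>
  define l where "l = nat (\<lceil>z\<rceil> - 1)"
  have c: "\<lceil>z\<rceil> \<ge> 1" using z by linarith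
  have l: "real l = of_int \<lceil>z\<rceil> - 1" using c by (simp add: l_def)
  have "real l < z" "z \<le> real l + 1" unfolding l by linarith+
  moreover have "l < p" using \<open>real l < z\<close> z by linarith
  ultimately show thesis
    using assms by (intro that[of l]) (auto simp: z_def field_simps)
qed

lemma uniform_grid_simple_process:
  assumes p: "0 < p" and T: "0 < T" and l: "l < p"
    and s: "s \<in> {T * real l / real p<..T * real (Suc l) / real p}"
  shows "simple_process p (\<lambda>l. T * real l / real p) \<xi> s \<omega> = \<xi> l \<omega>"
proof -
  have mono: "T * real i / real p \<le> T * real j / real p" if "i \<le> j" for i j
    using that p T by (intro divide_right_mono mult_left_mono) auto
  have "(\<Sum>i<p. \<xi> i \<omega> * indicator {T * real i / real p<..T * real (Suc i) / real p} s)
     = (\<Sum>i<p. if i = l then \<xi> l \<omega> else 0)"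
  proof (intro sum.cong refl)
    fix i assume "i \<in> {..<p}"
    have "s \<notin> {T * real i / real p<..T * real (Suc i) / real p}" if "i \<noteq> l"
    proof (cases "i < l")
      case True
      then show ?thesis using mono[of "Suc i" l] s by simp
    next
      case False
      then show ?thesis using that mono[of "Suc l" i] s by simp
    qed
    then show "\<xi> i \<omega> * indicator {T * real i / real p<..T * real (Suc i) / real p} s = (if i = l then \<xi> l \<omega> else 0)"
      using s by (cases "i = l") auto
  qed
  then show ?thesis using l by (simp only: simple_process_def) simp
qed

lemma uniform_grid_approximation:
  fixes h :: "real \<Rightarrow> real"
  assumes T: "0 < T" and cont: "continuous_on {0..T} h"
    and R: "\<And>p l s. 0 < p \<Longrightarrow> l < p \<Longrightarrow> s \<in> {T * real l / real p<..T * real (Suc l) / real p} \<Longrightarrow> R p s = h (T * real l / real p)"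
  shows "(\<lambda>p. \<integral>\<^sup>+s\<in>{0..T}. ennreal ((h s - R p s)\<^sup>2) \<partial>lborel) \<longlonglongrightarrow> 0"
proof (rule order_tendstoI)
  fix c :: ennreal assume c: "0 < c"
  obtain e :: real where e: "0 < e" "ennreal (e^2 * T) < c"
  proof (cases "c = \<infinity>")
    case True
    then show ?thesis using that[of 1] by (simp add: ennreal_less_top)
  next
    case False
    then obtain c' where c': "c = ennreal c'" "0 < c'" using c
      by (cases c) (auto simp: zero_less_iff_neq_zero)
    show ?thesis
    proof (rule that[of "sqrt (c' / (2 * T))"])
      show "0 < sqrt (c' / (2 * T))" using c' T by simp
      have "(sqrt (c' / (2 * T)))^2 * T = c' / 2" using c' T by simp
      then show "ennreal ((sqrt (c' / (2 * T)))^2 * T) < c" using c' by (simp add: ennreal_lessI)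
    qed
  qed
  have "uniformly_continuous_on {0..T} h" using cont by (intro compact_uniformly_continuous) auto
  then obtain d where d: "0 < d" "\<And>x y. x \<in> {0..T} \<Longrightarrow> y \<in> {0..T} \<Longrightarrow> dist y x < d \<Longrightarrow> dist (h y) (h x) < e"
    using e(1) unfolding uniformly_continuous_on_def by metis
  obtain P :: nat where P: "T / d < real P" using reals_Archimedean2 by blast
  show "eventually (\<lambda>p. (\<integral>\<^sup>+s\<in>{0..T}. ennreal ((h s - R p s)\<^sup>2) \<partial>lborel) < c) sequentially"
    using eventually_ge_at_top[of "max P 1"]
  proof eventually_elim
    case (elim p)
    then have p: "0 < p" and "T / d < real p" using P by auto
    then have Tp: "T / real p < d" using d T by (simp add: field_simps)
    have "(\<integral>\<^sup>+s\<in>{0..T}. ennreal ((h s - R p s)\<^sup>2) \<partial>lborel) \<le> (\<integral>\<^sup>+s. ennreal (e^2) * indicator {0..T} s \<partial>lborel)"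
    proof (rule nn_integral_mono_AE)
      \<comment> \<open>Time zero belongs to no cell of the grid.\<close>
      have "AE s in lborel. s \<noteq> (0::real)" by (rule AE_lborel_singleton)
      then show "AE s in lborel. ennreal ((h s - R p s)\<^sup>2) * indicator {0..T} s \<le> ennreal (e^2) * indicator {0..T} s"
      proof eventually_elim
        case (elim s)
        show ?case
        proof (cases "s \<in> {0..T}")
          case True
          with elim have s: "0 < s" "s \<le> T" by auto
          obtain l where l: "l < p" "s \<in> {T * real l / real p<..T * real (Suc l) / real p}"
            using uniform_grid_cell[OF p T s] by blast
          have "T * real (Suc l) / real p - T * real l / real p = T / real p"
            by (simp add: diff_divide_distrib[symmetric] algebra_simps)
          then have "dist s (T * real l / real p) < d" using l Tp by (auto simp: dist_real_def)
          moreover have "0 \<le> T * real l / real p" using T by simp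
          moreover have "T * real l / real p \<le> T" using l s by auto
          ultimately have "\<bar>h s - h (T * real l / real p)\<bar> < e"
            using d(2)[of "T * real l / real p" s] True by (auto simp: dist_real_def)
          then have "(h s - R p s)^2 \<le> e^2" using R[OF p l] e by (simp add: abs_le_square_iff[symmetric])
          then show ?thesis by (intro mult_right_mono ennreal_leI) auto
        qed simp
      qed
    qed
    also have "\<dots> = ennreal (e^2 * T)"
      using T by (simp add: nn_integral_cmult_indicator ennreal_mult)
    also note e(2)
    finally show ?case .
  qed
qed simp

context brownian
begin

lemma measurable_F_pair:
  assumes "f \<in> borel_measurable (N \<Otimes>\<^sub>M F T)" "T \<le> 1"
  shows "f \<in> borel_measurable (N \<Otimes>\<^sub>M M)"
proof -
  have "(\<lambda>\<omega>. \<omega>) \<in> measurable M (F T)" using measurable_F_M[of "\<lambda>\<omega>. \<omega>" T "F T"] assms(2) by simp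
  then have "(\<lambda>z. (fst z, snd z)) \<in> measurable (N \<Otimes>\<^sub>M M) (N \<Otimes>\<^sub>M F T)"
    by (intro measurable_Pair measurable_fst measurable_compose[OF measurable_snd])
  from measurable_compose[OF this assms(1)] show ?thesis by simp
qed

text \<open>
  Only the values of the process on the time interval are known to be measurable, therefore the
  integral over time is rewritten over the restricted measure space.
\<close>

lemma measurable_time_integral:
  fixes T :: real
  assumes f: "(\<lambda>(s, \<omega>). f s \<omega>) \<in> borel_measurable (restrict_space borel {0..T} \<Otimes>\<^sub>M M)"
  shows "(\<lambda>\<omega>. \<integral>\<^sup>+s\<in>{0..T}. ennreal ((f s \<omega>)\<^sup>2) \<partial>lborel) \<in> borel_measurable M"
proof -
  let ?R = "restrict_space lborel {0..T}"
  interpret R: finite_measure ?R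
  proof (rule finite_measureI)
    have "emeasure ?R {0..T} = emeasure lborel {0..T}"
      by (rule emeasure_restrict_space) auto
    then show "emeasure ?R (space ?R) \<noteq> \<infinity>" by (simp add: space_restrict_space emeasure_lborel_Icc_eq)
  qed
  have sets_eq: "sets (?R \<Otimes>\<^sub>M M) = sets (restrict_space borel {0..T} \<Otimes>\<^sub>M M)"
    by (intro sets_pair_measure_cong sets_restrict_space_cong) auto
  have "(\<lambda>(s, \<omega>). f s \<omega>) \<in> borel_measurable (?R \<Otimes>\<^sub>M M)"
    using f measurable_cong_sets[OF sets_eq refl] by simp
  then have "(\<lambda>z. f (fst z) (snd z)) \<in> borel_measurable (?R \<Otimes>\<^sub>M M)" by (simp add: split_beta')
  from measurable_pair_swap[OF this] have [measurable]: "(\<lambda>(\<omega>, s). f s \<omega>) \<in> borel_measurable (M \<Otimes>\<^sub>M ?R)"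
    by (simp add: split_beta')
  have "(\<lambda>(\<omega>, s). ennreal ((f s \<omega>)\<^sup>2)) \<in> borel_measurable (M \<Otimes>\<^sub>M ?R)" by measurable
  then have "(\<lambda>\<omega>. \<integral>\<^sup>+s. ennreal ((f s \<omega>)\<^sup>2) \<partial>?R) \<in> borel_measurable M"
    by (rule R.borel_measurable_nn_integral)
  then show ?thesis by (simp add: nn_integral_restrict_space)
qed

lemma simple_process_measurable:
  assumes "\<And>i. i < n \<Longrightarrow> \<xi> i \<in> borel_measurable M"
  shows "(\<lambda>(s, \<omega>). simple_process n \<tau> \<xi> s \<omega>) \<in> borel_measurable (restrict_space borel {0..T} \<Otimes>\<^sub>M M)"
  unfolding simple_process_def split_beta'
proof (intro borel_measurable_sum borel_measurable_times)
  fix i assume "i \<in> {..<n}"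
  then show "(\<lambda>z. \<xi> i (snd z)) \<in> borel_measurable (restrict_space borel {0..T} \<Otimes>\<^sub>M M)"
    using assms[of i] by (intro measurable_compose[OF measurable_snd]) auto
  show "(\<lambda>z. indicator {\<tau> i<..\<tau> (Suc i)} (fst z) :: real) \<in> borel_measurable (restrict_space borel {0..T} \<Otimes>\<^sub>M M)"
    by (intro measurable_compose[OF measurable_fst] measurable_restrict_space1) simp
qed

text \<open>
  Simple data without the boundedness of the coefficients, so that the Riemann sums of an unbounded
  process are included.
\<close>

definition adapted_simple :: "real \<Rightarrow> nat \<Rightarrow> (nat \<Rightarrow> real) \<Rightarrow> (nat \<Rightarrow> 'w \<Rightarrow> real) \<Rightarrow> bool" where
  "adapted_simple T n \<tau> \<xi> \<longleftrightarrow> (\<forall>i\<le>n. \<tau> i \<in> {0..T}) \<and> (\<forall>i<n. \<tau> i \<le> \<tau> (Suc i)) \<and>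
     (\<forall>i<n. \<xi> i \<in> borel_measurable (F (\<tau> i)))"

lemma simple_data_adapted: "simple_data M F T n \<tau> \<xi> \<Longrightarrow> adapted_simple T n \<tau> \<xi>"
  by (auto simp: simple_data_def adapted_simple_def)

lemma adapted_simpleD:
  assumes "adapted_simple T n \<tau> \<xi>"
  shows "i \<le> n \<Longrightarrow> \<tau> i \<in> {0..T}" "i < n \<Longrightarrow> \<tau> i \<le> \<tau> (Suc i)"
    "i < n \<Longrightarrow> \<xi> i \<in> borel_measurable (F (\<tau> i))"
  using assms unfolding adapted_simple_def by blast+

lemma adapted_simple_measurable_M:
  assumes A: "adapted_simple T n \<tau> \<xi>" and T: "T \<le> 1" and i: "i < n"
  shows "\<xi> i \<in> borel_measurable M"
proof (rule measurable_F_M[OF adapted_simpleD(3)[OF A i]])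
  show "\<tau> i \<le> 1" using adapted_simpleD(1)[OF A, of i] i T by simp
qed

lemma simple_integral_measurable:
  assumes A: "adapted_simple T n \<tau> \<xi>" and T: "T \<le> 1"
  shows "simple_integral B n \<tau> \<xi> \<in> borel_measurable M"
  unfolding simple_integral_def
proof (intro borel_measurable_sum borel_measurable_times borel_measurable_diff)
  fix i assume "i \<in> {..<n}"
  then have i: "i < n" by simp
  show "\<xi> i \<in> borel_measurable M" by (rule adapted_simple_measurable_M[OF A T i])
  have "\<tau> i \<in> {0..T}" "\<tau> (Suc i) \<in> {0..T}"
    using i by (simp_all add: adapted_simpleD(1)[OF A] del: atLeastAtMost_iff)
  then show "B (\<tau> i) \<in> borel_measurable M" "B (\<tau> (Suc i)) \<in> borel_measurable M"
    using T by (auto intro!: B_measurable)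
qed

lemma simple_process_adapted:
  assumes A: "adapted_simple T n \<tau> \<xi>"
    and mono: "\<And>j. j < r \<Longrightarrow> v j < v (Suc j)"
    and sub: "\<And>i. i \<le> n \<Longrightarrow> \<tau> i \<in> v ` {..r}" and j: "j < r"
  shows "simple_process n \<tau> \<xi> (v (Suc j)) \<in> borel_measurable (F (v j))"
  unfolding simple_process_def
proof (rule borel_measurable_sum)
  have vs: "v p < v q" if "p < q" "q \<le> r" for p q
    by (rule grid_less[of r v, OF mono that])
  fix i assume "i \<in> {..<n}"
  then have i: "i < n" by simp
  obtain p where p: "p \<le> r" "\<tau> i = v p" using sub[of i] i by auto
  show "(\<lambda>\<omega>. \<xi> i \<omega> * indicator {\<tau> i<..\<tau> (Suc i)} (v (Suc j))) \<in> borel_measurable (F (v j))"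
  proof (cases "p \<le> j")
    case True
    then have "\<tau> i \<le> v j" using vs[of p j] p j by (cases "p = j") auto
    then have "\<xi> i \<in> borel_measurable (F (v j))"
      by (rule measurable_F_mono[OF adapted_simpleD(3)[OF A i]])
    then show ?thesis by simp
  next
    case False
    then have "\<not> \<tau> i < v (Suc j)" using vs[of "Suc j" p] p by (cases "p = Suc j") auto
    then show ?thesis by (simp add: indicator_def)
  qed
qed

text \<open>
  Both integrals are written on the grid of all their partition points, where their difference is a
  single sum to which the Lenglart inequality applies.
\<close>

lemma simple_integral_diff_prob:
  assumes A: "adapted_simple T n \<tau> \<xi>" and A': "adapted_simple T n' \<tau>' \<xi>'"
    and T: "T \<le> 1" and e: "0 < \<epsilon>" and d: "0 \<le> \<delta>"
  shows "prob {\<omega>\<in>space M. \<epsilon> < \<bar>simple_integral B n \<tau> \<xi> \<omega> - simple_integral B n' \<tau>' \<xi>' \<omega>\<bar>}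
    \<le> \<delta> / \<epsilon>^2 + prob {\<omega>\<in>space M.
         ennreal \<delta> < (\<integral>\<^sup>+s\<in>{0..T}. ennreal ((simple_process n \<tau> \<xi> s \<omega> - simple_process n' \<tau>' \<xi>' s \<omega>)\<^sup>2) \<partial>lborel)}"
proof -
  define P where "P = \<tau> ` {..n} \<union> \<tau>' ` {..n'}"
  have P: "finite P" "P \<noteq> {}" by (auto simp: P_def)
  obtain v r where mono: "\<And>j. j < r \<Longrightarrow> v j < v (Suc j)" and vP: "v ` {..r} = P"
    using sorted_enumeration[OF P] by metis
  have sub: "\<tau> i \<in> v ` {..r}" if "i \<le> n" for i using that unfolding vP P_def by auto
  have sub': "\<tau>' i \<in> v ` {..r}" if "i \<le> n'" for i using that unfolding vP P_def by auto
  have "P \<subseteq> {0..T}" unfolding P_def using adapted_simpleD(1)[OF A] adapted_simpleD(1)[OF A'] by blast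
  then have vT: "v j \<in> {0..T}" if "j \<le> r" for j using that vP by blast
  define D where "D s \<omega> = simple_process n \<tau> \<xi> s \<omega> - simple_process n' \<tau>' \<xi>' s \<omega>" for s \<omega>
  have diff: "simple_integral B n \<tau> \<xi> \<omega> - simple_integral B n' \<tau>' \<xi>' \<omega>
     = (\<Sum>j<r. D (v (Suc j)) \<omega> * (B (v (Suc j)) \<omega> - B (v j) \<omega>))" for \<omega>
  proof -
    have "simple_integral B n \<tau> \<xi> \<omega> = (\<Sum>j<r. simple_process n \<tau> \<xi> (v (Suc j)) \<omega> * (B (v (Suc j)) \<omega> - B (v j) \<omega>))"
      by (rule simple_integral_refine[of r v n \<tau>, OF mono sub adapted_simpleD(2)[OF A]])
    moreover have "simple_integral B n' \<tau>' \<xi>' \<omega> = (\<Sum>j<r. simple_process n' \<tau>' \<xi>' (v (Suc j)) \<omega> * (B (v (Suc j)) \<omega> - B (v j) \<omega>))"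
      by (rule simple_integral_refine[of r v n' \<tau>', OF mono sub' adapted_simpleD(2)[OF A']])
    ultimately show ?thesis by (simp only: D_def left_diff_distrib sum_subtractf)
  qed
  have Dv: "D (v (Suc j)) \<in> borel_measurable (F (v j))" if "j < r" for j
    unfolding D_def
    using simple_process_adapted[of T n \<tau> \<xi> r v j, OF A mono sub that]
      simple_process_adapted[of T n' \<tau>' \<xi>' r v j, OF A' mono sub' that]
    by (rule borel_measurable_diff)
  have Dm: "(\<lambda>(s, \<omega>). D s \<omega>) \<in> borel_measurable (restrict_space borel {0..T} \<Otimes>\<^sub>M M)"
    using borel_measurable_diff[OF simple_process_measurable[of n \<xi>, OF adapted_simple_measurable_M[OF A T]]
      simple_process_measurable[of n' \<xi>', OF adapted_simple_measurable_M[OF A' T]]]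
    by (simp add: D_def split_beta')
  have [measurable]: "(\<lambda>\<omega>. \<integral>\<^sup>+s\<in>{0..T}. ennreal ((D s \<omega>)\<^sup>2) \<partial>lborel) \<in> borel_measurable M"
    by (rule measurable_time_integral[OF Dm])
  have v1: "v j \<in> {0..1}" if "j \<le> r" for j using vT[OF that] T by auto
  have "prob {\<omega>\<in>space M. \<epsilon> < \<bar>\<Sum>j<r. D (v (Suc j)) \<omega> * (B (v (Suc j)) \<omega> - B (v j) \<omega>)\<bar>}
    \<le> \<delta> / \<epsilon>^2 + prob {\<omega>\<in>space M. \<delta> < (\<Sum>j<r. (D (v (Suc j)) \<omega>)^2 * (v (Suc j) - v j))}"
    by (rule lenglart_inequality[of r v "\<lambda>j. D (v (Suc j))", OF v1 less_imp_le[OF mono] Dv e d])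
  also have "prob {\<omega>\<in>space M. \<delta> < (\<Sum>j<r. (D (v (Suc j)) \<omega>)^2 * (v (Suc j) - v j))}
     \<le> prob {\<omega>\<in>space M. ennreal \<delta> < (\<integral>\<^sup>+s\<in>{0..T}. ennreal ((D s \<omega>)\<^sup>2) \<partial>lborel)}"
  proof (rule finite_measure_mono)
    show "{\<omega>\<in>space M. \<delta> < (\<Sum>j<r. (D (v (Suc j)) \<omega>)^2 * (v (Suc j) - v j))}
       \<subseteq> {\<omega>\<in>space M. ennreal \<delta> < (\<integral>\<^sup>+s\<in>{0..T}. ennreal ((D s \<omega>)\<^sup>2) \<partial>lborel)}"
    proof safe
      fix \<omega> assume \<omega>: "\<omega> \<in> space M" and less: "\<delta> < (\<Sum>j<r. (D (v (Suc j)) \<omega>)^2 * (v (Suc j) - v j))"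
      have "ennreal \<delta> < ennreal (\<Sum>j<r. (D (v (Suc j)) \<omega>)^2 * (v (Suc j) - v j))"
        using less d by (simp add: ennreal_less_iff)
      also have "\<dots> \<le> (\<integral>\<^sup>+s\<in>{0..T}. ennreal ((D s \<omega>)\<^sup>2) \<partial>lborel)"
      proof (rule step_function_integral_le[of r v T "\<lambda>s. D s \<omega>", OF mono vT])
        fix j s assume "j < r" "s \<in> {v j<..v (Suc j)}"
        then show "D s \<omega> = D (v (Suc j)) \<omega>"
          unfolding D_def
          using simple_process_grid_cell[of r v n \<tau> j s \<xi> \<omega>, OF mono sub] simple_process_grid_cell[of r v n' \<tau>' j s \<xi>' \<omega>, OF mono sub']
          by simp
      qed
      finally show "ennreal \<delta> < (\<integral>\<^sup>+s\<in>{0..T}. ennreal ((D s \<omega>)\<^sup>2) \<partial>lborel)" .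
    qed
  qed measurable
  finally show ?thesis by (simp add: diff D_def)
qed

text \<open>
  Along almost every path the step functions on uniform grids converge to the integrand by uniform
  continuity. Compared with any sequence of simple integrands that defines I, both approximations
  are close to the integrand in L^2 of the time interval, so by the Lenglart inequality their
  integrals are close in probability.
\<close>

theorem riemann_sums_tendsto_ito_integral:
  assumes T: "0 < T" "T \<le> 1"
    and H: "\<And>s. s \<in> {0..T} \<Longrightarrow> H s \<in> borel_measurable (F s)"
    and cont: "AE \<omega> in M. continuous_on {0..T} (\<lambda>s. H s \<omega>)"
    and I: "has_ito_integral M F B H T I"
  shows "tendsto_prob (\<lambda>p \<omega>. \<Sum>l<p. H (T * real l / real p) \<omega> * (B (T * real (Suc l) / real p) \<omega> - B (T * real l / real p) \<omega>)) I"
proof -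
  from I obtain n \<tau> \<xi> where
    prog: "progressively_measurable F T H" and Im [measurable]: "I \<in> borel_measurable M" and
    sd: "\<And>m. simple_data M F T (n m) (\<tau> m) (\<xi> m)" and
    lim1: "\<And>\<epsilon>. 0 < \<epsilon> \<Longrightarrow> (\<lambda>m. prob {\<omega>\<in>space M.
            (\<integral>\<^sup>+s\<in>{0..T}. ennreal ((H s \<omega> - simple_process (n m) (\<tau> m) (\<xi> m) s \<omega>)\<^sup>2) \<partial>lborel)
              > ennreal \<epsilon>}) \<longlonglongrightarrow> 0" and
    lim2: "\<And>\<epsilon>. 0 < \<epsilon> \<Longrightarrow> (\<lambda>m. prob {\<omega>\<in>space M. \<bar>simple_integral B (n m) (\<tau> m) (\<xi> m) \<omega> - I \<omega>\<bar> > \<epsilon>}) \<longlonglongrightarrow> 0"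
    unfolding has_ito_integral_def by blast
  note as = simple_data_adapted[OF sd]
  define g where "g p l = T * real l / real p" for p l :: nat
  define z where "z p l = H (g p l)" for p l :: nat
  define R where "R p = simple_process p (g p) (z p)" for p :: nat
  define S where "S p = simple_integral B p (g p) (z p)" for p :: nat
  have g01: "g p l \<in> {0..T}" if "l \<le> p" for p l
  proof -
    have "T * real l \<le> T * real p" using that T by simp
    then show ?thesis using T by (cases "p = 0") (auto simp: g_def divide_le_eq)
  qed
  have ag: "adapted_simple T p (g p) (z p)" for p
    unfolding adapted_simple_def
  proof (intro conjI allI impI)
    fix i assume "i \<le> p" then show "g p i \<in> {0..T}" by (rule g01)
  next
    fix i show "g p i \<le> g p (Suc i)" using T unfolding g_def by (intro divide_right_mono mult_left_mono) auto
  next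
    fix i assume "i < p" then show "z p i \<in> borel_measurable (F (g p i))"
      unfolding z_def using g01[of i p] by (intro H) simp
  qed
  have Sm [measurable]: "S p \<in> borel_measurable M" for p
    unfolding S_def by (rule simple_integral_measurable[OF ag T(2)])
  have Jm [measurable]: "simple_integral B (n m) (\<tau> m) (\<xi> m) \<in> borel_measurable M" for m
    by (rule simple_integral_measurable[OF as T(2)])
  have Hm: "(\<lambda>(s, \<omega>). H s \<omega>) \<in> borel_measurable (restrict_space borel {0..T} \<Otimes>\<^sub>M M)"
    using prog T by (intro measurable_F_pair[where T=T]) (auto simp: progressively_measurable_def)
  have Rm: "(\<lambda>(s, \<omega>). R p s \<omega>) \<in> borel_measurable (restrict_space borel {0..T} \<Otimes>\<^sub>M M)" for p
    unfolding R_def by (rule simple_process_measurable[OF adapted_simple_measurable_M[OF ag T(2)]])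
  have Pm: "(\<lambda>(s, \<omega>). simple_process (n m) (\<tau> m) (\<xi> m) s \<omega>) \<in> borel_measurable (restrict_space borel {0..T} \<Otimes>\<^sub>M M)" for m
    by (rule simple_process_measurable[OF adapted_simple_measurable_M[OF as T(2)]])
  define dR where "dR p \<omega> = (\<integral>\<^sup>+s\<in>{0..T}. ennreal ((H s \<omega> - R p s \<omega>)\<^sup>2) \<partial>lborel)" for p \<omega>
  define dP where "dP m \<omega> = (\<integral>\<^sup>+s\<in>{0..T}. ennreal ((H s \<omega> - simple_process (n m) (\<tau> m) (\<xi> m) s \<omega>)\<^sup>2) \<partial>lborel)" for m \<omega>
  have dRm [measurable]: "dR p \<in> borel_measurable M" for p
    unfolding dR_def using borel_measurable_diff[OF Hm Rm[of p]]
    by (intro measurable_time_integral) (simp add: split_beta')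
  have dPm [measurable]: "dP m \<in> borel_measurable M" for m
    unfolding dP_def using borel_measurable_diff[OF Hm Pm[of m]]
    by (intro measurable_time_integral) (simp add: split_beta')
  have dR0: "AE \<omega> in M. (\<lambda>p. dR p \<omega>) \<longlonglongrightarrow> 0"
    using cont
  proof eventually_elim
    case (elim \<omega>)
    show ?case unfolding dR_def
    proof (rule uniform_grid_approximation[OF T(1) elim])
      fix p l :: nat and s assume "0 < p" "l < p" "s \<in> {T * real l / real p<..T * real (Suc l) / real p}"
      then show "R p s \<omega> = H (T * real l / real p) \<omega>"
        using uniform_grid_simple_process[of p T l s "z p" \<omega>] T unfolding R_def g_def z_def by simp
    qed
  qed
  have dR_lim: "(\<lambda>p. prob {\<omega>\<in>space M. ennreal c < dR p \<omega>}) \<longlonglongrightarrow> 0" if "0 < c" for c :: real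
    using that by (intro AE_tendsto_0_imp_prob dR0) auto
  have tri: "dR p \<omega> \<le> ennreal (\<delta> / 4) \<Longrightarrow> dP m \<omega> \<le> ennreal (\<delta> / 4) \<Longrightarrow> \<omega> \<in> space M \<Longrightarrow>
      (\<integral>\<^sup>+s\<in>{0..T}. ennreal ((R p s \<omega> - simple_process (n m) (\<tau> m) (\<xi> m) s \<omega>)\<^sup>2) \<partial>lborel) \<le> ennreal \<delta>"
    if "0 < \<delta>" for p m \<omega> \<delta>
  proof -
    assume a: "dR p \<omega> \<le> ennreal (\<delta> / 4)" "dP m \<omega> \<le> ennreal (\<delta> / 4)" and \<omega>: "\<omega> \<in> space M"
    let ?Q = "\<lambda>s. simple_process (n m) (\<tau> m) (\<xi> m) s \<omega>"
    have sec: "(\<lambda>s. f s \<omega>) \<in> borel_measurable (restrict_space borel {0..T})"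
      if "(\<lambda>(s, \<omega>). f s \<omega>) \<in> borel_measurable (restrict_space borel {0..T} \<Otimes>\<^sub>M M)" for f :: "real \<Rightarrow> 'w \<Rightarrow> real"
      using measurable_compose[OF measurable_Pair2'[OF \<omega>] that] by simp
    have rs: "sets (restrict_space lborel {0..T}) = sets (restrict_space borel {0..T})"
      by (rule sets_restrict_space_cong) simp
    note mc = measurable_cong_sets[OF rs refl]
    have [measurable]: "(\<lambda>s. H s \<omega>) \<in> borel_measurable (restrict_space lborel {0..T})"
      "(\<lambda>s. R p s \<omega>) \<in> borel_measurable (restrict_space lborel {0..T})"
      "?Q \<in> borel_measurable (restrict_space lborel {0..T})"
      using sec[OF Hm] sec[OF Rm] sec[OF Pm] by (simp_all add: mc)
    have "(\<integral>\<^sup>+s\<in>{0..T}. ennreal ((R p s \<omega> - ?Q s)\<^sup>2) \<partial>lborel)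
       = (\<integral>\<^sup>+s. ennreal ((R p s \<omega> - ?Q s)\<^sup>2) \<partial>restrict_space lborel {0..T})"
      by (simp add: nn_integral_restrict_space)
    also have "\<dots> \<le> (\<integral>\<^sup>+s. 2 * ennreal ((H s \<omega> - R p s \<omega>)\<^sup>2) + 2 * ennreal ((H s \<omega> - ?Q s)\<^sup>2) \<partial>restrict_space lborel {0..T})"
    proof (rule nn_integral_mono)
      fix s
      have "ennreal ((R p s \<omega> - ?Q s)\<^sup>2) \<le> ennreal (2 * (H s \<omega> - R p s \<omega>)\<^sup>2 + 2 * (H s \<omega> - ?Q s)\<^sup>2)"
        by (intro ennreal_leI square_diff_le)
      then show "ennreal ((R p s \<omega> - ?Q s)\<^sup>2) \<le> 2 * ennreal ((H s \<omega> - R p s \<omega>)\<^sup>2) + 2 * ennreal ((H s \<omega> - ?Q s)\<^sup>2)"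
        by (simp add: ennreal_plus ennreal_mult)
    qed
    also have "\<dots> = 2 * dR p \<omega> + 2 * dP m \<omega>"
      by (simp add: nn_integral_add nn_integral_cmult dR_def dP_def nn_integral_restrict_space)
    also have "\<dots> \<le> 2 * ennreal (\<delta> / 4) + 2 * ennreal (\<delta> / 4)"
      using a by (intro add_mono mult_left_mono) auto
    also have "\<dots> = ennreal (2 * (\<delta> / 4) + 2 * (\<delta> / 4))" using that by (simp only: ennreal_plus ennreal_mult) simp
    finally show ?thesis by simp
  qed
  have bound: "prob {\<omega>\<in>space M. \<epsilon> < \<bar>S p \<omega> - I \<omega>\<bar>} \<le> 4 * \<delta> / \<epsilon>^2 + prob {\<omega>\<in>space M. ennreal (\<delta>/4) < dR p \<omega>}"
    if e: "0 < \<epsilon>" and d: "0 < \<delta>" for p \<epsilon> \<delta>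
  proof -
    let ?J = "\<lambda>m. simple_integral B (n m) (\<tau> m) (\<xi> m)"
    let ?b = "\<lambda>m. 4 * \<delta> / \<epsilon>^2 + prob {\<omega>\<in>space M. ennreal (\<delta>/4) < dR p \<omega>}
       + prob {\<omega>\<in>space M. ennreal (\<delta>/4) < dP m \<omega>} + prob {\<omega>\<in>space M. \<epsilon>/2 < \<bar>?J m \<omega> - I \<omega>\<bar>}"
    have "prob {\<omega>\<in>space M. \<epsilon> < \<bar>S p \<omega> - I \<omega>\<bar>} \<le> ?b m" for m
    proof -
      let ?D = "\<lambda>\<omega>. \<integral>\<^sup>+s\<in>{0..T}. ennreal ((R p s \<omega> - simple_process (n m) (\<tau> m) (\<xi> m) s \<omega>)\<^sup>2) \<partial>lborel"
      have "prob {\<omega>\<in>space M. \<epsilon> < \<bar>S p \<omega> - I \<omega>\<bar>}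
          \<le> prob ({\<omega>\<in>space M. \<epsilon>/2 < \<bar>S p \<omega> - ?J m \<omega>\<bar>} \<union> {\<omega>\<in>space M. \<epsilon>/2 < \<bar>?J m \<omega> - I \<omega>\<bar>})"
      proof (rule finite_measure_mono)
        have "\<epsilon>/2 < \<bar>S p \<omega> - ?J m \<omega>\<bar> \<or> \<epsilon>/2 < \<bar>?J m \<omega> - I \<omega>\<bar>" if "\<epsilon> < \<bar>S p \<omega> - I \<omega>\<bar>" for \<omega>
          using that by linarith
        then show "{\<omega>\<in>space M. \<epsilon> < \<bar>S p \<omega> - I \<omega>\<bar>}
          \<subseteq> {\<omega>\<in>space M. \<epsilon>/2 < \<bar>S p \<omega> - ?J m \<omega>\<bar>} \<union> {\<omega>\<in>space M. \<epsilon>/2 < \<bar>?J m \<omega> - I \<omega>\<bar>}" by blast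
      qed auto
      also have "\<dots> \<le> prob {\<omega>\<in>space M. \<epsilon>/2 < \<bar>S p \<omega> - ?J m \<omega>\<bar>} + prob {\<omega>\<in>space M. \<epsilon>/2 < \<bar>?J m \<omega> - I \<omega>\<bar>}"
        by (rule measure_Un_le) auto
      also have "prob {\<omega>\<in>space M. \<epsilon>/2 < \<bar>S p \<omega> - ?J m \<omega>\<bar>} \<le> \<delta> / (\<epsilon>/2)^2 + prob {\<omega>\<in>space M. ennreal \<delta> < ?D \<omega>}"
        unfolding S_def R_def
        by (rule simple_integral_diff_prob[OF ag as T(2)]) (use e d in auto)
      also have "prob {\<omega>\<in>space M. ennreal \<delta> < ?D \<omega>}
          \<le> prob ({\<omega>\<in>space M. ennreal (\<delta>/4) < dR p \<omega>} \<union> {\<omega>\<in>space M. ennreal (\<delta>/4) < dP m \<omega>})"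
      proof (rule finite_measure_mono)
        show "{\<omega>\<in>space M. ennreal \<delta> < ?D \<omega>} \<subseteq> {\<omega>\<in>space M. ennreal (\<delta>/4) < dR p \<omega>} \<union> {\<omega>\<in>space M. ennreal (\<delta>/4) < dP m \<omega>}"
          using tri[OF d, of p _ m] by (auto simp: not_less[symmetric])
      qed auto
      also have "\<dots> \<le> prob {\<omega>\<in>space M. ennreal (\<delta>/4) < dR p \<omega>} + prob {\<omega>\<in>space M. ennreal (\<delta>/4) < dP m \<omega>}"
        by (rule measure_Un_le) auto
      also have "\<delta> / (\<epsilon>/2)^2 = 4 * \<delta> / \<epsilon>^2" by (simp add: power_divide)
      finally show ?thesis by simp
    qed
    moreover have "?b \<longlonglongrightarrow> 4 * \<delta> / \<epsilon>^2 + prob {\<omega>\<in>space M. ennreal (\<delta>/4) < dR p \<omega>} + 0 + 0"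
      using lim1[of "\<delta>/4"] lim2[of "\<epsilon>/2"] e d unfolding dP_def by (intro tendsto_intros) auto
    ultimately show ?thesis by (intro LIMSEQ_le_const[of ?b]) auto
  qed
  have "tendsto_prob S I"
    unfolding tendsto_prob_def
  proof (intro allI impI)
    fix \<epsilon> :: real assume e: "0 < \<epsilon>"
    show "(\<lambda>p. prob {\<omega>\<in>space M. \<epsilon> < \<bar>S p \<omega> - I \<omega>\<bar>}) \<longlonglongrightarrow> 0"
    proof (rule order_tendstoI)
      fix c :: real assume c: "0 < c"
      define \<delta> where "\<delta> = c * \<epsilon>^2 / 8"
      have d: "0 < \<delta>" using c e by (simp add: \<delta>_def)
      have "eventually (\<lambda>p. prob {\<omega>\<in>space M. ennreal (\<delta>/4) < dR p \<omega>} < c/2) sequentially"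
        using order_tendstoD(2)[OF dR_lim[of "\<delta>/4"], of "c/2"] c d by simp
      then show "eventually (\<lambda>p. prob {\<omega>\<in>space M. \<epsilon> < \<bar>S p \<omega> - I \<omega>\<bar>} < c) sequentially"
      proof eventually_elim
        case (elim p)
        have "4 * \<delta> / \<epsilon>^2 = c / 2" using e by (simp add: \<delta>_def)
        then show ?case using bound[OF e d, of p] elim by linarith
      qed
    next
      fix c :: real assume "c < 0"
      then show "eventually (\<lambda>p. c < prob {\<omega>\<in>space M. \<epsilon> < \<bar>S p \<omega> - I \<omega>\<bar>}) sequentially"
        by (intro always_eventually allI) (meson less_le_trans measure_nonneg)
    qed
  qed
  moreover have "S = (\<lambda>p \<omega>. \<Sum>l<p. H (T * real l / real p) \<omega> * (B (T * real (Suc l) / real p) \<omega> - B (T * real l / real p) \<omega>))"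
    by (intro ext) (simp only: S_def z_def g_def simple_integral_def)
  ultimately show ?thesis by simp
qed

abbreviation dB :: "nat \<Rightarrow> nat \<Rightarrow> 'w \<Rightarrow> real" where
  "dB n l \<omega> \<equiv> B (real (Suc l) / real n) \<omega> - B (real l / real n) \<omega>"

end

section \<open>Localisation of the solution\<close>

text \<open>
  A coefficient that is constant on blocks of P fine steps only sees the coarse increments.
\<close>

lemma block_sum_telescope:
  fixes c b :: "nat \<Rightarrow> real"
  assumes P: "0 < P"
  shows "(\<Sum>l<i * P. c (l div P) * (b (Suc l) - b l)) = (\<Sum>j<i. c j * (b (Suc j * P) - b (j * P)))"
proof -
  have "(\<Sum>l<i * P. c (l div P) * (b (Suc l) - b l))
     = (\<Sum>j<i. \<Sum>l=j * P..<j * P + P. c (l div P) * (b (Suc l) - b l))"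
    by (rule sum.nat_group[symmetric])
  also have "\<dots> = (\<Sum>j<i. c j * (b (Suc j * P) - b (j * P)))"
  proof (intro sum.cong refl)
    fix j
    have "(\<Sum>l=j * P..<j * P + P. c (l div P) * (b (Suc l) - b l)) = (\<Sum>l=j * P..<j * P + P. c j * (b (Suc l) - b l))"
    proof (intro sum.cong refl)
      fix l assume "l \<in> {j * P..<j * P + P}"
      then have "l div P = j" using P by (intro div_nat_eqI) (auto simp: mult.commute)
      then show "c (l div P) * (b (Suc l) - b l) = c j * (b (Suc l) - b l)" by simp
    qed
    also have "\<dots> = c j * (b (j * P + P) - b (j * P))"
      by (subst sum_distrib_left[symmetric]) (simp add: sum_Suc_diff')
    finally show "(\<Sum>l=j * P..<j * P + P. c (l div P) * (b (Suc l) - b l)) = c j * (b (Suc j * P) - b (j * P))"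
      by (simp add: add.commute)
  qed
  finally show ?thesis .
qed

text \<open>
  One constant L \<ge> 1 serves as bound of \<sigma>' and as Lipschitz constant of both \<sigma> and
  \<sigma> \<sigma>'. Being at least one, its powers are increasing, which saves case distinctions.
\<close>

locale wick_sde = brownian M B
  for M :: "'w measure" and B :: "real \<Rightarrow> 'w \<Rightarrow> real" +
  fixes \<sigma> :: "real \<Rightarrow> real" and a :: real and X :: "real \<Rightarrow> 'w \<Rightarrow> real" and L :: real
  assumes deriv_sigma: "\<And>x. (\<sigma> has_real_derivative deriv \<sigma> x) (at x)"
    and continuous_deriv: "continuous_on UNIV (deriv \<sigma>)"
    and L1: "1 \<le> L"
    and deriv_bound: "\<And>x. \<bar>deriv \<sigma> x\<bar> \<le> L"
    and sigma_lipschitz: "\<And>x y. \<bar>\<sigma> x - \<sigma> y\<bar> \<le> L * \<bar>x - y\<bar>"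
    and sigma_deriv_lipschitz: "\<And>x y. \<bar>\<sigma> x * deriv \<sigma> x - \<sigma> y * deriv \<sigma> y\<bar> \<le> L * \<bar>x - y\<bar>"
    and solution: "strong_solution M B \<sigma> a X"
begin

lemma sigma_measurable [measurable]: "\<sigma> \<in> borel_measurable borel"
  using deriv_sigma by (intro borel_measurable_continuous_onI continuous_at_imp_continuous_on ballI)
    (blast intro: DERIV_isCont)

lemma deriv_measurable [measurable]: "deriv \<sigma> \<in> borel_measurable borel"
  using continuous_deriv by (rule borel_measurable_continuous_onI)

lemma X_adapted: "t \<in> {0..1} \<Longrightarrow> X t \<in> borel_measurable (F t)"
  and X_continuous: "AE \<omega> in M. continuous_on {0..1} (\<lambda>t. X t \<omega>)"
  and X_start: "AE \<omega> in M. X 0 \<omega> = a"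
  and X_integral: "t \<in> {0..1} \<Longrightarrow> has_ito_integral M F B (\<lambda>s \<omega>. \<sigma> (X s \<omega>)) t (\<lambda>\<omega>. X t \<omega> - a)"
  using solution by (simp_all add: strong_solution_def)

lemma X_measurable: "t \<in> {0..1} \<Longrightarrow> X t \<in> borel_measurable M"
  using measurable_F_M[OF X_adapted] by simp

lemma grid_point: "0 < n \<Longrightarrow> i \<le> n \<Longrightarrow> real i / real n \<in> {0..1}"
  by (simp add: divide_le_eq)

lemma grid_ratio: "real (i * Suc p) / real (n * Suc p) = real i / real n"
  unfolding of_nat_mult by (rule mult_divide_mult_cancel_right) simp

text \<open>
  All sums belonging to a coarse grid use the refinements of the whole grid into n (p+1) steps, so
  that sums ending at different coarse times have a common time grid and can be subtracted.
\<close>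

lemma X_riemann_sums:
  assumes n: "0 < n" and i: "i \<le> n"
  shows "tendsto_prob (\<lambda>p \<omega>. \<Sum>l<i * Suc p. \<sigma> (X (real l / real (n * Suc p)) \<omega>)
      * dB (n * Suc p) l \<omega>) (\<lambda>\<omega>. X (real i / real n) \<omega> - a)"
proof (cases "i = 0")
  case True
  have "prob {\<omega>\<in>space M. \<epsilon> < \<bar>0 - (X 0 \<omega> - a)\<bar>} = 0" if "0 < \<epsilon>" for \<epsilon>
  proof -
    have "AE \<omega> in M. \<not> \<epsilon> < \<bar>0 - (X 0 \<omega> - a)\<bar>"
      using X_start by eventually_elim (use that in auto)
    then show ?thesis
      using X_measurable[of 0] by (subst prob_eq_0) auto
  qed
  then show ?thesis using True by (simp add: tendsto_prob_def)
next
  case False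
  define T where "T = real i / real n"
  have T: "0 < T" "T \<le> 1" using False n i by (auto simp: T_def)
  have "tendsto_prob (\<lambda>p \<omega>. \<Sum>l<p. \<sigma> (X (T * real l / real p) \<omega>) * (B (T * real (Suc l) / real p) \<omega> - B (T * real l / real p) \<omega>))
      (\<lambda>\<omega>. X T \<omega> - a)"
  proof (rule riemann_sums_tendsto_ito_integral[OF T])
    fix s assume "s \<in> {0..T}"
    then have [measurable]: "X s \<in> borel_measurable (F s)" using X_adapted[of s] T by auto
    show "(\<lambda>\<omega>. \<sigma> (X s \<omega>)) \<in> borel_measurable (F s)" by measurable
  next
    show "AE \<omega> in M. continuous_on {0..T} (\<lambda>s. \<sigma> (X s \<omega>))"
      using X_continuous
    proof eventually_elim
      case (elim \<omega>)
      have "continuous_on UNIV \<sigma>"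
        using deriv_sigma by (intro continuous_at_imp_continuous_on ballI) (blast intro: DERIV_isCont)
      moreover have "continuous_on {0..T} (\<lambda>t. X t \<omega>)"
        using elim T by (auto elim: continuous_on_subset)
      ultimately show ?case by (auto intro: continuous_on_compose2)
    qed
  next
    show "has_ito_integral M F B (\<lambda>s \<omega>. \<sigma> (X s \<omega>)) T (\<lambda>\<omega>. X T \<omega> - a)"
      using T by (intro X_integral) auto
  qed
  then have lim: "(\<lambda>p. prob {\<omega>\<in>space M. \<epsilon> < \<bar>(\<Sum>l<p. \<sigma> (X (T * real l / real p) \<omega>) * (B (T * real (Suc l) / real p) \<omega> - B (T * real l / real p) \<omega>)) - (X T \<omega> - a)\<bar>}) \<longlonglongrightarrow> 0"
    if "0 < \<epsilon>" for \<epsilon> using that by (rule tendsto_probD)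
  have sm: "strict_mono (\<lambda>p. i * Suc p)" using False by (intro strict_monoI) simp
  \<comment> \<open>The uniform grid on [0, i/n] with i (p+1) cells is the refined grid.\<close>
  have cancel: "(x / y * z) / (x * w) = z / (y * w)" if "x \<noteq> 0" for x y z w :: real
    using that by (cases "w = 0"; cases "y = 0"; simp add: field_simps)
  have eq: "T * real l / real (i * Suc p) = real l / real (n * Suc p)" for l p
    unfolding T_def of_nat_mult by (rule cancel) (use False in simp)
  show ?thesis
    unfolding tendsto_prob_def
  proof (intro allI impI)
    fix \<epsilon> :: real assume "0 < \<epsilon>"
    from LIMSEQ_subseq_LIMSEQ[OF lim[OF this] sm]
    show "(\<lambda>p. prob {\<omega>\<in>space M. \<epsilon> < \<bar>(\<Sum>l<i * Suc p. \<sigma> (X (real l / real (n * Suc p)) \<omega>)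
      * dB (n * Suc p) l \<omega>) - (X (real i / real n) \<omega> - a)\<bar>}) \<longlonglongrightarrow> 0"
      unfolding comp_def eq by (simp only: T_def)
  qed
qed

text \<open>
  The path stays within [-b, b] up to time t. Restricting to rational times makes the event
  measurable; this is harmless, as all grid points are rational.
\<close>

definition good :: "real \<Rightarrow> real \<Rightarrow> 'w set" where
  "good b t = {\<omega> \<in> space M. \<forall>q\<in>\<rat> \<inter> {0..t}. \<bar>X q \<omega>\<bar> \<le> b}"

lemma good_F: "t \<le> 1 \<Longrightarrow> good b t \<in> sets (F t)"
proof -
  assume t: "t \<le> 1"
  have "{\<omega> \<in> space (F t). \<forall>q\<in>\<rat> \<inter> {0..t}. \<bar>X q \<omega>\<bar> \<le> b} \<in> sets (F t)"
  proof (rule sets.sets_Collect_countable_All'[OF _ countable_Int1[OF countable_rat]])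
    fix q assume "q \<in> \<rat> \<inter> {0..t}"
    then have q: "q \<in> {0..1}" "q \<le> t" using t by simp_all
    have [measurable]: "X q \<in> borel_measurable (F t)"
      by (rule measurable_F_mono[OF X_adapted[OF q(1)] q(2)])
    show "{\<omega> \<in> space (F t). \<bar>X q \<omega>\<bar> \<le> b} \<in> sets (F t)" by measurable
  qed
  then show ?thesis by (simp add: good_def)
qed

lemma good_M: "t \<le> 1 \<Longrightarrow> good b t \<in> sets M"
  by (rule subsetD[OF sets_F_subset good_F])

lemma good_mono: "s \<le> t \<Longrightarrow> good b t \<subseteq> good b s"
  by (auto simp: good_def)

lemma good_bound: "\<omega> \<in> good b t \<Longrightarrow> t \<in> \<rat> \<Longrightarrow> 0 \<le> t \<Longrightarrow> \<bar>X t \<omega>\<bar> \<le> b"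
  by (auto simp: good_def)

lemma prob_good: "(\<lambda>b. prob (good (real b) 1)) \<longlonglongrightarrow> 1"
proof -
  have "(\<lambda>b. prob (good (real b) 1)) \<longlonglongrightarrow> prob (\<Union>b. good (real b) 1)"
  proof (rule finite_Lim_measure_incseq)
    show "range (\<lambda>b. good (real b) 1) \<subseteq> sets M" using good_M by auto
    show "incseq (\<lambda>b. good (real b) 1)"
    proof (intro monoI subsetI)
      fix b c :: nat and \<omega> assume "b \<le> c" "\<omega> \<in> good (real b) 1"
      then show "\<omega> \<in> good (real c) 1" unfolding good_def by (auto intro: order_trans)
    qed
  qed
  moreover have "prob (\<Union>b. good (real b) 1) = 1"
  proof (rule prob_eq_1[THEN iffD2])
    show "(\<Union>b. good (real b) 1) \<in> sets M" using good_M by auto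
    show "AE \<omega> in M. \<omega> \<in> (\<Union>b. good (real b) 1)"
      using X_continuous AE_space
    proof eventually_elim
      case (elim \<omega>)
      then have "bounded ((\<lambda>t. X t \<omega>) ` {0..1})"
        by (intro compact_imp_bounded compact_continuous_image) auto
      then obtain c where "\<forall>x\<in>(\<lambda>t. X t \<omega>) ` {0..1}. norm x \<le> c"
        unfolding bounded_iff by blast
      then have c: "\<bar>X t \<omega>\<bar> \<le> c" if "t \<in> {0..1}" for t using that by auto
      obtain b :: nat where "c \<le> real b" using real_arch_simple by blast
      have "\<omega> \<in> good (real b) 1"
        unfolding good_def using order_trans[OF c \<open>c \<le> real b\<close>] elim(2) by auto
      then show ?case by blast
    qed
  qed
  ultimately show ?thesis by simp
qed

lemma sigma_growth: "\<bar>x\<bar> \<le> b \<Longrightarrow> \<bar>\<sigma> x\<bar> \<le> \<bar>\<sigma> 0\<bar> + L * b"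
proof -
  assume b: "\<bar>x\<bar> \<le> b"
  have "\<bar>\<sigma> x - \<sigma> 0\<bar> \<le> L * \<bar>x\<bar>" using sigma_lipschitz[of x 0] by simp
  also have "\<dots> \<le> L * b" using b L1 by (intro mult_left_mono) auto
  finally show ?thesis by linarith
qed

text \<open>
  On the event that the path is bounded up to the final time it was bounded at all earlier times, so
  each coefficient may be multiplied by the indicator of its own time before the isometry is
  applied. Fatou's lemma carries the bound to the limit.
\<close>

lemma localized_isometry:
  assumes n: "0 < n" and i: "i \<le> n"
    and th: "\<And>p l. l < i * Suc p \<Longrightarrow> \<theta> p l \<in> borel_measurable (F (real l / real (n * Suc p)))"
    and I [measurable]: "I \<in> borel_measurable M"
    and lim: "tendsto_prob (\<lambda>p \<omega>. \<Sum>l<i * Suc p. \<theta> p l \<omega>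
      * dB (n * Suc p) l \<omega>) I"
    and c: "\<And>p. (\<Sum>l<i * Suc p. ennreal (1 / real (n * Suc p)) *
        sqmean (\<lambda>\<omega>. indicator (good b (real l / real (n * Suc p))) \<omega> * \<theta> p l \<omega>)) \<le> c"
  shows "sqmean (\<lambda>\<omega>. indicator (good b (real i / real n)) \<omega> * I \<omega>) \<le> c"
proof (rule fatou_prob[OF _ I _ lim])
  fix p
  define m where "m = n * Suc p"
  have m: "0 < m" using n by (simp add: m_def)
  have im: "i * Suc p \<le> m" using i unfolding m_def by (rule mult_le_mono1)
  define v where "v l = real l / real m" for l
  have v1: "v l \<in> {0..1}" if "l \<le> i * Suc p" for l
    unfolding v_def using that im m by (intro grid_point) auto
  have vm: "v l \<le> v (Suc l)" for l by (simp add: v_def divide_right_mono)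
  have vd: "v (Suc l) - v l = 1 / real m" for l by (simp add: v_def diff_divide_distrib[symmetric])
  have thv: "\<theta> p l \<in> borel_measurable (F (v l))" if "l < i * Suc p" for l
    using th[OF that] by (simp only: v_def m_def)
  define \<zeta> where "\<zeta> l \<omega> = indicator (good b (v l)) \<omega> * \<theta> p l \<omega>" for l \<omega>
  have zm: "\<zeta> l \<in> borel_measurable (F (v l))" if "l < i * Suc p" for l
  proof -
    have [measurable]: "good b (v l) \<in> sets (F (v l))" using v1[of l] that by (intro good_F) auto
    have [measurable]: "\<theta> p l \<in> borel_measurable (F (v l))" by (rule thv[OF that])
    show ?thesis unfolding \<zeta>_def by measurable
  qed
  have vend: "v (i * Suc p) = real i / real n" by (simp only: v_def m_def grid_ratio)
  have dinv: "(\<lambda>\<omega>. ito_sum v (\<theta> p) (i * Suc p) \<omega>) \<in> borel_measurable (F (v (i * Suc p)))"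
    by (rule partial_sum_adapted[of _ v "\<theta> p", OF v1 vm thv])
  then show "(\<lambda>\<omega>. \<Sum>l<i * Suc p. \<theta> p l \<omega>
      * dB (n * Suc p) l \<omega>) \<in> borel_measurable M"
    using measurable_F_M v1[of "i * Suc p"] unfolding v_def m_def by auto
  have "sqmean (\<lambda>\<omega>. indicator (good b (v (i * Suc p))) \<omega> * (ito_sum v (\<theta> p) (i * Suc p) \<omega>))
     \<le> sqmean (\<lambda>\<omega>. ito_sum v \<zeta> (i * Suc p) \<omega>)"
  proof (rule sqmean_mono)
    fix \<omega>
    show "\<bar>indicator (good b (v (i * Suc p))) \<omega> * (ito_sum v (\<theta> p) (i * Suc p) \<omega>)\<bar>
       \<le> \<bar>ito_sum v \<zeta> (i * Suc p) \<omega>\<bar>"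
    proof (cases "\<omega> \<in> good b (v (i * Suc p))")
      case True
      have "\<zeta> l \<omega> = \<theta> p l \<omega>" if "l < i * Suc p" for l
      proof -
        have "real l \<le> real (i * Suc p)" using that by (intro of_nat_mono less_imp_le)
        then have "v l \<le> v (i * Suc p)" unfolding v_def by (rule divide_right_mono) simp
        then have "\<omega> \<in> good b (v l)" using True good_mono by blast
        then show ?thesis by (simp add: \<zeta>_def)
      qed
      then have "(ito_sum v \<zeta> (i * Suc p) \<omega>) = (ito_sum v (\<theta> p) (i * Suc p) \<omega>)"
        by (intro sum.cong) auto
      then show ?thesis using True by simp
    qed simp
  qed
  also have "\<dots> = (\<Sum>l<i * Suc p. ennreal (v (Suc l) - v l) * sqmean (\<zeta> l))"
    by (rule ito_isometry[of _ v \<zeta>, OF v1 vm zm])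
  also have "\<dots> = (\<Sum>l<i * Suc p. ennreal (1 / real m) * sqmean (\<zeta> l))"
    by (simp only: vd)
  also have "\<dots> \<le> c"
  proof -
    have "\<zeta> l = (\<lambda>\<omega>. indicator (good b (real l / real (n * Suc p))) \<omega> * \<theta> p l \<omega>)" for l
      by (intro ext) (simp only: \<zeta>_def m_def v_def)
    then show ?thesis using c[of p] by (simp only: m_def)
  qed
  finally show "sqmean (\<lambda>\<omega>. indicator (good b (real i / real n)) \<omega> * (\<Sum>l<i * Suc p. \<theta> p l \<omega>
      * dB (n * Suc p) l \<omega>)) \<le> c"
    unfolding vend by (simp only: v_def m_def)
next
  show "(\<lambda>\<omega>. indicator (good b (real i / real n)) \<omega>) \<in> borel_measurable M"
    using good_M[of "real i / real n" b] grid_point[OF n i] by auto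
qed

section \<open>Convergence of the Euler scheme in probability\<close>

primrec euler :: "nat \<Rightarrow> nat \<Rightarrow> 'w \<Rightarrow> real" where
  "euler n 0 = (\<lambda>\<omega>. a)"
| "euler n (Suc l) = (\<lambda>\<omega>. euler n l \<omega> + \<sigma> (euler n l \<omega>) * dB n l \<omega>)"

lemma euler_adapted: "0 < n \<Longrightarrow> l \<le> n \<Longrightarrow> euler n l \<in> borel_measurable (F (real l / real n))"
proof (induction l)
  case (Suc l)
  have le: "real l / real n \<le> real (Suc l) / real n" by (simp add: divide_right_mono)
  have [measurable]: "euler n l \<in> borel_measurable (F (real (Suc l) / real n))"
    using Suc by (intro measurable_F_mono[OF _ le]) auto
  have [measurable]: "B (real l / real n) \<in> borel_measurable (F (real (Suc l) / real n))"
    "B (real (Suc l) / real n) \<in> borel_measurable (F (real (Suc l) / real n))"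
    using le by (auto intro!: B_adapted)
  show ?case unfolding euler.simps by measurable
qed simp

lemma euler_measurable: "0 < n \<Longrightarrow> l \<le> n \<Longrightarrow> euler n l \<in> borel_measurable M"
  using measurable_F_M[OF euler_adapted] grid_point[of n l] by auto

lemma euler_eq_fine_sum:
  assumes n: "0 < n"
  shows "euler n i \<omega> - a = (\<Sum>l<i * Suc p. \<sigma> (euler n (l div Suc p) \<omega>)
      * dB (n * Suc p) l \<omega>)"
proof -
  have "(\<Sum>l<i * Suc p. \<sigma> (euler n (l div Suc p) \<omega>)
      * dB (n * Suc p) l \<omega>)
     = (\<Sum>j<i. \<sigma> (euler n j \<omega>) * (B (real (Suc j * Suc p) / real (n * Suc p)) \<omega> - B (real (j * Suc p) / real (n * Suc p)) \<omega>))"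
    by (rule block_sum_telescope[of "Suc p" "\<lambda>j. \<sigma> (euler n j \<omega>)" "\<lambda>l. B (real l / real (n * Suc p)) \<omega>" i]) simp
  also have "\<dots> = (\<Sum>j<i. \<sigma> (euler n j \<omega>) * dB n j \<omega>)"
    by (simp only: grid_ratio)
  also have "\<dots> = euler n i \<omega> - a" by (induction i) auto
  finally show ?thesis by simp
qed

lemma X_fine_sum_measurable:
  assumes n: "0 < n" and i: "i \<le> n"
  shows "(\<lambda>\<omega>. \<Sum>l<i * Suc p. \<sigma> (X (real l / real (n * Suc p)) \<omega>)
      * dB (n * Suc p) l \<omega>) \<in> borel_measurable M"
proof (intro borel_measurable_sum borel_measurable_times borel_measurable_diff)
  fix l assume "l \<in> {..<i * Suc p}"
  then have l: "l < i * Suc p" by simp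
  have "i * Suc p \<le> n * Suc p" using i by (rule mult_le_mono1)
  then have l': "l \<le> n * Suc p" "Suc l \<le> n * Suc p" using l by linarith+
  have pos: "0 < n * Suc p" using n by simp
  have [measurable]: "X (real l / real (n * Suc p)) \<in> borel_measurable M"
    by (rule X_measurable[OF grid_point[OF pos l'(1)]])
  show "(\<lambda>\<omega>. \<sigma> (X (real l / real (n * Suc p)) \<omega>)) \<in> borel_measurable M" by measurable
  show "B (real l / real (n * Suc p)) \<in> borel_measurable M"
    by (rule B_measurable[OF grid_point[OF pos l'(1)]])
  show "B (real (Suc l) / real (n * Suc p)) \<in> borel_measurable M"
    by (rule B_measurable[OF grid_point[OF pos l'(2)]])
qed

lemma sqmean_good_sigma:
  assumes "0 \<le> b" "u \<in> {0..1}" "u \<in> \<rat>"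
  shows "sqmean (\<lambda>\<omega>. indicator (good b u) \<omega> * \<sigma> (X u \<omega>)) \<le> ennreal ((\<bar>\<sigma> 0\<bar> + L * b)^2)"
proof (rule sqmean_bounded)
  fix \<omega>
  have "0 \<le> \<bar>\<sigma> 0\<bar> + L * b" using assms L1 by simp
  then show "\<bar>indicator (good b u) \<omega> * \<sigma> (X u \<omega>)\<bar> \<le> \<bar>\<sigma> 0\<bar> + L * b"
    using sigma_growth[OF good_bound[of \<omega> b u]] assms by (cases "\<omega> \<in> good b u") auto
qed

text \<open>
  Localised mean square continuity, the only regularity of the solution that enters the error of the
  Euler scheme.
\<close>

lemma X_increment_sqmean:
  assumes n: "0 < n" and ji: "j \<le> i" and i: "i \<le> n" and b: "0 \<le> b"
  shows "sqmean (\<lambda>\<omega>. indicator (good b (real i / real n)) \<omega> * (X (real i / real n) \<omega> - X (real j / real n) \<omega>))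
    \<le> ennreal (real (i - j) / real n * (\<bar>\<sigma> 0\<bar> + L * b)^2)"
proof -
  define K where "K = (\<bar>\<sigma> 0\<bar> + L * b)^2"
  have K: "0 \<le> K" by (simp add: K_def)
  define \<theta> where "\<theta> p l \<omega> = (if j * Suc p \<le> l then \<sigma> (X (real l / real (n * Suc p)) \<omega>) else 0)" for p l \<omega>
  have j: "j \<le> n" using ji i by simp
  have pt: "real l / real (n * Suc p) \<in> {0..1}" if "l < i * Suc p" for l p
  proof -
    have "i * Suc p \<le> n * Suc p" using i by (rule mult_le_mono1)
    then show ?thesis using that n by (intro grid_point) auto
  qed
  have jp: "j * Suc p \<le> i * Suc p" for p using ji by (rule mult_le_mono1)
  have sum_eq: "(\<Sum>l<i * Suc p. \<theta> p l \<omega> * dB (n * Suc p) l \<omega>)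
     = (\<Sum>l<i * Suc p. \<sigma> (X (real l / real (n * Suc p)) \<omega>) * dB (n * Suc p) l \<omega>)
     - (\<Sum>l<j * Suc p. \<sigma> (X (real l / real (n * Suc p)) \<omega>) * dB (n * Suc p) l \<omega>)"
    (is "?l = sum ?f _ - sum ?f _") for p \<omega>
  proof -
    have "?l = (\<Sum>l\<in>{..<i * Suc p}. if l \<in> {j * Suc p..} then ?f l else 0)"
      unfolding \<theta>_def by (intro sum.cong refl) simp
    also have "\<dots> = sum ?f ({..<i * Suc p} \<inter> {j * Suc p..})"
      by (rule sum.inter_restrict[symmetric]) simp
    also have "{..<i * Suc p} \<inter> {j * Suc p..} = {..<i * Suc p} - {..<j * Suc p}" by auto
    also have "sum ?f \<dots> = sum ?f {..<i * Suc p} - sum ?f {..<j * Suc p}"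
      by (rule sum_diff) (use jp[of p] in auto)
    finally show ?thesis .
  qed
  show ?thesis
    unfolding K_def[symmetric]
  proof (rule localized_isometry[where \<theta>=\<theta>])
    fix p l assume l: "l < i * Suc p"
    have [measurable]: "X (real l / real (n * Suc p)) \<in> borel_measurable (F (real l / real (n * Suc p)))"
      by (rule X_adapted[OF pt[OF l]])
    show "\<theta> p l \<in> borel_measurable (F (real l / real (n * Suc p)))"
      unfolding \<theta>_def by measurable
  next
    show "(\<lambda>\<omega>. X (real i / real n) \<omega> - X (real j / real n) \<omega>) \<in> borel_measurable M"
      by (intro borel_measurable_diff X_measurable grid_point n i j)
  next
    have "tendsto_prob (\<lambda>p \<omega>. (\<Sum>l<i * Suc p. \<sigma> (X (real l / real (n * Suc p)) \<omega>) * dB (n * Suc p) l \<omega>)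
     - (\<Sum>l<j * Suc p. \<sigma> (X (real l / real (n * Suc p)) \<omega>) * dB (n * Suc p) l \<omega>))
     (\<lambda>\<omega>. (X (real i / real n) \<omega> - a) - (X (real j / real n) \<omega> - a))"
      by (intro tendsto_prob_diff X_riemann_sums X_fine_sum_measurable borel_measurable_diff X_measurable
            grid_point borel_measurable_const n i j)
    then show "tendsto_prob (\<lambda>p \<omega>. \<Sum>l<i * Suc p. \<theta> p l \<omega> * dB (n * Suc p) l \<omega>)
      (\<lambda>\<omega>. X (real i / real n) \<omega> - X (real j / real n) \<omega>)"
      unfolding sum_eq by simp
  next
    fix p
    have "(\<Sum>l<i * Suc p. ennreal (1 / real (n * Suc p)) * sqmean (\<lambda>\<omega>. indicator (good b (real l / real (n * Suc p))) \<omega> * \<theta> p l \<omega>))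
       \<le> (\<Sum>l\<in>{..<i * Suc p}. if l \<in> {j * Suc p..} then ennreal (1 / real (n * Suc p) * K) else 0)"
    proof (intro sum_mono)
      fix l assume "l \<in> {..<i * Suc p}"
      then have l: "l < i * Suc p" by simp
      show "ennreal (1 / real (n * Suc p)) * sqmean (\<lambda>\<omega>. indicator (good b (real l / real (n * Suc p))) \<omega> * \<theta> p l \<omega>)
        \<le> (if l \<in> {j * Suc p..} then ennreal (1 / real (n * Suc p) * K) else 0)"
      proof (cases "j * Suc p \<le> l")
        case True
        have "sqmean (\<lambda>\<omega>. indicator (good b (real l / real (n * Suc p))) \<omega> * \<theta> p l \<omega>) \<le> ennreal K"
          unfolding \<theta>_def K_def using True sqmean_good_sigma[OF b pt[OF l]] by simp
        then have "ennreal (1 / real (n * Suc p)) * sqmean (\<lambda>\<omega>. indicator (good b (real l / real (n * Suc p))) \<omega> * \<theta> p l \<omega>)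
           \<le> ennreal (1 / real (n * Suc p)) * ennreal K" by (intro mult_left_mono) auto
        also have "\<dots> = ennreal (1 / real (n * Suc p) * K)" using K by (intro ennreal_mult[symmetric]) auto
        finally show ?thesis using True by simp
      next
        case False
        then show ?thesis by (simp add: \<theta>_def sqmean_def del: mult_Suc_right)
      qed
    qed
    also have "\<dots> = (\<Sum>l\<in>{..<i * Suc p} \<inter> {j * Suc p..}. ennreal (1 / real (n * Suc p) * K))"
      by (rule sum.inter_restrict[symmetric]) simp
    also have "\<dots> = of_nat ((i - j) * Suc p) * ennreal (1 / real (n * Suc p) * K)"
    proof -
      have "{..<i * Suc p} \<inter> {j * Suc p..} = {j * Suc p..<i * Suc p}" by auto
      then have "card ({..<i * Suc p} \<inter> {j * Suc p..}) = (i - j) * Suc p"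
        by (simp add: diff_mult_distrib del: mult_Suc_right)
      then show ?thesis by (simp only: sum_constant)
    qed
    also have "\<dots> = ennreal (real ((i - j) * Suc p) * (1 / real (n * Suc p) * K))"
      using K by (subst ennreal_of_nat_eq_real_of_nat) (intro ennreal_mult[symmetric], auto)
    also have "real ((i - j) * Suc p) * (1 / real (n * Suc p) * K) = real ((i - j) * Suc p) / real (n * Suc p) * K" by simp
    also have "\<dots> = real (i - j) / real n * K" by (simp only: grid_ratio)
    finally show "(\<Sum>l<i * Suc p. ennreal (1 / real (n * Suc p)) * sqmean (\<lambda>\<omega>. indicator (good b (real l / real (n * Suc p))) \<omega> * \<theta> p l \<omega>))
       \<le> ennreal (real (i - j) / real n * K)" .
  qed (use n i in auto)
qed

text \<open>
  The difference of the solution and the Euler scheme is the limit of sums with coefficients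
  \<sigma>(X_u) - \<sigma>(y_j), where t_j is the last coarse time before u. Splitting X_u - y_j at
  X_(t_j) leaves a term of order 1/n from the continuity of the solution and the localised error at
  time t_j, which gives a recursion for the errors at coarse times.
\<close>

lemma euler_localized_error:
  assumes n: "0 < n" and i: "i \<le> n" and b: "0 \<le> b"
  shows "sqmean (\<lambda>\<omega>. indicator (good b (real i / real n)) \<omega> * (X (real i / real n) \<omega> - euler n i \<omega>))
    \<le> ennreal (2 * L^2 * (\<bar>\<sigma> 0\<bar> + L * b)^2 * exp (2 * L^2) / real n)"
proof -
  define K where "K = (\<bar>\<sigma> 0\<bar> + L * b)^2"
  have K: "0 \<le> K" by (simp add: K_def)
  have L0: "0 \<le> L" using L1 by simp
  define A where "A i = sqmean (\<lambda>\<omega>. indicator (good b (real i / real n)) \<omega> * (X (real i / real n) \<omega> - euler n i \<omega>))" for i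
  define \<alpha> where "\<alpha> = 2 * L^2 * K / real n / real n"
  define \<beta> where "\<beta> = 2 * L^2 / real n"
  have nn: "0 \<le> \<alpha>" "0 \<le> \<beta>" using K L0 by (auto simp: \<alpha>_def \<beta>_def)
  have rec: "A i \<le> (\<Sum>j<i. ennreal \<alpha> + ennreal \<beta> * A j)" if i: "i \<le> n" for i
    unfolding A_def[of i]
  proof (rule localized_isometry[where \<theta>="\<lambda>p l \<omega>. \<sigma> (X (real l / real (n * Suc p)) \<omega>) - \<sigma> (euler n (l div Suc p) \<omega>)"])
    fix p l assume l: "l < i * Suc p"
    have ip: "i * Suc p \<le> n * Suc p" using i by (rule mult_le_mono1)
    have pt: "real l / real (n * Suc p) \<in> {0..1}" using l ip n by (intro grid_point) auto
    have ld: "l div Suc p < n" using l ip less_mult_imp_div_less by (metis less_le_trans)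
    have "real (l div Suc p) / real n = real (l div Suc p * Suc p) / real (n * Suc p)" by (simp only: grid_ratio)
    also have "\<dots> \<le> real l / real (n * Suc p)" by (intro divide_right_mono of_nat_mono div_times_less_eq_dividend) simp
    finally have [measurable]: "euler n (l div Suc p) \<in> borel_measurable (F (real l / real (n * Suc p)))"
      using ld n by (intro measurable_F_mono[OF euler_adapted]) auto
    have [measurable]: "X (real l / real (n * Suc p)) \<in> borel_measurable (F (real l / real (n * Suc p)))"
      by (rule X_adapted[OF pt])
    show "(\<lambda>\<omega>. \<sigma> (X (real l / real (n * Suc p)) \<omega>) - \<sigma> (euler n (l div Suc p) \<omega>)) \<in> borel_measurable (F (real l / real (n * Suc p)))"
      by measurable
  next
    show "(\<lambda>\<omega>. X (real i / real n) \<omega> - euler n i \<omega>) \<in> borel_measurable M"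
      by (intro borel_measurable_diff X_measurable euler_measurable grid_point n i)
  next
    have "tendsto_prob (\<lambda>p \<omega>. (\<Sum>l<i * Suc p. \<sigma> (X (real l / real (n * Suc p)) \<omega>) * dB (n * Suc p) l \<omega>)
       - (euler n i \<omega> - a)) (\<lambda>\<omega>. (X (real i / real n) \<omega> - a) - (euler n i \<omega> - a))"
    proof (rule tendsto_prob_diff)
      show "tendsto_prob (\<lambda>p \<omega>. euler n i \<omega> - a) (\<lambda>\<omega>. euler n i \<omega> - a)" by (simp add: tendsto_prob_def)
    qed (intro X_riemann_sums X_fine_sum_measurable borel_measurable_diff X_measurable
            grid_point borel_measurable_const euler_measurable n i)+
    moreover have "(\<Sum>l<i * Suc p. (\<sigma> (X (real l / real (n * Suc p)) \<omega>) - \<sigma> (euler n (l div Suc p) \<omega>))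
          * dB (n * Suc p) l \<omega>)
      = (\<Sum>l<i * Suc p. \<sigma> (X (real l / real (n * Suc p)) \<omega>) * dB (n * Suc p) l \<omega>)
        - (euler n i \<omega> - a)" for p \<omega>
      unfolding euler_eq_fine_sum[OF n, of i \<omega> p] by (simp only: left_diff_distrib sum_subtractf)
    ultimately show "tendsto_prob (\<lambda>p \<omega>. \<Sum>l<i * Suc p. (\<sigma> (X (real l / real (n * Suc p)) \<omega>) - \<sigma> (euler n (l div Suc p) \<omega>))
          * dB (n * Suc p) l \<omega>)
      (\<lambda>\<omega>. X (real i / real n) \<omega> - euler n i \<omega>)"
      by simp
  next
    fix p
    let ?m = "n * Suc p"
    let ?u = "\<lambda>l. real l / real ?m"
    have m: "0 < ?m" using n by simp
    have step: "sqmean (\<lambda>\<omega>. indicator (good b (?u l)) \<omega> * (\<sigma> (X (?u l) \<omega>) - \<sigma> (euler n (l div Suc p) \<omega>)))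
        \<le> ennreal (2 * L^2 * K / real n) + ennreal (2 * L^2) * A (l div Suc p)" if l: "l < i * Suc p" for l
    proof -
      define j where "j = l div Suc p"
      have ip: "i * Suc p \<le> ?m" using i by (rule mult_le_mono1)
      have lm: "l \<le> ?m" using l ip by simp
      have j: "j < n" unfolding j_def using l ip less_mult_imp_div_less by (metis less_le_trans)
      have jl: "j * Suc p \<le> l" unfolding j_def by (rule div_times_less_eq_dividend)
      have tj: "real j / real n = ?u (j * Suc p)" by (simp only: grid_ratio)
      have "real (j * Suc p) \<le> real l" using jl by (rule of_nat_mono)
      then have le: "real j / real n \<le> ?u l" unfolding tj by (rule divide_right_mono) simp
      have lj: "real (l - j * Suc p) / real ?m \<le> 1 / real n"
      proof -
        have "l - j * Suc p \<le> 1 * Suc p" using mod_less_divisor[of "Suc p" l] unfolding j_def minus_div_mult_eq_mod by simp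
        then have "real (l - j * Suc p) \<le> real (1 * Suc p)" by (rule of_nat_mono)
        then have "real (l - j * Suc p) / real ?m \<le> real (1 * Suc p) / real ?m" by (rule divide_right_mono) simp
        also have "\<dots> = 1 / real n" by (simp only: grid_ratio of_nat_1)
        finally show ?thesis .
      qed
      have [measurable]: "X (?u l) \<in> borel_measurable M" "X (real j / real n) \<in> borel_measurable M" "euler n j \<in> borel_measurable M"
        using X_measurable[OF grid_point[OF m lm]] X_measurable[OF grid_point[of n j]] euler_measurable[of n j] n j by auto
      have [measurable]: "good b (?u l) \<in> sets M" "good b (real j / real n) \<in> sets M"
        using good_M grid_point[OF m lm] grid_point[of n j] n j by auto
      let ?D1 = "\<lambda>\<omega>. indicator (good b (?u l)) \<omega> * (X (?u l) \<omega> - X (real j / real n) \<omega>)"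
      let ?D2 = "\<lambda>\<omega>. indicator (good b (real j / real n)) \<omega> * (X (real j / real n) \<omega> - euler n j \<omega>)"
      have "sqmean (\<lambda>\<omega>. indicator (good b (?u l)) \<omega> * (\<sigma> (X (?u l) \<omega>) - \<sigma> (euler n j \<omega>)))
          \<le> sqmean (\<lambda>\<omega>. L * (indicator (good b (?u l)) \<omega> * (?D1 \<omega> + ?D2 \<omega>)))"
      proof (rule sqmean_mono)
        fix \<omega>
        show "\<bar>indicator (good b (?u l)) \<omega> * (\<sigma> (X (?u l) \<omega>) - \<sigma> (euler n j \<omega>))\<bar> \<le> \<bar>L * (indicator (good b (?u l)) \<omega> * (?D1 \<omega> + ?D2 \<omega>))\<bar>"
        proof (cases "\<omega> \<in> good b (?u l)")
          case True
          then have "\<omega> \<in> good b (real j / real n)" using good_mono[OF le] by blast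
          then show ?thesis using True sigma_lipschitz[of "X (?u l) \<omega>" "euler n j \<omega>"] L0 by (simp add: abs_mult)
        qed simp
      qed
      also have "\<dots> \<le> sqmean (\<lambda>\<omega>. L * (?D1 \<omega> + ?D2 \<omega>))"
        by (rule sqmean_mono) (auto simp: indicator_def)
      also have "\<dots> = ennreal (L^2) * sqmean (\<lambda>\<omega>. ?D1 \<omega> + ?D2 \<omega>)" by (rule sqmean_cmult) measurable
      also have "\<dots> \<le> ennreal (L^2) * (2 * sqmean ?D1 + 2 * sqmean ?D2)"
      proof (rule mult_left_mono[OF sqmean_add])
        show "?D1 \<in> borel_measurable M" "?D2 \<in> borel_measurable M" by measurable
      qed simp
      also have "\<dots> \<le> ennreal (L^2) * (2 * ennreal (1 / real n * K) + 2 * A j)"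
      proof -
        have "sqmean ?D1 \<le> ennreal (real (l - j * Suc p) / real ?m * K)"
          unfolding tj K_def by (rule X_increment_sqmean[OF m jl lm b])
        also have "\<dots> \<le> ennreal (1 / real n * K)" by (intro ennreal_leI mult_right_mono lj K)
        finally show ?thesis by (intro mult_left_mono add_mono) (auto simp: A_def)
      qed
      also have "\<dots> = ennreal (L^2) * (2 * ennreal (1 / real n * K)) + ennreal (L^2) * (2 * A j)"
        by (rule distrib_left)
      also have "ennreal (L^2) * (2 * ennreal (1 / real n * K)) = ennreal (2 * L^2 * K / real n)"
      proof -
        have "ennreal (L^2) * (2 * ennreal (1 / real n * K)) = ennreal (L^2) * ennreal (2 * (1 / real n * K))"
          using ennreal_mult'[of 2 "1 / real n * K"] by simp
        also have "\<dots> = ennreal (L^2 * (2 * (1 / real n * K)))"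
          by (rule ennreal_mult'[symmetric]) simp
        also have "L^2 * (2 * (1 / real n * K)) = 2 * L^2 * K / real n" by simp
        finally show ?thesis .
      qed
      also have "ennreal (L^2) * (2 * A j) = ennreal (2 * L^2) * A j"
        by (simp add: ennreal_mult mult.commute mult.left_commute)
      finally show ?thesis by (simp only: j_def)
    qed
    \<comment> \<open>Each of the p+1 fine steps of a coarse step contributes the same share.\<close>
    have fac: "ennreal (1 / real ?m) * (ennreal (2 * L^2 * K / real n) + ennreal (2 * L^2) * A j)
        = ennreal (1 / real (Suc p)) * (ennreal \<alpha> + ennreal \<beta> * A j)" for j
    proof -
      have "ennreal (1 / real ?m) * ennreal (2 * L^2 * K / real n) = ennreal (1 / real (Suc p)) * ennreal \<alpha>"
        using K by (simp add: \<alpha>_def ennreal_mult[symmetric] mult.commute mult.left_commute del: of_nat_Suc mult_Suc_right)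
      moreover have "ennreal (1 / real ?m) * ennreal (2 * L^2) = ennreal (1 / real (Suc p)) * ennreal \<beta>"
        by (simp add: \<beta>_def ennreal_mult[symmetric] mult.commute mult.left_commute del: of_nat_Suc mult_Suc_right)
      ultimately show ?thesis by (simp add: distrib_left mult.assoc[symmetric])
    qed
    have "(\<Sum>l<i * Suc p. ennreal (1 / real ?m) * sqmean (\<lambda>\<omega>. indicator (good b (?u l)) \<omega> * (\<sigma> (X (?u l) \<omega>) - \<sigma> (euler n (l div Suc p) \<omega>))))
       \<le> (\<Sum>l<i * Suc p. ennreal (1 / real (Suc p)) * (ennreal \<alpha> + ennreal \<beta> * A (l div Suc p)))"
      unfolding fac[symmetric] by (intro sum_mono mult_left_mono step) auto
    also have "\<dots> = (\<Sum>j<i. \<Sum>l=j * Suc p..<j * Suc p + Suc p. ennreal (1 / real (Suc p)) * (ennreal \<alpha> + ennreal \<beta> * A (l div Suc p)))"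
      by (rule sum.nat_group[symmetric])
    also have "\<dots> = (\<Sum>j<i. ennreal \<alpha> + ennreal \<beta> * A j)"
    proof (intro sum.cong refl)
      fix j
      have "(\<Sum>l=j * Suc p..<j * Suc p + Suc p. ennreal (1 / real (Suc p)) * (ennreal \<alpha> + ennreal \<beta> * A (l div Suc p)))
        = (\<Sum>l=j * Suc p..<j * Suc p + Suc p. ennreal (1 / real (Suc p)) * (ennreal \<alpha> + ennreal \<beta> * A j))"
      proof (intro sum.cong refl)
        fix l assume "l \<in> {j * Suc p..<j * Suc p + Suc p}"
        then have "l div Suc p = j" by (intro div_nat_eqI) (auto simp: mult.commute)
        then show "ennreal (1 / real (Suc p)) * (ennreal \<alpha> + ennreal \<beta> * A (l div Suc p)) = ennreal (1 / real (Suc p)) * (ennreal \<alpha> + ennreal \<beta> * A j)" by simp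
      qed
      also have "\<dots> = (of_nat (Suc p) * ennreal (1 / real (Suc p))) * (ennreal \<alpha> + ennreal \<beta> * A j)"
        by (simp only: sum_constant card_atLeastLessThan add_diff_cancel_left' mult.assoc)
      also have "of_nat (Suc p) * ennreal (1 / real (Suc p)) = 1"
        by (simp only: ennreal_of_nat_eq_real_of_nat ennreal_mult[symmetric] of_nat_0_le_iff zero_le_divide_1_iff) simp
      finally show "(\<Sum>l=j * Suc p..<j * Suc p + Suc p. ennreal (1 / real (Suc p)) * (ennreal \<alpha> + ennreal \<beta> * A (l div Suc p))) = ennreal \<alpha> + ennreal \<beta> * A j"
        by simp
    qed
    finally show "(\<Sum>l<i * Suc p. ennreal (1 / real ?m) * sqmean (\<lambda>\<omega>. indicator (good b (?u l)) \<omega> * (\<sigma> (X (?u l) \<omega>) - \<sigma> (euler n (l div Suc p) \<omega>))))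
       \<le> (\<Sum>j<i. ennreal \<alpha> + ennreal \<beta> * A j)" .
  qed (use n i in auto)
  have "A i \<le> ennreal (real i * \<alpha> * (1 + \<beta>) ^ i)"
    using gronwall_sum_ennreal[OF nn rec i] .
  also have "\<dots> \<le> ennreal (real n * \<alpha> * exp (2 * L^2))"
  proof (intro ennreal_leI mult_mono)
    have "(1 + \<beta>) ^ i \<le> (1 + \<beta>) ^ n" using i nn by (intro power_increasing) auto
    also have "\<dots> \<le> exp \<beta> ^ n" using nn by (intro power_mono exp_ge_add_one_self) auto
    also have "\<dots> = exp (2 * L^2)" using n by (simp add: exp_of_nat_mult[symmetric] \<beta>_def)
    finally show "(1 + \<beta>) ^ i \<le> exp (2 * L^2)" .
  qed (use nn i in auto)
  also have "real n * \<alpha> * exp (2 * L^2) = 2 * L^2 * K * exp (2 * L^2) / real n"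
    using n by (simp add: \<alpha>_def)
  finally show ?thesis by (simp only: A_def K_def)
qed

theorem euler_tendsto_prob:
  assumes N: "0 < N" and k: "k \<le> N"
  shows "tendsto_prob (\<lambda>m. euler (N * Suc m) (k * Suc m)) (X (real k / real N))"
  unfolding tendsto_prob_def
proof (intro allI impI)
  fix \<epsilon> :: real assume e: "0 < \<epsilon>"
  let ?t = "real k / real N"
  have t: "?t \<in> {0..1}" using grid_point[OF N k] .
  have [measurable]: "X ?t \<in> borel_measurable M" using X_measurable[OF t] .
  have km: "k * Suc m \<le> N * Suc m" "0 < N * Suc m" for m using k N by (auto intro: mult_le_mono1 simp del: mult_Suc_right)
  have em [measurable]: "euler (N * Suc m) (k * Suc m) \<in> borel_measurable M" for m
    by (rule euler_measurable[OF km(2,1)])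
  let ?P = "\<lambda>m. prob {\<omega>\<in>space M. \<epsilon> < \<bar>euler (N * Suc m) (k * Suc m) \<omega> - X ?t \<omega>\<bar>}"
  show "?P \<longlonglongrightarrow> 0"
  proof (rule order_tendstoI)
    fix c :: real assume c: "0 < c"
    have "eventually (\<lambda>b. 1 - c/2 < prob (good (real b) 1)) sequentially"
      using prob_good by (rule order_tendstoD(1)) (use c in simp)
    then obtain b :: nat where b: "1 - c/2 < prob (good (real b) 1)" by (auto simp: eventually_sequentially)
    have gM [measurable]: "good (real b) ?t \<in> sets M" using good_M t by auto
    define C where "C = 2 * L^2 * (\<bar>\<sigma> 0\<bar> + L * real b)^2 * exp (2 * L^2)"
    have C: "0 \<le> C" using L1 by (simp add: C_def)
    have bound: "?P m \<le> c/2 + C / \<epsilon>^2 * inverse (real (Suc m))" for m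
    proof -
      let ?f = "\<lambda>\<omega>. indicator (good (real b) ?t) \<omega> * (X ?t \<omega> - euler (N * Suc m) (k * Suc m) \<omega>)"
      have "sqmean ?f \<le> ennreal (C / real (N * Suc m))"
        using euler_localized_error[OF km(2)[of m] km(1)[of m], of "real b"] unfolding C_def grid_ratio by simp
      also have "\<dots> \<le> ennreal (C * inverse (real (Suc m)))"
      proof (rule ennreal_leI)
        have "C / real (N * Suc m) \<le> C / real (1 * Suc m)"
          using N C by (intro divide_left_mono) (auto simp del: mult_Suc_right of_nat_Suc)
        then show "C / real (N * Suc m) \<le> C * inverse (real (Suc m))" by (simp add: divide_inverse del: of_nat_Suc)
      qed
      finally have sq: "sqmean ?f \<le> ennreal (C * inverse (real (Suc m)))" .
      have fm [measurable]: "?f \<in> borel_measurable M" by measurable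
      have "prob {\<omega>\<in>space M. \<epsilon> < \<bar>?f \<omega>\<bar>} \<le> C * inverse (real (Suc m)) / \<epsilon>^2"
        by (rule chebyshev_sqmean[OF fm sq _ e]) (use C in simp)
      moreover have "?P m \<le> prob ((space M - good (real b) ?t) \<union> {\<omega>\<in>space M. \<epsilon> < \<bar>?f \<omega>\<bar>})"
      proof (rule finite_measure_mono)
        show "{\<omega>\<in>space M. \<epsilon> < \<bar>euler (N * Suc m) (k * Suc m) \<omega> - X ?t \<omega>\<bar>}
           \<subseteq> (space M - good (real b) ?t) \<union> {\<omega>\<in>space M. \<epsilon> < \<bar>?f \<omega>\<bar>}"
          by (auto simp: abs_minus_commute simp del: mult_Suc_right)
      qed measurable
      moreover have "\<dots> \<le> prob (space M - good (real b) ?t) + prob {\<omega>\<in>space M. \<epsilon> < \<bar>?f \<omega>\<bar>}"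
      proof (rule measure_Un_le)
        show "space M - good (real b) ?t \<in> sets M" by measurable
        show "{\<omega>\<in>space M. \<epsilon> < \<bar>?f \<omega>\<bar>} \<in> sets M" by measurable
      qed
      moreover have "prob (space M - good (real b) ?t) \<le> c/2"
      proof -
        have "prob (good (real b) 1) \<le> prob (good (real b) ?t)"
          using t by (intro finite_measure_mono good_mono gM) auto
        then show ?thesis using b by (simp add: prob_compl)
      qed
      ultimately show ?thesis by (simp add: mult.commute mult.left_commute)
    qed
    have "(\<lambda>m. c/2 + C / \<epsilon>^2 * inverse (real (Suc m))) \<longlonglongrightarrow> c/2 + C / \<epsilon>^2 * 0"
      by (intro tendsto_intros LIMSEQ_inverse_real_of_nat)
    then have "eventually (\<lambda>m. c/2 + C / \<epsilon>^2 * inverse (real (Suc m)) < c) sequentially"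
      by (rule order_tendstoD(2)) (use c in simp)
    then show "eventually (\<lambda>m. ?P m < c) sequentially"
    proof eventually_elim
      case (elim m)
      then show ?case using bound[of m] by linarith
    qed
  next
    fix c :: real assume "c < 0"
    then show "eventually (\<lambda>m. c < ?P m) sequentially"
      by (intro always_eventually allI) (meson less_le_trans measure_nonneg)
  qed
qed

end

section \<open>Moments after one Brownian increment\<close>

context brownian
begin

lemma sqmean_wick_increment:
  assumes s: "0 \<le> s" "s < t" "t \<le> 1"
    and [measurable]: "e \<in> borel_measurable (F s)" "g \<in> borel_measurable (F s)" "D \<in> borel_measurable (F s)"
      "c \<in> borel_measurable (F s)"
    and c: "\<And>\<omega>. \<bar>c \<omega>\<bar> \<le> L" and L: "0 \<le> L"
  shows "sqmean (\<lambda>\<omega>. e \<omega> + g \<omega> * (B t \<omega> - B s \<omega>) - wick_step (D \<omega>) (c \<omega>) (B t \<omega> - B s \<omega>) (t - s))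
    \<le> sqmean e + ennreal (t - s) * sqmean (\<lambda>\<omega>. g \<omega> - D \<omega>) + ennreal (L^2 * (t - s)^2 * exp (L^2)) * sqmean D"
proof -
  note toM = measurable_F_M[OF _ order_trans[OF less_imp_le[OF s(2)] s(3)]]
  have [measurable]: "e \<in> borel_measurable M" "g \<in> borel_measurable M" "D \<in> borel_measurable M"
    by (rule toM, measurable)+
  have "sqmean (\<lambda>\<omega>. e \<omega> + g \<omega> * (B t \<omega> - B s \<omega>) - wick_step (D \<omega>) (c \<omega>) (B t \<omega> - B s \<omega>) (t - s))
     = (\<integral>\<^sup>+\<omega>. (\<integral>\<^sup>+x. ennreal ((e \<omega> + g \<omega> * x - wick_step (D \<omega>) (c \<omega>) x (t - s))^2) \<partial>gauss (t - s)) \<partial>M)"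
    unfolding sqmean_def
    using nn_integral_increment[OF s, of "\<lambda>z. ennreal ((e (fst z) + g (fst z) * snd z - wick_step (D (fst z)) (c (fst z)) (snd z) (t - s))^2)"]
    by simp
  also have "\<dots> \<le> (\<integral>\<^sup>+\<omega>. ennreal ((e \<omega>)^2) + ennreal (t - s) * ennreal ((g \<omega> - D \<omega>)^2) + ennreal (L^2 * (t - s)^2 * exp (L^2)) * ennreal ((D \<omega>)^2) \<partial>M)"
  proof (rule nn_integral_mono)
    fix \<omega>
    have cL: "(c \<omega>)^2 \<le> L^2" using c[of \<omega>] L by (simp add: abs_le_square_iff[symmetric])
    have "(c \<omega>)^2 * (t - s) \<le> L^2 * 1" using cL s by (intro mult_mono) auto
    then have "(c \<omega>)^2 * (t - s)^2 * exp ((c \<omega>)^2 * (t - s)) * (D \<omega>)^2 \<le> L^2 * (t - s)^2 * exp (L^2) * (D \<omega>)^2"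
      using cL by (intro mult_mono) auto
    then have "ennreal ((e \<omega>)^2 + (t - s) * (g \<omega> - D \<omega>)^2 + (c \<omega>)^2 * (t - s)^2 * exp ((c \<omega>)^2 * (t - s)) * (D \<omega>)^2)
      \<le> ennreal ((e \<omega>)^2 + (t - s) * (g \<omega> - D \<omega>)^2 + L^2 * (t - s)^2 * exp (L^2) * (D \<omega>)^2)"
      by (intro ennreal_leI) simp
    also have "\<dots> = ennreal ((e \<omega>)^2) + ennreal (t - s) * ennreal ((g \<omega> - D \<omega>)^2) + ennreal (L^2 * (t - s)^2 * exp (L^2)) * ennreal ((D \<omega>)^2)"
      using s by (simp add: ennreal_plus ennreal_mult)
    finally show "(\<integral>\<^sup>+x. ennreal ((e \<omega> + g \<omega> * x - wick_step (D \<omega>) (c \<omega>) x (t - s))^2) \<partial>gauss (t - s))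
      \<le> ennreal ((e \<omega>)^2) + ennreal (t - s) * ennreal ((g \<omega> - D \<omega>)^2) + ennreal (L^2 * (t - s)^2 * exp (L^2)) * ennreal ((D \<omega>)^2)"
      using gauss_wick_step_square[of "t - s" "e \<omega>" "g \<omega>" "D \<omega>" "c \<omega>"] s by (auto elim: order_trans)
  qed
  also have "\<dots> = sqmean e + ennreal (t - s) * sqmean (\<lambda>\<omega>. g \<omega> - D \<omega>) + ennreal (L^2 * (t - s)^2 * exp (L^2)) * sqmean D"
    unfolding sqmean_def by (simp add: nn_integral_add nn_integral_cmult)
  finally show ?thesis .
qed

lemma sqmean_weighted_fourth:
  assumes s: "0 \<le> s" "s < t" "t \<le> 1"
    and [measurable]: "w \<in> borel_measurable (F s)" "U \<in> borel_measurable (F s)" "V \<in> borel_measurable (F s)"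
  shows "sqmean (\<lambda>\<omega>. w \<omega> * (U \<omega> + V \<omega> * (B t \<omega> - B s \<omega>))^2)
    = (\<integral>\<^sup>+\<omega>. ennreal ((w \<omega>)^2 * ((U \<omega>)^4 + 6 * (t - s) * (U \<omega>)^2 * (V \<omega>)^2 + 3 * (t - s)^2 * (V \<omega>)^4)) \<partial>M)"
proof -
  have "sqmean (\<lambda>\<omega>. w \<omega> * (U \<omega> + V \<omega> * (B t \<omega> - B s \<omega>))^2)
    = (\<integral>\<^sup>+\<omega>. (\<integral>\<^sup>+x. ennreal ((w \<omega> * (U \<omega> + V \<omega> * x)^2)^2) \<partial>gauss (t - s)) \<partial>M)"
    unfolding sqmean_def
    using nn_integral_increment[OF s, of "\<lambda>z. ennreal ((w (fst z) * (U (fst z) + V (fst z) * snd z)^2)^2)"]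
    by simp
  also have "\<dots> = (\<integral>\<^sup>+\<omega>. ennreal ((w \<omega>)^2 * ((U \<omega>)^4 + 6 * (t - s) * (U \<omega>)^2 * (V \<omega>)^2 + 3 * (t - s)^2 * (V \<omega>)^4)) \<partial>M)"
  proof (rule nn_integral_cong)
    fix \<omega>
    have "(\<integral>\<^sup>+x. ennreal ((w \<omega> * (U \<omega> + V \<omega> * x)^2)^2) \<partial>gauss (t - s))
       = (\<integral>\<^sup>+x. ennreal ((w \<omega>)^2) * ennreal ((U \<omega> + V \<omega> * x)^4) \<partial>gauss (t - s))"
      by (intro nn_integral_cong) (simp add: ennreal_mult'[symmetric] power_mult_distrib)
    also have "\<dots> = ennreal ((w \<omega>)^2) * (\<integral>\<^sup>+x. ennreal ((U \<omega> + V \<omega> * x)^4) \<partial>gauss (t - s))"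
      by (rule nn_integral_cmult) measurable
    also have "\<dots> = ennreal ((w \<omega>)^2 * ((U \<omega>)^4 + 6 * (t - s) * (U \<omega>)^2 * (V \<omega>)^2 + 3 * (t - s)^2 * (V \<omega>)^4))"
      using s by (simp add: gauss_affine_fourth ennreal_mult')
    finally show "(\<integral>\<^sup>+x. ennreal ((w \<omega> * (U \<omega> + V \<omega> * x)^2)^2) \<partial>gauss (t - s))
       = ennreal ((w \<omega>)^2 * ((U \<omega>)^4 + 6 * (t - s) * (U \<omega>)^2 * (V \<omega>)^2 + 3 * (t - s)^2 * (V \<omega>)^4))" .
  qed
  finally show ?thesis .
qed

lemma sqmean_exp_increment:
  assumes s: "0 \<le> s" "s \<le> t" "t \<le> 1"
    and [measurable]: "d \<in> borel_measurable (F s)" "c \<in> borel_measurable (F s)"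
    and c: "\<And>\<omega>. \<bar>c \<omega>\<bar> \<le> L" and L: "0 \<le> L"
  shows "sqmean (\<lambda>\<omega>. d \<omega> * exp (c \<omega> * (B t \<omega> - B s \<omega>) - (c \<omega>)^2 * (t - s) / 2)) \<le> ennreal (exp (L^2)) * sqmean d"
    and "sqmean (\<lambda>\<omega>. d \<omega> * (1 + c \<omega> * (B t \<omega> - B s \<omega>) - exp (c \<omega> * (B t \<omega> - B s \<omega>) - (c \<omega>)^2 * (t - s) / 2)))
      \<le> ennreal (L^4 * (t - s)^2 * exp (L^2)) * sqmean d"
proof -
  have s1: "s \<le> 1" using s by simp
  have dM [measurable]: "d \<in> borel_measurable M"
    by (rule measurable_F_M[OF _ s1]) measurable
  have cL: "(c \<omega>)^2 \<le> L^2" for \<omega> using c[of \<omega>] L by (simp add: abs_le_square_iff[symmetric])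
  have cv: "(c \<omega>)^2 * (t - s) \<le> L^2" for \<omega>
  proof -
    have "(c \<omega>)^2 * (t - s) \<le> L^2 * 1" using cL[of \<omega>] s by (intro mult_mono) auto
    then show ?thesis by simp
  qed
  have main: "sqmean (\<lambda>\<omega>. d \<omega> * f (c \<omega>) (B t \<omega> - B s \<omega>)) \<le> ennreal K * sqmean d"
    if K: "0 \<le> K" and st: "s < t" and [measurable]: "(\<lambda>z. f (fst z) (snd z)) \<in> borel_measurable (borel \<Otimes>\<^sub>M borel)"
      and f: "\<And>\<omega>. (\<integral>\<^sup>+x. ennreal ((f (c \<omega>) x)^2) \<partial>gauss (t - s)) \<le> ennreal K" for f :: "real \<Rightarrow> real \<Rightarrow> real" and K
  proof -
    have fm: "(\<lambda>z. f (c (fst z)) (snd z)) \<in> borel_measurable (F s \<Otimes>\<^sub>M borel)"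
      using measurable_compose[of "\<lambda>z. (c (fst z), snd z)" "F s \<Otimes>\<^sub>M borel" "borel \<Otimes>\<^sub>M borel" "\<lambda>z. f (fst z) (snd z)" borel]
      by simp
    have fx [measurable]: "(\<lambda>x. f r x) \<in> borel_measurable borel" for r
      using measurable_compose[of "\<lambda>x. (r, x)" borel "borel \<Otimes>\<^sub>M borel" "\<lambda>z. f (fst z) (snd z)" borel] by simp
    have "sqmean (\<lambda>\<omega>. d \<omega> * f (c \<omega>) (B t \<omega> - B s \<omega>))
      = (\<integral>\<^sup>+\<omega>. (\<integral>\<^sup>+x. ennreal ((d \<omega> * f (c \<omega>) x)^2) \<partial>gauss (t - s)) \<partial>M)"
      unfolding sqmean_def
      using nn_integral_increment[OF s(1) st s(3), of "\<lambda>z. ennreal ((d (fst z) * f (c (fst z)) (snd z))^2)"] fm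
      by simp
    also have "\<dots> \<le> (\<integral>\<^sup>+\<omega>. ennreal K * ennreal ((d \<omega>)^2) \<partial>M)"
    proof (rule nn_integral_mono)
      fix \<omega>
      have "(\<integral>\<^sup>+x. ennreal ((d \<omega> * f (c \<omega>) x)^2) \<partial>gauss (t - s)) = (\<integral>\<^sup>+x. ennreal ((d \<omega>)^2) * ennreal ((f (c \<omega>) x)^2) \<partial>gauss (t - s))"
        by (intro nn_integral_cong) (simp add: ennreal_mult'[symmetric] power_mult_distrib)
      also have "\<dots> = ennreal ((d \<omega>)^2) * (\<integral>\<^sup>+x. ennreal ((f (c \<omega>) x)^2) \<partial>gauss (t - s))"
        by (rule nn_integral_cmult) measurable
      also have "\<dots> \<le> ennreal ((d \<omega>)^2) * ennreal K" using f by (rule mult_left_mono) simp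
      finally show "(\<integral>\<^sup>+x. ennreal ((d \<omega> * f (c \<omega>) x)^2) \<partial>gauss (t - s)) \<le> ennreal K * ennreal ((d \<omega>)^2)"
        by (simp add: mult.commute)
    qed
    also have "\<dots> = ennreal K * sqmean d" unfolding sqmean_def by (rule nn_integral_cmult) measurable
    finally show ?thesis .
  qed
  show "sqmean (\<lambda>\<omega>. d \<omega> * exp (c \<omega> * (B t \<omega> - B s \<omega>) - (c \<omega>)^2 * (t - s) / 2)) \<le> ennreal (exp (L^2)) * sqmean d"
  proof (cases "s = t")
    case True
    have "1 * sqmean d \<le> ennreal (exp (L^2)) * sqmean d"
      by (intro mult_right_mono) (auto simp: ennreal_1[symmetric] simp del: ennreal_1)
    then show ?thesis using True by simp
  next
    case False
    then have st: "s < t" using s by simp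
    show ?thesis
    proof (rule main[of "exp (L^2)" "\<lambda>c x. exp (c * x - c^2 * (t - s) / 2)"])
      fix \<omega>
      have "(\<integral>\<^sup>+x. ennreal ((exp (c \<omega> * x - (c \<omega>)^2 * (t - s) / 2))^2) \<partial>gauss (t - s)) = ennreal (exp ((c \<omega>)^2 * (t - s)))"
        using gauss_affine_exp_square[of "t - s" 0 0 1 "c \<omega>"] st by simp
      also have "\<dots> \<le> ennreal (exp (L^2))" using cv[of \<omega>] by (intro ennreal_leI) simp
      finally show "(\<integral>\<^sup>+x. ennreal ((exp (c \<omega> * x - (c \<omega>)^2 * (t - s) / 2))^2) \<partial>gauss (t - s)) \<le> ennreal (exp (L^2))" .
    qed (use st in simp_all)
  qed
  show "sqmean (\<lambda>\<omega>. d \<omega> * (1 + c \<omega> * (B t \<omega> - B s \<omega>) - exp (c \<omega> * (B t \<omega> - B s \<omega>) - (c \<omega>)^2 * (t - s) / 2)))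
      \<le> ennreal (L^4 * (t - s)^2 * exp (L^2)) * sqmean d"
  proof (cases "s = t")
    case True
    then show ?thesis by (simp add: sqmean_def)
  next
    case False
    then have st: "s < t" using s by simp
    show ?thesis
    proof (rule main[of "L^4 * (t - s)^2 * exp (L^2)" "\<lambda>c x. 1 + c * x - exp (c * x - c^2 * (t - s) / 2)"])
      fix \<omega>
      have "(\<integral>\<^sup>+x. ennreal ((1 + c \<omega> * x - exp (c \<omega> * x - (c \<omega>)^2 * (t - s) / 2))^2) \<partial>gauss (t - s))
          \<le> ennreal ((c \<omega>)^4 * (t - s)^2 * exp ((c \<omega>)^2 * (t - s)))"
        using gauss_exp_remainder_square[of "t - s" "c \<omega>"] st by simp
      also have "\<dots> \<le> ennreal (L^4 * (t - s)^2 * exp (L^2))"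
      proof (intro ennreal_leI mult_mono)
        have "((c \<omega>)^2)^2 \<le> (L^2)^2" by (rule power_mono[OF cL]) simp
        then show "(c \<omega>)^4 \<le> L^4" by simp
      qed (use cv[of \<omega>] in auto)
      finally show "(\<integral>\<^sup>+x. ennreal ((1 + c \<omega> * x - exp (c \<omega> * x - (c \<omega>)^2 * (t - s) / 2))^2) \<partial>gauss (t - s))
          \<le> ennreal (L^4 * (t - s)^2 * exp (L^2))" .
    qed (use st in simp_all)
  qed
qed

end

section \<open>One step of the scheme against a block of Euler steps\<close>

text \<open>
  A block of P consecutive Euler steps of length \<eta> = 1/n, starting at the step q; it covers one
  step of length h = P/n of the scheme. All mean squares below are bounded in terms of a bound Q of
  the mean square of \<sigma> at the beginning of the block.
\<close>

locale euler_block = wick_sde M B \<sigma> a X L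
  for M :: "'w measure" and B :: "real \<Rightarrow> 'w \<Rightarrow> real" and \<sigma> :: "real \<Rightarrow> real" and a :: real
    and X :: "real \<Rightarrow> 'w \<Rightarrow> real" and L :: real +
  fixes n q P :: nat and Q :: real
  assumes n: "0 < n" and P: "0 < P" and qP: "q + P \<le> n"
    and Q: "0 \<le> Q" and euler_start: "sqmean (\<lambda>\<omega>. \<sigma> (euler n q \<omega>)) \<le> ennreal Q"
begin

abbreviation \<eta> :: real where "\<eta> \<equiv> 1 / real n"

abbreviation h :: real where "h \<equiv> real P / real n"

abbreviation v :: "nat \<Rightarrow> real" where "v j \<equiv> real (q + j) / real n"

abbreviation b :: "nat \<Rightarrow> 'w \<Rightarrow> real" where "b j \<omega> \<equiv> B (v j) \<omega> - B (v 0) \<omega>"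

abbreviation \<Delta> :: "nat \<Rightarrow> 'w \<Rightarrow> real" where "\<Delta> j \<omega> \<equiv> B (v (Suc j)) \<omega> - B (v j) \<omega>"

abbreviation y :: "nat \<Rightarrow> 'w \<Rightarrow> real" where "y j \<equiv> euler n (q + j)"

abbreviation U :: "nat \<Rightarrow> 'w \<Rightarrow> real" where "U j \<omega> \<equiv> y j \<omega> - y 0 \<omega>"

lemma eta: "0 < \<eta>" "\<eta> \<le> 1" "\<eta> \<le> h" "h \<le> 1" "0 \<le> h"
  using n P qP by (auto simp: divide_right_mono)

lemma L0: "0 \<le> L" using L1 by simp

lemma v_range: "j \<le> P \<Longrightarrow> 0 \<le> v j \<and> v j \<le> 1"
  using qP n by (simp add: divide_le_eq)

lemma v_step: "v (Suc j) - v j = \<eta>" "v j < v (Suc j)" "v 0 \<le> v j" "v j - v 0 = real j / real n"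
  using n by (simp_all add: diff_divide_distrib[symmetric] divide_strict_right_mono divide_right_mono)

lemma v_le: "i \<le> j \<Longrightarrow> v i \<le> v j"
  using n by (simp add: divide_right_mono)

lemma y_Suc: "y (Suc j) \<omega> = y j \<omega> + \<sigma> (y j \<omega>) * \<Delta> j \<omega>"
  by simp

lemma y_adapted: "i \<le> j \<Longrightarrow> j \<le> P \<Longrightarrow> y i \<in> borel_measurable (F (v j))"
  using qP n by (intro measurable_F_mono[OF euler_adapted v_le]) auto

lemma y_measurable: "j \<le> P \<Longrightarrow> y j \<in> borel_measurable M"
  using qP n by (intro euler_measurable) auto

lemma b_adapted: "j \<le> P \<Longrightarrow> (\<lambda>\<omega>. b j \<omega>) \<in> borel_measurable (F (v j))"
  using v_step(3)[of j] by (intro borel_measurable_diff B_adapted) auto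

lemma sqmean_sigma_y:
  assumes j: "j \<le> P"
  shows "sqmean (\<lambda>\<omega>. \<sigma> (y j \<omega>)) \<le> ennreal (2 * Q) + ennreal (2 * L^2) * sqmean (U j)"
proof -
  have [measurable]: "y j \<in> borel_measurable M" "y 0 \<in> borel_measurable M"
    using y_measurable[OF j] y_measurable[of 0] by auto
  have "sqmean (\<lambda>\<omega>. \<sigma> (y j \<omega>)) = sqmean (\<lambda>\<omega>. \<sigma> (y 0 \<omega>) + (\<sigma> (y j \<omega>) - \<sigma> (y 0 \<omega>)))" by simp
  also have "\<dots> \<le> 2 * sqmean (\<lambda>\<omega>. \<sigma> (y 0 \<omega>)) + 2 * sqmean (\<lambda>\<omega>. \<sigma> (y j \<omega>) - \<sigma> (y 0 \<omega>))"
    by (rule sqmean_add) measurable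
  also have "\<dots> \<le> 2 * ennreal Q + 2 * sqmean (\<lambda>\<omega>. L * U j \<omega>)"
  proof (intro add_mono mult_left_mono sqmean_mono)
    show "sqmean (\<lambda>\<omega>. \<sigma> (y 0 \<omega>)) \<le> ennreal Q" using euler_start by simp
    show "\<bar>\<sigma> (y j \<omega>) - \<sigma> (y 0 \<omega>)\<bar> \<le> \<bar>L * U j \<omega>\<bar>" for \<omega>
      using sigma_lipschitz[of "y j \<omega>" "y 0 \<omega>"] L0 by (simp add: abs_mult)
  qed auto
  also have "sqmean (\<lambda>\<omega>. L * U j \<omega>) = ennreal (L^2) * sqmean (U j)"
    by (rule sqmean_cmult) measurable
  also have "2 * ennreal Q + 2 * (ennreal (L^2) * sqmean (U j)) = ennreal (2 * Q) + ennreal (2 * L^2) * sqmean (U j)"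
    by (simp add: ennreal_mult' mult.assoc)
  finally show ?thesis .
qed

lemma euler_increment_square:
  assumes "j \<le> P"
  shows "sqmean (U j) \<le> ennreal (h * (2 * Q) * exp (2 * L^2))"
proof (rule gronwall_step_ennreal[OF _ _ n _ _ _ assms])
  fix j assume j: "j < P"
  have [measurable]: "y j \<in> borel_measurable (F (v j))" "y 0 \<in> borel_measurable (F (v j))"
    using y_adapted[of j j] y_adapted[of 0 j] j by auto
  have "sqmean (U (Suc j)) = sqmean (\<lambda>\<omega>. U j \<omega> + \<sigma> (y j \<omega>) * \<Delta> j \<omega>)" unfolding y_Suc by (simp add: algebra_simps)
  also have "\<dots> = sqmean (U j) + ennreal (v (Suc j) - v j) * sqmean (\<lambda>\<omega>. \<sigma> (y j \<omega>))"
  proof (rule sqmean_increment)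
    show "U j \<in> borel_measurable (F (v j))" "(\<lambda>\<omega>. \<sigma> (y j \<omega>)) \<in> borel_measurable (F (v j))" by measurable
  qed (use v_range[of j] v_range[of "Suc j"] v_step(2)[of j] j in \<open>auto\<close>)
  also have "\<dots> \<le> sqmean (U j) + ennreal \<eta> * (ennreal (2 * Q) + ennreal (2 * L^2) * sqmean (U j))"
    unfolding v_step(1) using j by (intro add_left_mono mult_left_mono sqmean_sigma_y) auto
  also have "\<dots> = sqmean (U j) + (ennreal (2 * Q / real n) + ennreal (2 * L^2 / real n) * sqmean (U j))"
    using Q by (simp add: distrib_left mult.assoc[symmetric] ennreal_mult[symmetric])
  finally show "sqmean (U (Suc j)) \<le> sqmean (U j) + (ennreal (2 * Q / real n) + ennreal (2 * L^2 / real n) * sqmean (U j))" .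
qed (use Q qP in \<open>auto simp: sqmean_def\<close>)

definition "increment_const = 2 * exp (2 * L^2)"

lemma euler_increment_square': "j \<le> P \<Longrightarrow> sqmean (U j) \<le> ennreal (increment_const * h * Q)"
  using euler_increment_square[of j] by (simp add: increment_const_def ac_simps)

definition "fourth_const = (12 * increment_const + 24) * exp (36 * L^4)"

lemma const_nonneg: "0 \<le> increment_const" "0 \<le> fourth_const" by (auto simp: increment_const_def fourth_const_def)

text \<open>
  The weight w stands for the inverse of s = \<sigma>(y_0), with value zero if s = 0. It turns the
  mixed terms into quantities that have already been bounded: w^2 s^2 U^2 \<le> U^2 and w^2 s^4
  \<le> s^2.
\<close>

lemma fourth_power_pointwise:
  fixes U V w s :: real
  assumes w: "w^2 * s^2 \<le> 1" and V: "\<bar>V\<bar> \<le> \<bar>s\<bar> + L * \<bar>U\<bar>"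
  shows "w^2 * (U^4 + 6 * \<eta> * U^2 * V^2 + 3 * \<eta>^2 * V^4)
    \<le> (w * U^2)^2 + \<eta> * (12 * U^2 + 24 * h * s^2) + 36 * L^4 * \<eta> * (w * U^2)^2"
proof -
  have V2: "V^2 \<le> 2 * s^2 + 2 * L^2 * U^2"
  proof -
    have "V^2 \<le> (\<bar>s\<bar> + L * \<bar>U\<bar>)^2" using V L0 by (simp add: abs_le_square_iff[symmetric])
    also have "\<dots> \<le> 2 * \<bar>s\<bar>^2 + 2 * (L * \<bar>U\<bar>)^2"
      using square_diff_le[of "\<bar>s\<bar>" "- (L * \<bar>U\<bar>)" 0] by simp
    finally show ?thesis by (simp add: power_mult_distrib)
  qed
  have V4: "V^4 \<le> 8 * s^4 + 8 * L^4 * U^4"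
  proof -
    have "V^4 = (V^2)^2" by simp
    also have "\<dots> \<le> (2 * s^2 + 2 * L^2 * U^2)^2" using V2 by (intro power_mono) auto
    also have "\<dots> \<le> 2 * (2 * s^2)^2 + 2 * (2 * L^2 * U^2)^2"
      using square_diff_le[of "2 * s^2" "- (2 * L^2 * U^2)" 0] by simp
    also have "\<dots> = 8 * s^4 + 8 * L^4 * U^4" by (simp add: power_mult_distrib power_mult[symmetric])
    finally show ?thesis .
  qed
  have e0: "0 \<le> \<eta>" using eta by simp
  have L24: "L^2 \<le> L^4" using L1 by (intro power_increasing) auto
  have ee: "\<eta>^2 \<le> \<eta> * h" unfolding power2_eq_square using eta by (intro mult_left_mono) auto
  have ee1: "\<eta>^2 \<le> \<eta>" using e0 eta(2) mult_left_mono[of \<eta> 1 \<eta>] by (simp add: power2_eq_square)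
  have a1: "6 * \<eta> * U^2 * V^2 \<le> 6 * \<eta> * U^2 * (2 * s^2 + 2 * L^2 * U^2)"
    using V2 e0 by (intro mult_left_mono) auto
  have a2: "3 * \<eta>^2 * V^4 \<le> 3 * \<eta>^2 * (8 * s^4 + 8 * L^4 * U^4)"
    using V4 by (intro mult_left_mono) auto
  have "w^2 * (U^4 + 6 * \<eta> * U^2 * V^2 + 3 * \<eta>^2 * V^4)
    \<le> w^2 * (U^4 + 6 * \<eta> * U^2 * (2 * s^2 + 2 * L^2 * U^2) + 3 * \<eta>^2 * (8 * s^4 + 8 * L^4 * U^4))"
    using a1 a2 by (intro mult_left_mono) auto
  also have "\<dots> = w^2 * U^4 + 12 * \<eta> * U^2 * (w^2 * s^2) + 12 * \<eta> * (L^2 * (w^2 * U^4))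
      + 24 * \<eta>^2 * (s^2 * (w^2 * s^2)) + 24 * \<eta>^2 * (L^4 * (w^2 * U^4))"
    by (simp add: algebra_simps power2_eq_square power4_eq_xxxx)
  also have "\<dots> \<le> w^2 * U^4 + 12 * \<eta> * U^2 * 1 + 12 * \<eta> * (L^4 * (w^2 * U^4))
      + 24 * (\<eta> * h) * (s^2 * 1) + 24 * \<eta> * (L^4 * (w^2 * U^4))"
    using w e0 L24 ee ee1 eta by (intro add_mono mult_mono order_refl mult_nonneg_nonneg) auto
  also have "\<dots> = (w * U^2)^2 + \<eta> * (12 * U^2 + 24 * h * s^2) + 36 * L^4 * \<eta> * (w * U^2)^2"
    by (simp add: algebra_simps power_mult_distrib power_mult[symmetric])
  finally show ?thesis .
qed

text \<open>
  The square of this variable is the fourth power of the increment, divided by \<sigma>(y_0)^2.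
\<close>

abbreviation fourth :: "nat \<Rightarrow> 'w \<Rightarrow> real" where
  "fourth j \<omega> \<equiv> inverse (\<sigma> (y 0 \<omega>)) * (U j \<omega>)^2"

lemma euler_increment_fourth:
  assumes "j \<le> P"
  shows "sqmean (fourth j) \<le> ennreal (fourth_const * h^2 * Q)"
proof -
  have "sqmean (fourth j) \<le> ennreal (real P / real n * ((12 * increment_const + 24) * h * Q) * exp (36 * L^4))"
  proof (rule gronwall_step_ennreal[OF _ _ n _ _ _ assms])
    fix j assume j: "j < P"
    let ?w = "\<lambda>\<omega>. inverse (\<sigma> (y 0 \<omega>))"
    have [measurable]: "y j \<in> borel_measurable (F (v j))" "y 0 \<in> borel_measurable (F (v j))"
      using y_adapted[of j j] y_adapted[of 0 j] j by auto
    have [measurable]: "y j \<in> borel_measurable M" "y 0 \<in> borel_measurable M"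
      using y_measurable[of j] y_measurable[of 0] j by auto
    have [measurable]: "euler n q \<in> borel_measurable M" using y_measurable[of 0] by simp
    have "sqmean (fourth (Suc j)) = sqmean (\<lambda>\<omega>. ?w \<omega> * (U j \<omega> + \<sigma> (y j \<omega>) * \<Delta> j \<omega>)^2)"
      unfolding y_Suc by (simp add: algebra_simps)
    also have "\<dots> = (\<integral>\<^sup>+\<omega>. ennreal ((?w \<omega>)^2 * ((U j \<omega>)^4 + 6 * (v (Suc j) - v j) * (U j \<omega>)^2 * (\<sigma> (y j \<omega>))^2
          + 3 * (v (Suc j) - v j)^2 * (\<sigma> (y j \<omega>))^4)) \<partial>M)"
    proof (rule sqmean_weighted_fourth)
      show "?w \<in> borel_measurable (F (v j))" "U j \<in> borel_measurable (F (v j))"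
        "(\<lambda>\<omega>. \<sigma> (y j \<omega>)) \<in> borel_measurable (F (v j))" by measurable
    qed (use v_range[of j] v_range[of "Suc j"] v_step(2)[of j] j in \<open>auto\<close>)
    also have "\<dots> \<le> (\<integral>\<^sup>+\<omega>. ennreal ((fourth j \<omega>)^2) + ennreal \<eta> * (12 * ennreal ((U j \<omega>)^2) + ennreal (24 * h) * ennreal ((\<sigma> (y 0 \<omega>))^2))
         + ennreal (36 * L^4 * \<eta>) * ennreal ((fourth j \<omega>)^2) \<partial>M)"
    proof (rule nn_integral_mono)
      fix \<omega>
      have "ennreal ((?w \<omega>)^2 * ((U j \<omega>)^4 + 6 * \<eta> * (U j \<omega>)^2 * (\<sigma> (y j \<omega>))^2 + 3 * \<eta>^2 * (\<sigma> (y j \<omega>))^4))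
        \<le> ennreal ((fourth j \<omega>)^2 + \<eta> * (12 * (U j \<omega>)^2 + 24 * h * (\<sigma> (y 0 \<omega>))^2) + 36 * L^4 * \<eta> * (fourth j \<omega>)^2)"
      proof (intro ennreal_leI fourth_power_pointwise)
        show "(?w \<omega>)\<^sup>2 * (\<sigma> (y 0 \<omega>))\<^sup>2 \<le> 1"
          by (cases "\<sigma> (y 0 \<omega>) = 0") (auto simp: power_mult_distrib[symmetric])
        show "\<bar>\<sigma> (y j \<omega>)\<bar> \<le> \<bar>\<sigma> (y 0 \<omega>)\<bar> + L * \<bar>U j \<omega>\<bar>"
          using sigma_lipschitz[of "y j \<omega>" "y 0 \<omega>"] by linarith
      qed
      also have "\<dots> = ennreal ((fourth j \<omega>)^2) + ennreal \<eta> * (12 * ennreal ((U j \<omega>)^2) + ennreal (24 * h) * ennreal ((\<sigma> (y 0 \<omega>))^2))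
         + ennreal (36 * L^4 * \<eta>) * ennreal ((fourth j \<omega>)^2)"
      proof -
        have "12 * ennreal ((U j \<omega>)^2) + ennreal (24 * h) * ennreal ((\<sigma> (y 0 \<omega>))^2) = ennreal (12 * (U j \<omega>)^2 + 24 * h * (\<sigma> (y 0 \<omega>))^2)"
        proof -
          have "12 * ennreal ((U j \<omega>)^2) = ennreal (12 * (U j \<omega>)^2)" using ennreal_mult'[of 12 "(U j \<omega>)^2"] by simp
          moreover have "ennreal (24 * h) * ennreal ((\<sigma> (y 0 \<omega>))^2) = ennreal (24 * h * (\<sigma> (y 0 \<omega>))^2)"
            by (rule ennreal_mult'[symmetric]) simp
          ultimately show ?thesis by (simp only:) (rule ennreal_plus[symmetric], simp_all)
        qed
        then show ?thesis
          by (simp only:) (rule ennreal_add_mult_mult[symmetric], use L0 in auto)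
      qed
      finally show "ennreal ((?w \<omega>)^2 * ((U j \<omega>)^4 + 6 * (v (Suc j) - v j) * (U j \<omega>)^2 * (\<sigma> (y j \<omega>))^2
          + 3 * (v (Suc j) - v j)^2 * (\<sigma> (y j \<omega>))^4)) \<le> \<dots>"
        unfolding v_step(1) .
    qed
    also have "\<dots> = sqmean (fourth j) + ennreal \<eta> * (12 * sqmean (U j) + ennreal (24 * h) * sqmean (\<lambda>\<omega>. \<sigma> (y 0 \<omega>)))
         + ennreal (36 * L^4 * \<eta>) * sqmean (fourth j)"
      unfolding sqmean_def by (simp add: nn_integral_add nn_integral_cmult)
    also have "\<dots> \<le> sqmean (fourth j) + ennreal \<eta> * (12 * ennreal (increment_const * h * Q) + ennreal (24 * h) * ennreal Q)
         + ennreal (36 * L^4 * \<eta>) * sqmean (fourth j)"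
      using euler_start euler_increment_square'[of j] j
      by (intro add_mono mult_left_mono order_refl) auto
    also have "ennreal \<eta> * (12 * ennreal (increment_const * h * Q) + ennreal (24 * h) * ennreal Q) = ennreal ((12 * increment_const + 24) * h * Q / real n)"
    proof -
      have e12: "12 * ennreal (increment_const * h * Q) = ennreal (12 * (increment_const * h * Q))"
        using ennreal_mult'[of 12 "increment_const * h * Q"] by simp
      have "ennreal \<eta> * (12 * ennreal (increment_const * h * Q) + ennreal (24 * h) * ennreal Q) = ennreal (\<eta> * (12 * (increment_const * h * Q) + 24 * h * Q))"
        unfolding e12 using eta Q const_nonneg by (simp add: ennreal_plus[symmetric] ennreal_mult[symmetric] del: ennreal_plus)
      also have "\<eta> * (12 * (increment_const * h * Q) + 24 * h * Q) = (12 * increment_const + 24) * h * Q / real n"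
        by (simp add: algebra_simps add_divide_distrib)
      finally show ?thesis .
    qed
    finally show "sqmean (fourth (Suc j)) \<le> sqmean (fourth j) + (ennreal ((12 * increment_const + 24) * h * Q / real n) + ennreal (36 * L^4 / real n) * sqmean (fourth j))"
      by (simp add: add.assoc)
  qed (use Q qP eta const_nonneg in \<open>auto simp: sqmean_def\<close>)
  then show ?thesis by (simp add: fourth_const_def power2_eq_square ac_simps)
qed

text \<open>
  A zero of \<sigma> is absorbing for the Euler scheme. This covers the case in which the weight
  degenerates.
\<close>

lemma euler_frozen:
  assumes "\<sigma> (y 0 \<omega>) = 0"
  shows "y j \<omega> = y 0 \<omega>"
  by (induction j) (use assms in auto)

lemma euler_taylor_remainder:
  assumes j: "j \<le> P"
  shows "sqmean (\<lambda>\<omega>. \<sigma> (y j \<omega>) - \<sigma> (y 0 \<omega>) - deriv \<sigma> (y 0 \<omega>) * U j \<omega>) \<le> ennreal ((6 * L^2 + 2 * L)^2 * (fourth_const * h^2 * Q))"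
proof (rule sqmean_le_cmult[OF _ _ euler_increment_fourth[OF j]])
  have [measurable]: "y j \<in> borel_measurable M" "y 0 \<in> borel_measurable M"
    using y_measurable[OF j] y_measurable[of 0] by auto
  show "fourth j \<in> borel_measurable M" by measurable
  fix \<omega>
  show "\<bar>\<sigma> (y j \<omega>) - \<sigma> (y 0 \<omega>) - deriv \<sigma> (y 0 \<omega>) * U j \<omega>\<bar> \<le> (6 * L^2 + 2 * L) * \<bar>fourth j \<omega>\<bar>"
  proof (cases "\<sigma> (y 0 \<omega>) = 0")
    case True
    then show ?thesis using euler_frozen[OF True, of j] L0 by simp
  next
    case False
    have "\<bar>\<sigma> (y 0 \<omega>)\<bar> * \<bar>\<sigma> (y j \<omega>) - \<sigma> (y 0 \<omega>) - deriv \<sigma> (y 0 \<omega>) * U j \<omega>\<bar> \<le> (6 * L^2 + 2 * L) * (U j \<omega>)^2"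
      by (rule taylor_remainder_bound[OF deriv_sigma deriv_bound sigma_deriv_lipschitz sigma_lipschitz L0 L0])
    then show ?thesis using False by (simp add: abs_mult field_simps)
  qed
qed (use const_nonneg Q in auto)

text \<open>
  The process y_j - y_0 - \<sigma>(y_0) b_j is a stochastic sum with coefficients \<sigma>(y_j) -
  \<sigma>(y_0), which are of mean square order h.
\<close>

lemma euler_linear_remainder:
  assumes "j \<le> P"
  shows "sqmean (\<lambda>\<omega>. U j \<omega> - \<sigma> (y 0 \<omega>) * b j \<omega>) \<le> ennreal (L^2 * increment_const * h^2 * Q)"
proof -
  have "sqmean (\<lambda>\<omega>. U j \<omega> - \<sigma> (y 0 \<omega>) * b j \<omega>) \<le> ennreal (real P / real n * (L^2 * (increment_const * h * Q)) * exp 0)"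
  proof (rule gronwall_step_ennreal[OF _ _ n _ _ _ assms, where \<beta>=0])
    fix j assume j: "j < P"
    have [measurable]: "y j \<in> borel_measurable (F (v j))" "y 0 \<in> borel_measurable (F (v j))"
      using y_adapted[of j j] y_adapted[of 0 j] j by auto
    have [measurable]: "(\<lambda>\<omega>. b j \<omega>) \<in> borel_measurable (F (v j))" using b_adapted[of j] j by simp
    have [measurable]: "y j \<in> borel_measurable M" "y 0 \<in> borel_measurable M"
      using y_measurable[of j] y_measurable[of 0] j by auto
    have "(\<lambda>\<omega>. U (Suc j) \<omega> - \<sigma> (y 0 \<omega>) * b (Suc j) \<omega>)
       = (\<lambda>\<omega>. (U j \<omega> - \<sigma> (y 0 \<omega>) * b j \<omega>) + (\<sigma> (y j \<omega>) - \<sigma> (y 0 \<omega>)) * \<Delta> j \<omega>)"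
      unfolding y_Suc by (rule ext) (simp only: algebra_simps)
    then have "sqmean (\<lambda>\<omega>. U (Suc j) \<omega> - \<sigma> (y 0 \<omega>) * b (Suc j) \<omega>)
       = sqmean (\<lambda>\<omega>. (U j \<omega> - \<sigma> (y 0 \<omega>) * b j \<omega>) + (\<sigma> (y j \<omega>) - \<sigma> (y 0 \<omega>)) * \<Delta> j \<omega>)"
      by (simp only:)
    also have "\<dots> = sqmean (\<lambda>\<omega>. U j \<omega> - \<sigma> (y 0 \<omega>) * b j \<omega>) + ennreal (v (Suc j) - v j) * sqmean (\<lambda>\<omega>. \<sigma> (y j \<omega>) - \<sigma> (y 0 \<omega>))"
    proof (rule sqmean_increment)
      show "(\<lambda>\<omega>. U j \<omega> - \<sigma> (y 0 \<omega>) * b j \<omega>) \<in> borel_measurable (F (v j))" by measurable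
      show "(\<lambda>\<omega>. \<sigma> (y j \<omega>) - \<sigma> (y 0 \<omega>)) \<in> borel_measurable (F (v j))" by measurable
    qed (use v_range[of j] v_range[of "Suc j"] v_step(2)[of j] j in \<open>auto\<close>)
    also have "\<dots> \<le> sqmean (\<lambda>\<omega>. U j \<omega> - \<sigma> (y 0 \<omega>) * b j \<omega>) + ennreal \<eta> * ennreal (L^2 * (increment_const * h * Q))"
      unfolding v_step(1)
    proof (intro add_left_mono mult_left_mono sqmean_le_cmult[OF _ _ euler_increment_square'])
      show "U j \<in> borel_measurable M" by measurable
      show "\<bar>\<sigma> (y j \<omega>) - \<sigma> (y 0 \<omega>)\<bar> \<le> L * \<bar>U j \<omega>\<bar>" for \<omega> by (rule sigma_lipschitz)
    qed (use j const_nonneg Q in auto)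
    also have "ennreal \<eta> * ennreal (L^2 * (increment_const * h * Q)) = ennreal (L^2 * (increment_const * h * Q) / real n)"
      using const_nonneg Q by (simp add: ennreal_mult[symmetric])
    finally show "sqmean (\<lambda>\<omega>. U (Suc j) \<omega> - \<sigma> (y 0 \<omega>) * b (Suc j) \<omega>)
      \<le> sqmean (\<lambda>\<omega>. U j \<omega> - \<sigma> (y 0 \<omega>) * b j \<omega>) + (ennreal (L^2 * (increment_const * h * Q) / real n) + ennreal (0 / real n) * sqmean (\<lambda>\<omega>. U j \<omega> - \<sigma> (y 0 \<omega>) * b j \<omega>))"
      by simp
  qed (use Q qP const_nonneg in \<open>auto simp: sqmean_def\<close>)
  then show ?thesis by (simp add: power2_eq_square ac_simps)
qed

text \<open>
  The weights come from splitting a sum of five terms by four successive uses of (f + g)^2 \<le> 2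
  f^2 + 2 g^2: they are 2, 4, 8, 16 and 16. The third and the fourth term are at most L^2 e each,
  which accounts for the 24 below.
\<close>

definition "integrand_const = 2 * (6 * L^2 + 2 * L)^2 * fourth_const + 4 * L^4 * increment_const + 16 * L^4 * exp (L^2)"

text \<open>
  The scheme starts its step at x, at a mean square distance of at most e from the Euler scheme.
\<close>

context
  fixes x :: "'w \<Rightarrow> real" and e :: real
  assumes x_adapted: "x \<in> borel_measurable (F (real q / real n))"
    and x_start: "sqmean (\<lambda>\<omega>. \<sigma> (x \<omega>)) \<le> ennreal Q"
    and e: "0 \<le> e" and start_error: "sqmean (\<lambda>\<omega>. euler n q \<omega> - x \<omega>) \<le> ennreal e"
begin

text \<open>
  The step of the scheme, extended to all intermediate times of the block.
\<close>

definition scheme_path :: "nat \<Rightarrow> 'w \<Rightarrow> real" where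
  "scheme_path j \<omega> = x \<omega> + wick_step (\<sigma> (x \<omega>)) (deriv \<sigma> (x \<omega>)) (b j \<omega>) (v j - v 0)"

text \<open>
  The diffusion coefficient of the extended scheme: it solves dD = \<sigma>'(x) D dB with initial
  value \<sigma>(x).
\<close>

definition scheme_integrand :: "nat \<Rightarrow> 'w \<Rightarrow> real" where
  "scheme_integrand j \<omega> = \<sigma> (x \<omega>) * exp (deriv \<sigma> (x \<omega>) * b j \<omega> - (deriv \<sigma> (x \<omega>))^2 * (v j - v 0) / 2)"

lemma scheme_path_Suc: "scheme_path (Suc j) \<omega> = scheme_path j \<omega> + wick_step (scheme_integrand j \<omega>) (deriv \<sigma> (x \<omega>)) (\<Delta> j \<omega>) (v (Suc j) - v j)"
  using wick_step_add[of "\<sigma> (x \<omega>)" "deriv \<sigma> (x \<omega>)" "b j \<omega>" "\<Delta> j \<omega>" "v j - v 0" "v (Suc j) - v j"]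
  by (simp add: scheme_path_def scheme_integrand_def)

lemma x_meas: "j \<le> P \<Longrightarrow> x \<in> borel_measurable (F (v j))"
  by (rule measurable_F_mono[OF x_adapted]) (simp add: divide_right_mono)

lemma x_measM: "x \<in> borel_measurable M"
  using measurable_F_M[OF x_meas[of 0]] v_range[of 0] by simp

lemma b_measM: "j \<le> P \<Longrightarrow> (\<lambda>\<omega>. b j \<omega>) \<in> borel_measurable M"
  using measurable_F_M[OF b_adapted[of j]] v_range[of j] by simp

lemma scheme_integrand_square: "j \<le> P \<Longrightarrow> sqmean (scheme_integrand j) \<le> ennreal (exp (L^2) * Q)"
proof -
  assume j: "j \<le> P"
  have [measurable]: "x \<in> borel_measurable (F (v 0))" using x_meas[of 0] by simp
  have "sqmean (scheme_integrand j) \<le> ennreal (exp (L^2)) * sqmean (\<lambda>\<omega>. \<sigma> (x \<omega>))"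
    unfolding scheme_integrand_def
  proof (rule sqmean_exp_increment(1))
    show "0 \<le> v 0" "v 0 \<le> v j" "v j \<le> 1" using v_range[of 0] v_step(3)[of j] v_range[OF j] by auto
    show "(\<lambda>\<omega>. \<sigma> (x \<omega>)) \<in> borel_measurable (F (v 0))" by measurable
    show "(\<lambda>\<omega>. deriv \<sigma> (x \<omega>)) \<in> borel_measurable (F (v 0))" by measurable
  qed (use deriv_bound L0 in auto)
  also have "\<dots> \<le> ennreal (exp (L^2)) * ennreal Q" using x_start by (rule mult_left_mono) simp
  finally show ?thesis by (simp add: ennreal_mult')
qed

lemma exp_remainder_square:
  assumes j: "j \<le> P"
  shows "sqmean (\<lambda>\<omega>. \<sigma> (x \<omega>) * (1 + deriv \<sigma> (x \<omega>) * b j \<omega> - exp (deriv \<sigma> (x \<omega>) * b j \<omega> - (deriv \<sigma> (x \<omega>))^2 * (v j - v 0) / 2)))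
    \<le> ennreal (L^4 * exp (L^2) * h^2 * Q)"
proof -
  have [measurable]: "x \<in> borel_measurable (F (v 0))" using x_meas[of 0] by simp
  have "sqmean (\<lambda>\<omega>. \<sigma> (x \<omega>) * (1 + deriv \<sigma> (x \<omega>) * b j \<omega> - exp (deriv \<sigma> (x \<omega>) * b j \<omega> - (deriv \<sigma> (x \<omega>))^2 * (v j - v 0) / 2)))
     \<le> ennreal (L^4 * (v j - v 0)^2 * exp (L^2)) * sqmean (\<lambda>\<omega>. \<sigma> (x \<omega>))"
  proof (rule sqmean_exp_increment(2))
    show "0 \<le> v 0" "v 0 \<le> v j" "v j \<le> 1" using v_range[of 0] v_step(3)[of j] v_range[OF j] by auto
    show "(\<lambda>\<omega>. \<sigma> (x \<omega>)) \<in> borel_measurable (F (v 0))" by measurable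
    show "(\<lambda>\<omega>. deriv \<sigma> (x \<omega>)) \<in> borel_measurable (F (v 0))" by measurable
  qed (use deriv_bound L0 in auto)
  also have "\<dots> \<le> ennreal (L^4 * h^2 * exp (L^2)) * ennreal Q"
  proof (rule mult_mono)
    have "v j - v 0 \<le> h" unfolding v_step(4) using j by (simp add: divide_right_mono)
    then have "(v j - v 0)^2 \<le> h^2" using v_step(3)[of j] by (intro power_mono) auto
    then show "ennreal (L^4 * (v j - v 0)^2 * exp (L^2)) \<le> ennreal (L^4 * h^2 * exp (L^2))"
      by (intro ennreal_leI mult_right_mono mult_left_mono) auto
  qed (use x_start in auto)
  also have "\<dots> = ennreal (L^4 * exp (L^2) * h^2 * Q)"
    using Q by (simp add: ennreal_mult[symmetric] ac_simps)
  finally show ?thesis .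
qed

text \<open>
  The five terms are the Taylor remainder of \<sigma> along the Euler scheme, the error of replacing
  the Euler increment by \<sigma>(y_0) b_j, the differences of \<sigma> and of \<sigma> \<sigma>' at
  the two starting points, and the remainder of the Wick exponential.
\<close>

lemma integrand_error:
  assumes j: "j \<le> P"
  shows "sqmean (\<lambda>\<omega>. \<sigma> (y j \<omega>) - scheme_integrand j \<omega>) \<le> ennreal (integrand_const * h^2 * Q + 24 * L^2 * e)"
proof -
  have [measurable]: "y j \<in> borel_measurable M" "y 0 \<in> borel_measurable M" "x \<in> borel_measurable M"
      "(\<lambda>\<omega>. b j \<omega>) \<in> borel_measurable M"
    using y_measurable[OF j] y_measurable[of 0] x_measM b_measM[OF j] by auto
  have e0: "sqmean (\<lambda>\<omega>. y 0 \<omega> - x \<omega>) \<le> ennreal e" using start_error by simp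
  let ?R1 = "\<lambda>\<omega>. \<sigma> (y j \<omega>) - \<sigma> (y 0 \<omega>) - deriv \<sigma> (y 0 \<omega>) * U j \<omega>"
  let ?R2 = "\<lambda>\<omega>. deriv \<sigma> (y 0 \<omega>) * (U j \<omega> - \<sigma> (y 0 \<omega>) * b j \<omega>)"
  let ?R3 = "\<lambda>\<omega>. \<sigma> (y 0 \<omega>) - \<sigma> (x \<omega>)"
  let ?g = "\<lambda>\<omega>. \<sigma> (y 0 \<omega>) * deriv \<sigma> (y 0 \<omega>) - \<sigma> (x \<omega>) * deriv \<sigma> (x \<omega>)"
  let ?R4 = "\<lambda>\<omega>. ?g \<omega> * b j \<omega>"
  let ?R5 = "\<lambda>\<omega>. \<sigma> (x \<omega>) * (1 + deriv \<sigma> (x \<omega>) * b j \<omega> - exp (deriv \<sigma> (x \<omega>) * b j \<omega> - (deriv \<sigma> (x \<omega>))^2 * (v j - v 0) / 2))"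
  have m1: "?R1 \<in> borel_measurable M" by measurable
  have m2: "?R2 \<in> borel_measurable M" by measurable
  have m3: "?R3 \<in> borel_measurable M" by measurable
  have m4: "?R4 \<in> borel_measurable M" by measurable
  have m5: "?R5 \<in> borel_measurable M" by measurable
  have b1: "sqmean ?R1 \<le> ennreal ((6 * L^2 + 2 * L)^2 * (fourth_const * h^2 * Q))" by (rule euler_taylor_remainder[OF j])
  have b2: "sqmean ?R2 \<le> ennreal (L^2 * (L^2 * increment_const * h^2 * Q))"
  proof (rule sqmean_le_cmult[OF _ _ euler_linear_remainder[OF j]])
    show "(\<lambda>\<omega>. U j \<omega> - \<sigma> (y 0 \<omega>) * b j \<omega>) \<in> borel_measurable M" by measurable
    show "\<bar>?R2 \<omega>\<bar> \<le> L * \<bar>U j \<omega> - \<sigma> (y 0 \<omega>) * b j \<omega>\<bar>" for \<omega>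
      unfolding abs_mult by (intro mult_right_mono deriv_bound) auto
  qed (use const_nonneg Q in auto)
  have b3: "sqmean ?R3 \<le> ennreal (L^2 * e)"
  proof (rule sqmean_le_cmult[OF _ _ e0 e])
    show "\<bar>?R3 \<omega>\<bar> \<le> L * \<bar>y 0 \<omega> - x \<omega>\<bar>" for \<omega> by (rule sigma_lipschitz)
  qed measurable
  have b4: "sqmean ?R4 \<le> ennreal (L^2 * e)"
  proof -
    have [measurable]: "x \<in> borel_measurable (F (v 0))" "y 0 \<in> borel_measurable (F (v 0))"
      using x_meas[of 0] y_adapted[of 0 0] by auto
    have gm: "?g \<in> borel_measurable (F (v 0))" by measurable
    have zm: "(\<lambda>_. 0) \<in> borel_measurable (F (v 0))" by measurable
    have "sqmean ?R4 = sqmean (\<lambda>\<omega>. 0 + ?g \<omega> * b j \<omega>)" by simp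
    also have "\<dots> = sqmean (\<lambda>\<omega>. 0) + ennreal (v j - v 0) * sqmean ?g"
      by (rule sqmean_increment[OF _ v_step(3) _ zm gm]) (use v_range[of 0] v_range[OF j] in auto)
    also have "\<dots> \<le> 0 + 1 * ennreal (L^2 * e)"
    proof (intro add_mono mult_mono)
      have "v j - v 0 \<le> 1" using v_range[of 0] v_range[OF j] by linarith
      then show "ennreal (v j - v 0) \<le> 1" by simp
      show "sqmean ?g \<le> ennreal (L^2 * e)"
      proof (rule sqmean_le_cmult[OF _ _ e0 e])
        show "\<bar>?g \<omega>\<bar> \<le> L * \<bar>y 0 \<omega> - x \<omega>\<bar>" for \<omega> by (rule sigma_deriv_lipschitz)
      qed measurable
    qed (auto simp: sqmean_def)
    finally show ?thesis by simp
  qed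
  have b5: "sqmean ?R5 \<le> ennreal (L^4 * exp (L^2) * h^2 * Q)" by (rule exp_remainder_square[OF j])
  have eq: "\<sigma> (y j \<omega>) - scheme_integrand j \<omega> = ?R1 \<omega> + (?R2 \<omega> + (?R3 \<omega> + (?R4 \<omega> + ?R5 \<omega>)))" for \<omega>
    unfolding scheme_integrand_def by (simp add: algebra_simps)
  define p where "p = (6 * L^2 + 2 * L)^2 * (fourth_const * h^2 * Q)"
  define r where "r = L^2 * (L^2 * increment_const * h^2 * Q)"
  define s where "s = L^4 * exp (L^2) * h^2 * Q"
  have nn: "0 \<le> p" "0 \<le> r" "0 \<le> s" "0 \<le> L^2 * e" using const_nonneg Q e by (auto simp: p_def r_def s_def)
  note b = b1[folded p_def] b2[folded r_def] b3 b4 b5[folded s_def]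
  have s45: "sqmean (\<lambda>\<omega>. ?R4 \<omega> + ?R5 \<omega>) \<le> ennreal (2 * (L^2 * e) + 2 * s)"
    by (rule sqmean_add_le[OF m4 m5 b(4,5)]) (intro add_nonneg_nonneg mult_nonneg_nonneg zero_le_numeral nn zero_le_power2 e)+
  have m45: "(\<lambda>\<omega>. ?R4 \<omega> + ?R5 \<omega>) \<in> borel_measurable M" using m4 m5 by (rule borel_measurable_add)
  have s345: "sqmean (\<lambda>\<omega>. ?R3 \<omega> + (?R4 \<omega> + ?R5 \<omega>)) \<le> ennreal (2 * (L^2 * e) + 2 * (2 * (L^2 * e) + 2 * s))"
    by (rule sqmean_add_le[OF m3 m45 b(3) s45]) (intro add_nonneg_nonneg mult_nonneg_nonneg zero_le_numeral nn zero_le_power2 e)+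
  have m345: "(\<lambda>\<omega>. ?R3 \<omega> + (?R4 \<omega> + ?R5 \<omega>)) \<in> borel_measurable M" using m3 m45 by (rule borel_measurable_add)
  have s2345: "sqmean (\<lambda>\<omega>. ?R2 \<omega> + (?R3 \<omega> + (?R4 \<omega> + ?R5 \<omega>))) \<le> ennreal (2 * r + 2 * (2 * (L^2 * e) + 2 * (2 * (L^2 * e) + 2 * s)))"
    by (rule sqmean_add_le[OF m2 m345 b(2) s345]) (intro add_nonneg_nonneg mult_nonneg_nonneg zero_le_numeral nn zero_le_power2 e)+
  have m2345: "(\<lambda>\<omega>. ?R2 \<omega> + (?R3 \<omega> + (?R4 \<omega> + ?R5 \<omega>))) \<in> borel_measurable M" using m2 m345 by (rule borel_measurable_add)
  have "sqmean (\<lambda>\<omega>. ?R1 \<omega> + (?R2 \<omega> + (?R3 \<omega> + (?R4 \<omega> + ?R5 \<omega>))))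
     \<le> ennreal (2 * p + 2 * (2 * r + 2 * (2 * (L^2 * e) + 2 * (2 * (L^2 * e) + 2 * s))))"
    by (rule sqmean_add_le[OF m1 m2345 b(1) s2345]) (intro add_nonneg_nonneg mult_nonneg_nonneg zero_le_numeral nn zero_le_power2 e)+
  also have "2 * p + 2 * (2 * r + 2 * (2 * (L^2 * e) + 2 * (2 * (L^2 * e) + 2 * s))) = integrand_const * h^2 * Q + 24 * L^2 * e"
    unfolding p_def r_def s_def integrand_const_def by (simp add: algebra_simps power2_eq_square power4_eq_xxxx)
  finally show ?thesis unfolding eq .
qed

text \<open>
  The difference of the two paths is a stochastic sum, up to the quadratic corrections of the Wick
  exponential over single fine steps. These have total mean square of order h \<eta>, hence the
  requirement that the fine mesh be at most h^2.
\<close>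

lemma block_error:
  assumes fine: "\<eta> \<le> h^2"
  shows "sqmean (\<lambda>\<omega>. y P \<omega> - scheme_path P \<omega>) \<le> ennreal (e + h * (24 * L^2 * e + (integrand_const + L^2 * exp (L^2) * exp (L^2)) * h^2 * Q))"
proof -
  define K where "K = (integrand_const * h^2 * Q + 24 * L^2 * e) + L^2 * \<eta> * exp (L^2) * (exp (L^2) * Q)"
  have integrand_const: "0 \<le> integrand_const" using const_nonneg by (simp add: integrand_const_def)
  have K: "0 \<le> K" using integrand_const Q e by (simp add: K_def)
  have "sqmean (\<lambda>\<omega>. y j \<omega> - scheme_path j \<omega>) \<le> ennreal (e + real j * (K / real n))" if "j \<le> P" for j
    using that
  proof (induction j)
    case 0
    have "y 0 \<omega> - scheme_path 0 \<omega> = euler n q \<omega> - x \<omega>" for \<omega> by (simp add: scheme_path_def)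
    then show ?case using start_error by simp
  next
    case (Suc j)
    then have j: "j \<le> P" "Suc j \<le> P" by auto
    have [measurable]: "x \<in> borel_measurable (F (v j))" "y j \<in> borel_measurable (F (v j))"
      "(\<lambda>\<omega>. b j \<omega>) \<in> borel_measurable (F (v j))"
      using x_meas[OF j(1)] y_adapted[OF order_refl j(1)] b_adapted[OF j(1)] by auto
    have zm: "scheme_path j \<in> borel_measurable (F (v j))" unfolding scheme_path_def by measurable
    have Dm: "scheme_integrand j \<in> borel_measurable (F (v j))" unfolding scheme_integrand_def by measurable
    have em: "(\<lambda>\<omega>. y j \<omega> - scheme_path j \<omega>) \<in> borel_measurable (F (v j))" using zm by measurable
    have sm: "(\<lambda>\<omega>. \<sigma> (y j \<omega>)) \<in> borel_measurable (F (v j))" by measurable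
    have cm: "(\<lambda>\<omega>. deriv \<sigma> (x \<omega>)) \<in> borel_measurable (F (v j))" by measurable
    have "y (Suc j) \<omega> - scheme_path (Suc j) \<omega> = (y j \<omega> - scheme_path j \<omega>) + \<sigma> (y j \<omega>) * \<Delta> j \<omega>
        - wick_step (scheme_integrand j \<omega>) (deriv \<sigma> (x \<omega>)) (\<Delta> j \<omega>) (v (Suc j) - v j)" for \<omega>
      unfolding scheme_path_Suc y_Suc by simp
    then have "sqmean (\<lambda>\<omega>. y (Suc j) \<omega> - scheme_path (Suc j) \<omega>)
      = sqmean (\<lambda>\<omega>. (y j \<omega> - scheme_path j \<omega>) + \<sigma> (y j \<omega>) * \<Delta> j \<omega> - wick_step (scheme_integrand j \<omega>) (deriv \<sigma> (x \<omega>)) (\<Delta> j \<omega>) (v (Suc j) - v j))"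
      by (simp only:)
    also have "\<dots> \<le> sqmean (\<lambda>\<omega>. y j \<omega> - scheme_path j \<omega>) + ennreal (v (Suc j) - v j) * sqmean (\<lambda>\<omega>. \<sigma> (y j \<omega>) - scheme_integrand j \<omega>)
        + ennreal (L^2 * (v (Suc j) - v j)^2 * exp (L^2)) * sqmean (scheme_integrand j)"
      by (rule sqmean_wick_increment[OF _ v_step(2) _ em sm Dm cm deriv_bound L0])
         (use v_range[OF j(1)] v_range[OF j(2)] in auto)
    also have "\<dots> \<le> ennreal (e + real j * (K / real n)) + ennreal \<eta> * ennreal (integrand_const * h^2 * Q + 24 * L^2 * e)
        + ennreal (L^2 * \<eta>^2 * exp (L^2)) * ennreal (exp (L^2) * Q)"
      unfolding v_step(1)
      by (intro add_mono mult_left_mono integrand_error scheme_integrand_square Suc.IH j) auto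
    also have "\<dots> = ennreal ((e + real j * (K / real n)) + \<eta> * (integrand_const * h^2 * Q + 24 * L^2 * e) + (L^2 * \<eta>^2 * exp (L^2)) * (exp (L^2) * Q))"
      by (rule ennreal_add_mult_mult) (use e K integrand_const Q in auto)
    also have "(e + real j * (K / real n)) + \<eta> * (integrand_const * h^2 * Q + 24 * L^2 * e) + (L^2 * \<eta>^2 * exp (L^2)) * (exp (L^2) * Q)
       = e + real (Suc j) * (K / real n)"
      by (simp add: K_def algebra_simps power2_eq_square add_divide_distrib)
    finally show ?case .
  qed
  then have "sqmean (\<lambda>\<omega>. y P \<omega> - scheme_path P \<omega>) \<le> ennreal (e + real P * (K / real n))" by blast
  also have "\<dots> \<le> ennreal (e + h * (24 * L^2 * e + (integrand_const + L^2 * exp (L^2) * exp (L^2)) * h^2 * Q))"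
  proof (rule ennreal_leI)
    have "L^2 * \<eta> * exp (L^2) * (exp (L^2) * Q) \<le> L^2 * h^2 * exp (L^2) * (exp (L^2) * Q)"
      using fine Q by (intro mult_right_mono mult_left_mono) auto
    then have "K \<le> 24 * L^2 * e + (integrand_const + L^2 * exp (L^2) * exp (L^2)) * h^2 * Q"
      unfolding K_def by (simp add: algebra_simps)
    then have "h * K \<le> h * (24 * L^2 * e + (integrand_const + L^2 * exp (L^2) * exp (L^2)) * h^2 * Q)"
      by (intro mult_left_mono) auto
    then show "e + real P * (K / real n) \<le> e + h * (24 * L^2 * e + (integrand_const + L^2 * exp (L^2) * exp (L^2)) * h^2 * Q)" by simp
  qed
  finally show ?thesis .
qed

end

end

section \<open>The mean-square error of the scheme\<close>

context wick_sde
begin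

lemma sqmean_sigma_le:
  assumes [measurable]: "x \<in> borel_measurable M"
  shows "sqmean (\<lambda>\<omega>. \<sigma> (x \<omega>)) \<le> ennreal (2 * (\<sigma> a)^2) + ennreal (2 * L^2) * sqmean (\<lambda>\<omega>. x \<omega> - a)"
proof -
  have "sqmean (\<lambda>\<omega>. \<sigma> (x \<omega>)) = sqmean (\<lambda>\<omega>. \<sigma> a + (\<sigma> (x \<omega>) - \<sigma> a))" by simp
  also have "\<dots> \<le> 2 * sqmean (\<lambda>\<omega>. \<sigma> a) + 2 * sqmean (\<lambda>\<omega>. \<sigma> (x \<omega>) - \<sigma> a)"
    by (rule sqmean_add) measurable
  also have "\<dots> \<le> 2 * ennreal (\<bar>\<sigma> a\<bar>^2) + 2 * sqmean (\<lambda>\<omega>. L * (x \<omega> - a))"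
  proof (intro add_mono mult_left_mono sqmean_mono sqmean_bounded)
    show "\<bar>\<sigma> (x \<omega>) - \<sigma> a\<bar> \<le> \<bar>L * (x \<omega> - a)\<bar>" for \<omega>
      using sigma_lipschitz[of "x \<omega>" a] L1 by (simp add: abs_mult)
  qed auto
  also have "sqmean (\<lambda>\<omega>. L * (x \<omega> - a)) = ennreal (L^2) * sqmean (\<lambda>\<omega>. x \<omega> - a)"
    by (rule sqmean_cmult) measurable
  also have "2 * ennreal (\<bar>\<sigma> a\<bar>^2) + 2 * (ennreal (L^2) * sqmean (\<lambda>\<omega>. x \<omega> - a))
     = ennreal (2 * (\<sigma> a)^2) + ennreal (2 * L^2) * sqmean (\<lambda>\<omega>. x \<omega> - a)"
    by (simp add: ennreal_mult' mult.assoc)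
  finally show ?thesis .
qed

lemma scheme_Suc:
  "scheme B \<sigma> a N (Suc k) \<omega> = scheme B \<sigma> a N k \<omega> + wick_step (\<sigma> (scheme B \<sigma> a N k \<omega>)) (deriv \<sigma> (scheme B \<sigma> a N k \<omega>))
      (dB N k \<omega>) (1 / real N)"
  by (simp add: Let_def wick_step_def)

lemma scheme_adapted: "0 < N \<Longrightarrow> k \<le> N \<Longrightarrow> scheme B \<sigma> a N k \<in> borel_measurable (F (real k / real N))"
proof (induction k)
  case (Suc k)
  have le: "real k / real N \<le> real (Suc k) / real N" by (simp add: divide_right_mono)
  have [measurable]: "scheme B \<sigma> a N k \<in> borel_measurable (F (real (Suc k) / real N))"
    using Suc by (intro measurable_F_mono[OF _ le]) auto
  have [measurable]: "B (real k / real N) \<in> borel_measurable (F (real (Suc k) / real N))"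
    "B (real (Suc k) / real N) \<in> borel_measurable (F (real (Suc k) / real N))"
    using le by (auto intro!: B_adapted)
  have eq: "scheme B \<sigma> a N (Suc k) = (\<lambda>\<omega>. scheme B \<sigma> a N k \<omega> + wick_step (\<sigma> (scheme B \<sigma> a N k \<omega>)) (deriv \<sigma> (scheme B \<sigma> a N k \<omega>))
      (dB N k \<omega>) (1 / real N))"
    by (rule ext) (rule scheme_Suc)
  show ?case unfolding eq by measurable
qed simp

lemma scheme_measurable: "0 < N \<Longrightarrow> k \<le> N \<Longrightarrow> scheme B \<sigma> a N k \<in> borel_measurable M"
  using measurable_F_M[OF scheme_adapted] grid_point[of N k] by auto

text \<open>
  The whole time interval is a single block starting at a.
\<close>

lemma euler_sigma_bounded:
  assumes n: "0 < n" and l: "l \<le> n"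
  shows "sqmean (\<lambda>\<omega>. \<sigma> (euler n l \<omega>)) \<le> ennreal (2 * (\<sigma> a)^2 + 2 * L^2 * (2 * (\<sigma> a)^2 * exp (2 * L^2)))"
proof -
  interpret blk: euler_block M B \<sigma> a X L n 0 n "(\<sigma> a)^2"
  proof unfold_locales
    show "sqmean (\<lambda>\<omega>. \<sigma> (euler n 0 \<omega>)) \<le> ennreal ((\<sigma> a)^2)"
      using sqmean_bounded[of "\<lambda>\<omega>. \<sigma> a" "\<bar>\<sigma> a\<bar>"] by simp
  qed (use n in auto)
  have "sqmean (\<lambda>\<omega>. euler n l \<omega> - a) \<le> ennreal (2 * (\<sigma> a)^2 * exp (2 * L^2))"
    using blk.euler_increment_square[OF l] n by simp
  then have "ennreal (2 * (\<sigma> a)^2) + ennreal (2 * L^2) * sqmean (\<lambda>\<omega>. euler n l \<omega> - a)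
     \<le> ennreal (2 * (\<sigma> a)^2) + ennreal (2 * L^2) * ennreal (2 * (\<sigma> a)^2 * exp (2 * L^2))"
    by (intro add_left_mono mult_left_mono) auto
  also have "\<dots> = ennreal (2 * (\<sigma> a)^2 + 2 * L^2 * (2 * (\<sigma> a)^2 * exp (2 * L^2)))"
    by (rule ennreal_add_mult) auto
  finally show ?thesis
    using sqmean_sigma_le[OF euler_measurable[OF n l]] by (rule order_trans[rotated])
qed

definition scheme_growth :: real where "scheme_growth = 1 + L^2 * exp (L^2)"

lemma scheme_sigma_bounded:
  assumes N: "0 < N" and k: "k \<le> N"
  shows "sqmean (\<lambda>\<omega>. \<sigma> (scheme B \<sigma> a N k \<omega>))
    \<le> ennreal (2 * (\<sigma> a)^2 + 2 * L^2 * (scheme_growth * (2 * (\<sigma> a)^2) * exp (scheme_growth * (2 * L^2))))"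
proof -
  let ?x = "\<lambda>k. scheme B \<sigma> a N k"
  have g0: "0 \<le> scheme_growth" by (simp add: scheme_growth_def)
  have "sqmean (\<lambda>\<omega>. ?x k \<omega> - a) \<le> ennreal (real N / real N * (scheme_growth * (2 * (\<sigma> a)^2)) * exp (scheme_growth * (2 * L^2)))"
  proof (rule gronwall_step_ennreal[OF _ _ N order_refl _ _ k, where f="\<lambda>k. sqmean (\<lambda>\<omega>. ?x k \<omega> - a)"])
    fix j assume j: "j < N"
    let ?s = "real j / real N" and ?t = "real (Suc j) / real N"
    have st: "0 \<le> ?s" "?s < ?t" "?t \<le> 1" "?t - ?s = 1 / real N"
      using j N by (auto simp: divide_strict_right_mono divide_le_eq diff_divide_distrib[symmetric])
    have [measurable]: "?x j \<in> borel_measurable (F ?s)" using scheme_adapted[OF N, of j] j by simp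
    have xM [measurable]: "?x j \<in> borel_measurable M" using scheme_measurable[OF N, of j] j by simp
    \<comment> \<open>The step is linear in its coefficient, so the sign can be moved there.\<close>
    let ?D = "\<lambda>\<omega>. - \<sigma> (?x j \<omega>)"
    have em: "(\<lambda>\<omega>. ?x j \<omega> - a) \<in> borel_measurable (F ?s)" by measurable
    have zm: "(\<lambda>\<omega>. 0) \<in> borel_measurable (F ?s)" by measurable
    have Dm: "?D \<in> borel_measurable (F ?s)" by measurable
    have cm: "(\<lambda>\<omega>. deriv \<sigma> (?x j \<omega>)) \<in> borel_measurable (F ?s)" by measurable
    have L0: "0 \<le> L" using L1 by simp
    have Deq: "sqmean ?D = sqmean (\<lambda>\<omega>. \<sigma> (?x j \<omega>))" by (simp add: sqmean_def)
    have "sqmean (\<lambda>\<omega>. ?x (Suc j) \<omega> - a) = sqmean (\<lambda>\<omega>. (?x j \<omega> - a) + 0 * (B ?t \<omega> - B ?s \<omega>)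
        - wick_step (?D \<omega>) (deriv \<sigma> (?x j \<omega>)) (B ?t \<omega> - B ?s \<omega>) (?t - ?s))"
      unfolding scheme_Suc wick_step_minus st(4) by (simp add: algebra_simps)
    also have "\<dots> \<le> sqmean (\<lambda>\<omega>. ?x j \<omega> - a) + ennreal (?t - ?s) * sqmean (\<lambda>\<omega>. 0 - ?D \<omega>)
        + ennreal (L^2 * (?t - ?s)^2 * exp (L^2)) * sqmean ?D"
      by (rule sqmean_wick_increment[OF st(1-3) em zm Dm cm deriv_bound L0])
    also have "\<dots> = sqmean (\<lambda>\<omega>. ?x j \<omega> - a)
        + (ennreal (1 / real N) + ennreal (L^2 * (1 / real N)^2 * exp (L^2))) * sqmean (\<lambda>\<omega>. \<sigma> (?x j \<omega>))"
      unfolding Deq st(4) by (simp add: distrib_right add.assoc)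
    also have "ennreal (1 / real N) + ennreal (L^2 * (1 / real N)^2 * exp (L^2)) = ennreal (1 / real N + L^2 * (1 / real N)^2 * exp (L^2))"
      by (rule ennreal_plus[symmetric]) auto
    also have "\<dots> \<le> ennreal (scheme_growth / real N)"
    proof (rule ennreal_leI)
      have "(1 / real N)^2 \<le> 1 / real N" using N by (simp add: power2_eq_square divide_le_eq)
      then have "L^2 * (1 / real N)^2 * exp (L^2) \<le> L^2 * (1 / real N) * exp (L^2)"
        by (intro mult_right_mono mult_left_mono) auto
      then show "1 / real N + L^2 * (1 / real N)^2 * exp (L^2) \<le> scheme_growth / real N"
        by (simp add: scheme_growth_def add_divide_distrib)
    qed
    also have "ennreal (scheme_growth / real N) * sqmean (\<lambda>\<omega>. \<sigma> (?x j \<omega>))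
       \<le> ennreal (scheme_growth / real N) * (ennreal (2 * (\<sigma> a)^2) + ennreal (2 * L^2) * sqmean (\<lambda>\<omega>. ?x j \<omega> - a))"
      by (intro mult_left_mono sqmean_sigma_le xM) auto
    also have "\<dots> = ennreal (scheme_growth * (2 * (\<sigma> a)^2) / real N) + ennreal (scheme_growth * (2 * L^2) / real N) * sqmean (\<lambda>\<omega>. ?x j \<omega> - a)"
      using g0 by (simp add: distrib_left mult.assoc[symmetric] ennreal_mult[symmetric])
    finally show "sqmean (\<lambda>\<omega>. ?x (Suc j) \<omega> - a) \<le> sqmean (\<lambda>\<omega>. ?x j \<omega> - a)
       + (ennreal (scheme_growth * (2 * (\<sigma> a)^2) / real N) + ennreal (scheme_growth * (2 * L^2) / real N) * sqmean (\<lambda>\<omega>. ?x j \<omega> - a))"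
      by (simp add: add_left_mono mult_right_mono)
  qed (use g0 in \<open>auto simp: sqmean_def\<close>)
  then have "sqmean (\<lambda>\<omega>. ?x k \<omega> - a) \<le> ennreal (scheme_growth * (2 * (\<sigma> a)^2) * exp (scheme_growth * (2 * L^2)))"
    using N by simp
  then have "ennreal (2 * (\<sigma> a)^2) + ennreal (2 * L^2) * sqmean (\<lambda>\<omega>. ?x k \<omega> - a)
     \<le> ennreal (2 * (\<sigma> a)^2) + ennreal (2 * L^2) * ennreal (scheme_growth * (2 * (\<sigma> a)^2) * exp (scheme_growth * (2 * L^2)))"
    by (intro add_left_mono mult_left_mono) auto
  also have "\<dots> = ennreal (2 * (\<sigma> a)^2 + 2 * L^2 * (scheme_growth * (2 * (\<sigma> a)^2) * exp (scheme_growth * (2 * L^2))))"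
    by (rule ennreal_add_mult) (use g0 in auto)
  finally show ?thesis
    using sqmean_sigma_le[OF scheme_measurable[OF N k]] by (rule order_trans[rotated])
qed

text \<open>
  The block estimate is the recursion e_(k+1) \<le> (1 + \<beta>) e_k + \<alpha> with \<alpha> of
  order h^3 and \<beta> of order h, which over N steps gives order h^2 for the Euler scheme on every
  sufficiently fine grid.
\<close>

theorem scheme_mean_square_error:
  "\<exists>C\<ge>0. \<forall>N>0. \<forall>k\<le>N. sqmean (\<lambda>\<omega>. X (real k / real N) \<omega> - scheme B \<sigma> a N k \<omega>) \<le> ennreal (C / (real N)^2)"
proof -
  obtain Q where Q: "0 \<le> Q"
    and euQ: "\<And>n l. 0 < n \<Longrightarrow> l \<le> n \<Longrightarrow> sqmean (\<lambda>\<omega>. \<sigma> (euler n l \<omega>)) \<le> ennreal Q"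
    and scQ: "\<And>N k. 0 < N \<Longrightarrow> k \<le> N \<Longrightarrow> sqmean (\<lambda>\<omega>. \<sigma> (scheme B \<sigma> a N k \<omega>)) \<le> ennreal Q"
  proof -
    let ?q1 = "2 * (\<sigma> a)^2 + 2 * L^2 * (2 * (\<sigma> a)^2 * exp (2 * L^2))"
    let ?q2 = "2 * (\<sigma> a)^2 + 2 * L^2 * (scheme_growth * (2 * (\<sigma> a)^2) * exp (scheme_growth * (2 * L^2)))"
    show thesis
    proof (rule that[of "max ?q1 ?q2"])
      show "0 \<le> max ?q1 ?q2" by (intro max.coboundedI1) simp
      show "sqmean (\<lambda>\<omega>. \<sigma> (euler n l \<omega>)) \<le> ennreal (max ?q1 ?q2)" if "0 < n" "l \<le> n" for n l
        by (rule order_trans[OF euler_sigma_bounded[OF that] ennreal_leI]) simp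
      show "sqmean (\<lambda>\<omega>. \<sigma> (scheme B \<sigma> a N k \<omega>)) \<le> ennreal (max ?q1 ?q2)" if "0 < N" "k \<le> N" for N k
        by (rule order_trans[OF scheme_sigma_bounded[OF that] ennreal_leI]) simp
    qed
  qed
  define K where "K = (euler_block.integrand_const L + L^2 * exp (L^2) * exp (L^2)) * Q"
  have euler_scheme: "sqmean (\<lambda>\<omega>. euler (N * P) (k * P) \<omega> - scheme B \<sigma> a N k \<omega>) \<le> ennreal (K * exp (24 * L^2) / (real N)^2) \<and> 0 \<le> K"
    if N: "0 < N" and P: "N \<le> P" and k: "k \<le> N" for N P k
  proof -
    define n where "n = N * P"
    have P0: "0 < P" and n0: "0 < n" using N P by (auto simp: n_def)
    \<comment> \<open>One block adds h * K h^2 to the error and amplifies it by 1 + 24 L^2 h.\<close>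
    define \<alpha> where "\<alpha> = K / (real N)^3"
    define \<beta> where "\<beta> = 24 * L^2 / real N"
    have b0: "0 \<le> \<beta>" by (simp add: \<beta>_def)
    have hN: "real P / real n = 1 / real N" using P0 by (simp add: n_def)
    have blk: "euler_block M B \<sigma> a X L n (j * P) P Q" if "j < N" for j
    proof (unfold_locales)
      have "Suc j * P \<le> N * P" using that by (intro mult_le_mono1) simp
      then show le: "j * P + P \<le> n" by (simp add: n_def add.commute)
      show "sqmean (\<lambda>\<omega>. \<sigma> (euler n (j * P) \<omega>)) \<le> ennreal Q" using le by (intro euQ n0) simp
    qed (use n0 P0 Q in auto)
    have K0: "0 \<le> K"
    proof -
      interpret blk: euler_block M B \<sigma> a X L n "0 * P" P Q using N by (rule blk)
      show ?thesis unfolding K_def blk.integrand_const_def using blk.const_nonneg Q by (intro mult_nonneg_nonneg add_nonneg_nonneg) auto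
    qed
    have a0: "0 \<le> \<alpha>" using K0 by (simp add: \<alpha>_def)
    have rec: "sqmean (\<lambda>\<omega>. euler n (k * P) \<omega> - scheme B \<sigma> a N k \<omega>) \<le> ennreal (real k * \<alpha> * (1 + \<beta>) ^ k)"
      if "k \<le> N" for k
      using that
    proof (induction k)
      case 0
      then show ?case by (simp add: sqmean_def)
    next
      case (Suc k)
      then have kN: "k < N" "k \<le> N" by auto
      interpret blk: euler_block M B \<sigma> a X L n "k * P" P Q using kN(1) by (rule blk)
      let ?e = "real k * \<alpha> * (1 + \<beta>) ^ k"
      have grid: "real (j * P) / real n = real j / real N" for j using P0 by (simp add: n_def)
      have e0: "0 \<le> ?e" using a0 b0 by simp
      have xa: "scheme B \<sigma> a N k \<in> borel_measurable (F (real (k * P) / real n))"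
        unfolding grid using scheme_adapted[OF N kN(2)] .
      have fine: "1 / real n \<le> (real P / real n)^2"
      proof -
        have "real N * real N \<le> real N * real P" using P by (intro mult_left_mono) auto
        then have "1 / (real N * real P) \<le> 1 / (real N * real N)" using N by (intro divide_left_mono) auto
        then show ?thesis unfolding hN by (simp add: n_def power2_eq_square)
      qed
      have vP: "real (k * P + P) / real n = real (Suc k) / real N"
        using grid[of "Suc k"] by (simp add: add.commute)
      have v0: "real (k * P + 0) / real n = real k / real N" using grid[of k] by simp
      have d: "real (Suc k) / real N - real k / real N = 1 / real N" by (simp add: diff_divide_distrib[symmetric])
      have "blk.scheme_path (scheme B \<sigma> a N k) P \<omega> = scheme B \<sigma> a N (Suc k) \<omega>" for \<omega>
        unfolding blk.scheme_path_def[OF xa scQ[OF N kN(2)] e0 Suc.IH[OF kN(2)]] scheme_Suc vP v0 d ..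
      then have "sqmean (\<lambda>\<omega>. euler n (Suc k * P) \<omega> - scheme B \<sigma> a N (Suc k) \<omega>)
        = sqmean (\<lambda>\<omega>. euler n (k * P + P) \<omega> - blk.scheme_path (scheme B \<sigma> a N k) P \<omega>)"
        by (simp add: add.commute del: scheme.simps)
      also have "\<dots> \<le> ennreal (?e + real P / real n * (24 * L^2 * ?e + (blk.integrand_const + L^2 * exp (L^2) * exp (L^2)) * (real P / real n)^2 * Q))"
        by (rule blk.block_error[OF xa scQ[OF N kN(2)] e0 Suc.IH[OF kN(2)] fine])
      also have "?e + real P / real n * (24 * L^2 * ?e + (blk.integrand_const + L^2 * exp (L^2) * exp (L^2)) * (real P / real n)^2 * Q) = (1 + \<beta>) * ?e + \<alpha>"
      proof -
        have "e + 1 / r * (c * e + d * (1 / r)^2 * q) = (1 + c / r) * e + d * q / r^3" for e r c d q :: real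
          by (simp add: algebra_simps add_divide_distrib power2_eq_square power3_eq_cube)
        then show ?thesis unfolding hN \<alpha>_def \<beta>_def K_def .
      qed
      also have "ennreal \<dots> \<le> ennreal (real (Suc k) * \<alpha> * (1 + \<beta>) ^ Suc k)"
      proof (rule ennreal_leI)
        have "1 \<le> (1 + \<beta>) ^ Suc k" using b0 by (intro one_le_power) simp
        then have "\<alpha> * 1 \<le> \<alpha> * (1 + \<beta>) ^ Suc k" using a0 by (rule mult_left_mono)
        then show "(1 + \<beta>) * ?e + \<alpha> \<le> real (Suc k) * \<alpha> * (1 + \<beta>) ^ Suc k" by (simp add: algebra_simps)
      qed
      finally show ?case .
    qed
    have "sqmean (\<lambda>\<omega>. euler n (k * P) \<omega> - scheme B \<sigma> a N k \<omega>) \<le> ennreal (real k * \<alpha> * (1 + \<beta>) ^ k)"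
      by (rule rec[OF k])
    also have "\<dots> \<le> ennreal (real N * \<alpha> * exp (24 * L^2))"
    proof (intro ennreal_leI mult_mono)
      have "(1 + \<beta>) ^ k \<le> (1 + \<beta>) ^ N" using k b0 by (intro power_increasing) auto
      also have "\<dots> \<le> exp \<beta> ^ N" using b0 by (intro power_mono exp_ge_add_one_self) auto
      also have "\<dots> = exp (24 * L^2)" using N by (simp add: exp_of_nat_mult[symmetric] \<beta>_def)
      finally show "(1 + \<beta>) ^ k \<le> exp (24 * L^2)" .
    qed (use a0 b0 k in auto)
    also have "real N * \<alpha> * exp (24 * L^2) = K * exp (24 * L^2) / (real N)^2"
      using N by (simp add: \<alpha>_def field_simps power2_eq_square power3_eq_cube)
    finally show ?thesis using K0 by (simp add: n_def)
  qed
  show ?thesis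
  proof (intro exI[of _ "K * exp (24 * L^2)"] conjI allI impI)
    show "0 \<le> K * exp (24 * L^2)" using euler_scheme[of 1 1 0] by simp
    fix N k :: nat assume N: "0 < N" and k: "k \<le> N"
    let ?t = "real k / real N"
    \<comment> \<open>The shift by N makes every refinement fine enough for the block estimate.\<close>
    let ?Y = "\<lambda>m. euler (N * Suc (m + N)) (k * Suc (m + N))"
    have le: "k * Suc (m + N) \<le> N * Suc (m + N)" "0 < N * Suc (m + N)" for m
      using mult_le_mono1[OF k, of "Suc (m + N)"] N by simp_all
    have Ym: "?Y m \<in> borel_measurable M" for m by (rule euler_measurable[OF le(2,1)])
    have Sm: "scheme B \<sigma> a N k \<in> borel_measurable M" by (rule scheme_measurable[OF N k])
    have Xm: "X ?t \<in> borel_measurable M" by (rule X_measurable[OF grid_point[OF N k]])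
    have lim: "tendsto_prob ?Y (X ?t)"
      unfolding tendsto_prob_def
    proof (intro allI impI)
      fix \<epsilon> :: real assume "0 < \<epsilon>"
      from LIMSEQ_ignore_initial_segment[OF tendsto_probD[OF euler_tendsto_prob[OF N k] this], of N]
      show "(\<lambda>m. prob {\<omega>\<in>space M. \<epsilon> < \<bar>?Y m \<omega> - X ?t \<omega>\<bar>}) \<longlonglongrightarrow> 0" .
    qed
    have "tendsto_prob (\<lambda>m \<omega>. ?Y m \<omega> - scheme B \<sigma> a N k \<omega>) (\<lambda>\<omega>. X ?t \<omega> - scheme B \<sigma> a N k \<omega>)"
    proof (rule tendsto_prob_diff[OF Ym Sm Xm Sm lim])
      show "tendsto_prob (\<lambda>m. scheme B \<sigma> a N k) (scheme B \<sigma> a N k)" by (simp add: tendsto_prob_def)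
    qed
    then have "sqmean (\<lambda>\<omega>. 1 * (X ?t \<omega> - scheme B \<sigma> a N k \<omega>)) \<le> ennreal (K * exp (24 * L^2) / (real N)^2)"
    proof (rule fatou_prob[rotated 3])
      show "sqmean (\<lambda>\<omega>. 1 * (?Y m \<omega> - scheme B \<sigma> a N k \<omega>)) \<le> ennreal (K * exp (24 * L^2) / (real N)^2)" for m
        using euler_scheme[OF N _ k, of "Suc (m + N)"] by (simp del: mult_Suc_right)
    qed (use Ym Sm Xm in measurable)
    then show "sqmean (\<lambda>\<omega>. X ?t \<omega> - scheme B \<sigma> a N k \<omega>) \<le> ennreal (K * exp (24 * L^2) / (real N)^2)" by simp
  qed
qed

text \<open>
  Each step multiplies by a Wick exponential, and these multiply to the geometric Brownian motion.
\<close>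

lemma scheme_linear:
  assumes lin: "\<And>x. \<sigma> x = \<alpha> * x"
  shows "scheme B \<sigma> a N k \<omega> = a * exp (\<alpha> * (B (real k / real N) \<omega> - B 0 \<omega>) - \<alpha>^2 * (real k / real N) / 2)"
proof (induction k)
  case (Suc k)
  have "(\<sigma> has_real_derivative \<alpha>) (at x)" for x
    unfolding lin[abs_def] by (auto intro!: derivative_eq_intros)
  then have d: "deriv \<sigma> x = \<alpha>" for x by (rule DERIV_imp_deriv)
  have w: "x + wick_step (\<alpha> * x) \<alpha> b t = x * exp (\<alpha> * b - \<alpha>^2 * t / 2)" for x b t
    by (simp add: wick_step_def algebra_simps)
  have "\<alpha> * (B (real k / real N) \<omega> - B 0 \<omega>) - \<alpha>^2 * (real k / real N) / 2
      + (\<alpha> * dB N k \<omega> - \<alpha>^2 * (1 / real N) / 2)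
      = \<alpha> * (B (real (Suc k) / real N) \<omega> - B 0 \<omega>) - \<alpha>^2 * (real (Suc k) / real N) / 2"
    by (simp add: algebra_simps add_divide_distrib)
  then show ?case
    unfolding scheme_Suc lin[of "scheme B \<sigma> a N k \<omega>"] d w unfolding Suc.IH by (simp only: mult.assoc exp_add[symmetric])
qed simp

end

lemma C1_bounded_deriv_has_derivative:
  "C1_bounded_deriv f \<Longrightarrow> (f has_real_derivative deriv f x) (at x)"
  by (simp add: C1_bounded_deriv_def DERIV_deriv_iff_real_differentiable)

lemma C1_bounded_deriv_lipschitz:
  assumes f: "C1_bounded_deriv f"
  shows "\<exists>L\<ge>0. (\<forall>x. \<bar>deriv f x\<bar> \<le> L) \<and> (\<forall>x y. \<bar>f x - f y\<bar> \<le> L * \<bar>x - y\<bar>)"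
proof -
  from f have "bounded (range (deriv f))" by (simp add: C1_bounded_deriv_def)
  then obtain L where "\<forall>x\<in>range (deriv f). norm x \<le> L" unfolding bounded_iff by blast
  then have L: "\<bar>deriv f x\<bar> \<le> L" for x by auto
  then have "0 \<le> L" using abs_ge_zero[of "deriv f 0"] order_trans by blast
  moreover have "\<bar>f x - f y\<bar> \<le> L * \<bar>x - y\<bar>" for x y
    using field_differentiable_bound[of UNIV f "deriv f" L x y] C1_bounded_deriv_has_derivative[OF f] L by simp
  ultimately show ?thesis using L by blast
qed

theorem theorem1p1:
  fixes M :: "'w measure"
    and B X :: "real \<Rightarrow> 'w \<Rightarrow> real"
    and \<sigma> :: "real \<Rightarrow> real"
    and a :: real
  assumes "brownian_motion M B"
    and "\<sigma> \<in> borel_measurable borel"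
    and "C1_bounded_deriv \<sigma>"
    and "C1_bounded_deriv (\<lambda>x. \<sigma> x * deriv \<sigma> x)"
    and "strong_solution M B \<sigma> a X"
  shows "(\<exists>c>0. \<forall>N\<ge>1.
            integrable M (\<lambda>\<omega>. \<bar>X 1 \<omega> - scheme B \<sigma> a N N \<omega>\<bar>) \<and>
            (\<integral>\<omega>. \<bar>X 1 \<omega> - scheme B \<sigma> a N N \<omega>\<bar> \<partial>M) \<le> c / real N) \<and>
         (\<forall>\<alpha>. (\<forall>x. \<sigma> x = \<alpha> * x) \<longrightarrow>
            (\<forall>N\<ge>1. AE \<omega> in M. \<forall>k\<in>{0..N}. scheme B \<sigma> a N k \<omega> = X (real k / real N) \<omega>))"
proof -
  obtain L1 where L1: "0 \<le> L1" "\<And>x. \<bar>deriv \<sigma> x\<bar> \<le> L1" "\<And>x y. \<bar>\<sigma> x - \<sigma> y\<bar> \<le> L1 * \<bar>x - y\<bar>"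
    using C1_bounded_deriv_lipschitz[OF assms(3)] by blast
  obtain L2 where L2: "0 \<le> L2" "\<And>x y. \<bar>\<sigma> x * deriv \<sigma> x - \<sigma> y * deriv \<sigma> y\<bar> \<le> L2 * \<bar>x - y\<bar>"
    using C1_bounded_deriv_lipschitz[OF assms(4)] by blast
  define L where "L = 1 + L1 + L2"
  have L_le: "L1 * \<bar>x - y\<bar> \<le> L * \<bar>x - y\<bar>" "L2 * \<bar>x - y\<bar> \<le> L * \<bar>x - y\<bar>" for x y :: real
    using L1(1) L2(1) by (auto simp: L_def intro!: mult_right_mono)
  interpret wick_sde M B \<sigma> a X L
  proof
    show "brownian_motion M B" by fact
    show "(\<sigma> has_real_derivative deriv \<sigma> x) (at x)" for x by (rule C1_bounded_deriv_has_derivative[OF assms(3)])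
    show "continuous_on UNIV (deriv \<sigma>)" using assms(3) by (simp add: C1_bounded_deriv_def)
    show "1 \<le> L" using L1(1) L2(1) by (simp add: L_def)
    show "\<bar>deriv \<sigma> x\<bar> \<le> L" for x using L1(2)[of x] L2(1) by (simp add: L_def)
    show "\<bar>\<sigma> x - \<sigma> y\<bar> \<le> L * \<bar>x - y\<bar>" for x y using L1(3) L_le(1) by (rule order_trans)
    show "\<bar>\<sigma> x * deriv \<sigma> x - \<sigma> y * deriv \<sigma> y\<bar> \<le> L * \<bar>x - y\<bar>" for x y using L2(2) L_le(2) by (rule order_trans)
    show "strong_solution M B \<sigma> a X" by fact
  qed
  obtain C where C: "0 \<le> C" and err: "\<And>N k. 0 < N \<Longrightarrow> k \<le> N \<Longrightarrow>
      sqmean (\<lambda>\<omega>. X (real k / real N) \<omega> - scheme B \<sigma> a N k \<omega>) \<le> ennreal (C / (real N)^2)"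
    using scheme_mean_square_error by blast
  have part1: "integrable M (\<lambda>\<omega>. \<bar>X 1 \<omega> - scheme B \<sigma> a N N \<omega>\<bar>) \<and>
            (\<integral>\<omega>. \<bar>X 1 \<omega> - scheme B \<sigma> a N N \<omega>\<bar> \<partial>M) \<le> (C + 1) / real N" if N: "1 \<le> N" for N
  proof -
    define f where "f \<omega> = X 1 \<omega> - scheme B \<sigma> a N N \<omega>" for \<omega>
    have [measurable]: "f \<in> borel_measurable M"
      unfolding f_def using X_measurable[of 1] scheme_measurable[of N N] N by (intro borel_measurable_diff) auto
    have sq: "sqmean f \<le> ennreal (C / (real N)^2)"
      using err[of N N] N by (simp add: f_def[abs_def])
    have int2: "integrable M (\<lambda>\<omega>. (f \<omega>)^2)"
    proof (rule integrableI_nonneg)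
      show "(\<integral>\<^sup>+\<omega>. ennreal ((f \<omega>)^2) \<partial>M) < \<infinity>"
        using sq unfolding sqmean_def by (rule le_less_trans) simp
    qed auto
    have "ennreal (\<integral>\<omega>. (f \<omega>)^2 \<partial>M) = sqmean f"
      unfolding sqmean_def by (rule nn_integral_eq_integral[symmetric, OF int2]) simp
    then have "ennreal (\<integral>\<omega>. (f \<omega>)^2 \<partial>M) \<le> ennreal (C / (real N)^2)" using sq by simp
    then have sq': "(\<integral>\<omega>. (f \<omega>)^2 \<partial>M) \<le> C / (real N)^2" using C by (simp add: ennreal_le_iff)
    \<comment> \<open>The weight N gives both summands a mean of order 1/N.\<close>
    have young: "\<bar>f \<omega>\<bar> \<le> real N * (f \<omega>)^2 + 1 / real N" for \<omega>
    proof -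
      have N0: "0 < real N" using N by simp
      have "0 \<le> (real N * \<bar>f \<omega>\<bar> - 1)^2" by simp
      then have "2 * (real N * \<bar>f \<omega>\<bar>) \<le> (real N)^2 * (f \<omega>)^2 + 1"
        by (simp add: power2_diff power_mult_distrib)
      then have "real N * \<bar>f \<omega>\<bar> \<le> (real N)^2 * (f \<omega>)^2 + 1"
        using N0 by (smt (verit) abs_ge_zero mult_nonneg_nonneg)
      then have "\<bar>f \<omega>\<bar> \<le> ((real N)^2 * (f \<omega>)^2 + 1) / real N"
        using N0 by (simp add: pos_le_divide_eq mult.commute)
      then show ?thesis using N0 by (simp add: add_divide_distrib power2_eq_square)
    qed
    have int_b: "integrable M (\<lambda>\<omega>. real N * (f \<omega>)^2 + 1 / real N)" using int2 by simp
    have int1: "integrable M (\<lambda>\<omega>. \<bar>f \<omega>\<bar>)"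
    proof (rule Bochner_Integration.integrable_bound[OF int_b])
      show "AE \<omega> in M. norm \<bar>f \<omega>\<bar> \<le> norm (real N * (f \<omega>)^2 + 1 / real N)"
      proof (rule AE_I2)
        fix \<omega>
        show "norm \<bar>f \<omega>\<bar> \<le> norm (real N * (f \<omega>)^2 + 1 / real N)" using young[of \<omega>] by simp
      qed
    qed measurable
    have "(\<integral>\<omega>. \<bar>f \<omega>\<bar> \<partial>M) \<le> (\<integral>\<omega>. real N * (f \<omega>)^2 + 1 / real N \<partial>M)"
      by (rule integral_mono[OF int1 int_b young])
    also have "\<dots> = real N * (\<integral>\<omega>. (f \<omega>)^2 \<partial>M) + 1 / real N"
      using int2 by (simp add: prob_space)
    also have "\<dots> \<le> real N * (C / (real N)^2) + 1 / real N"
      using sq' by (intro add_right_mono mult_left_mono) auto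
    also have "\<dots> = (C + 1) / real N" using N by (simp add: power2_eq_square add_divide_distrib)
    finally show ?thesis using int1 by (simp add: f_def)
  qed
  have part2: "AE \<omega> in M. \<forall>k\<in>{0..N}. scheme B \<sigma> a N k \<omega> = X (real k / real N) \<omega>"
    if lin: "\<forall>x. \<sigma> x = \<alpha> * x" and N: "1 \<le> N" for \<alpha> N
  proof -
    have "AE \<omega> in M. scheme B \<sigma> a N k \<omega> = X (real k / real N) \<omega>" if k: "k \<le> N" for k
    proof -
      let ?f = "\<lambda>\<omega>. X (real k / real N) \<omega> - scheme B \<sigma> a N k \<omega>"
      have N0: "0 < N" using N by simp
      have fm [measurable]: "?f \<in> borel_measurable M"
        using X_measurable[OF grid_point[OF N0 k]] scheme_measurable[OF N0 k] by (rule borel_measurable_diff)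
      have "sqmean ?f \<le> ennreal (C / (real (N * Suc p))^2)" for p
      proof -
        have "k * Suc p \<le> N * Suc p" using k by (rule mult_le_mono1)
        moreover have "0 < N * Suc p" using N0 by simp
        moreover have "scheme B \<sigma> a (N * Suc p) (k * Suc p) \<omega> = scheme B \<sigma> a N k \<omega>" for \<omega>
          using lin by (simp only: scheme_linear[of \<alpha>] grid_ratio)
        ultimately show ?thesis using err[of "N * Suc p" "k * Suc p"] by (simp only: grid_ratio)
      qed
      moreover have "(\<lambda>p. ennreal (C / (real (N * Suc p))^2)) \<longlonglongrightarrow> ennreal 0"
      proof (rule tendsto_ennrealI)
        have "(\<lambda>p. C / (real N)^2 * (inverse (real (Suc p)))^2) \<longlonglongrightarrow> C / (real N)^2 * 0^2"
          by (intro tendsto_intros LIMSEQ_inverse_real_of_nat)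
        moreover have "C / (real (N * Suc p))^2 = C / (real N)^2 * (inverse (real (Suc p)))^2" for p
          by (simp only: of_nat_mult power_mult_distrib divide_inverse inverse_mult_distrib power_inverse mult.assoc)
        ultimately show "(\<lambda>p. C / (real (N * Suc p))^2) \<longlonglongrightarrow> 0" by simp
      qed
      ultimately have "sqmean ?f \<le> ennreal 0" by (intro LIMSEQ_le_const) auto
      then have "(\<integral>\<^sup>+\<omega>. ennreal ((?f \<omega>)^2) \<partial>M) = 0" by (simp add: sqmean_def)
      then have "AE \<omega> in M. ennreal ((?f \<omega>)^2) = 0"
        by (subst (asm) nn_integral_0_iff_AE) auto
      then show ?thesis by eventually_elim simp
    qed
    then show ?thesis by (intro AE_finite_allI) auto
  qed
  show ?thesis using part1 part2 C by (intro conjI exI[of _ "C + 1"]) auto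
qed

end
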